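(* Let $k,l$ be natural numbers with $1<k\le l$ and let $m=k+l-1$. Every $112m^2$-edge-connected simple graph whose number of edges is divisible by $m$ has an $S(k,l)$-decomposition.
   Context: $S(k,l)$ denotes the bistar: the tree consisting of two adjacent vertices of degrees $k$ and $l$ respectively, all other vertices being leaves. An $H$-decomposition of a graph $G$ is a partition of $E(G)$ into subgraphs isomorphic to $H$. *)

theory Defs
  imports Main
begin

definition simple_graph :: "'a set \<Rightarrow> 'a set set \<Rightarrow> bool" where
  "simple_graph V E \<longleftrightarrow> finite V \<and>
     (\<forall>e\<in>E. \<exists>u v. e = {u, v} \<and> u \<noteq> v \<and> u \<in> V \<and> v \<in> V)"

definition adj :: "'a set set \<Rightarrow> 'a \<Rightarrow> 'a \<Rightarrow> bool" where
  "adj E u v \<longleftrightarrow> {u, v} \<in> E"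

definition connected_graph :: "'a set \<Rightarrow> 'a set set \<Rightarrow> bool" where
  "connected_graph V E \<longleftrightarrow> V \<noteq> {} \<and> (\<forall>u\<in>V. \<forall>v\<in>V. (adj E)\<^sup>*\<^sup>* u v)"

definition edge_connected :: "nat \<Rightarrow> 'a set \<Rightarrow> 'a set set \<Rightarrow> bool" where
  "edge_connected lam V E \<longleftrightarrow>
     (\<forall>F. F \<subseteq> E \<and> card F < lam \<longrightarrow> connected_graph V (E - F))"

text \<open>The bistar S(k,l) on vertex set nat: centres 0 and 1 (adjacent), 0 has leaves
  2..k (k-1 leaves, degree k), 1 has leaves k+1..k+l-1 (l-1 leaves, degree l).\<close>
definition bistar :: "nat \<Rightarrow> nat \<Rightarrow> nat set set" where
  "bistar k l = {{0, 1}} \<union> {{0, a} | a. 2 \<le> a \<and> a \<le> k}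
                         \<union> {{1, b} | b. k + 1 \<le> b \<and> b \<le> k + l - 1}"

text \<open>Isomorphism of graphs without isolated vertices, given by their edge sets
  (vertex set = union of the edges).\<close>
definition edge_iso :: "'a set set \<Rightarrow> 'b set set \<Rightarrow> bool" where
  "edge_iso F H \<longleftrightarrow> (\<exists>f. bij_betw f (\<Union>F) (\<Union>H) \<and> (\<lambda>e. f ` e) ` F = H)"

definition has_decomposition :: "'b set set \<Rightarrow> 'a set set \<Rightarrow> bool" where
  "has_decomposition H E \<longleftrightarrow> (\<exists>P. \<Union>P = E \<and>
      (\<forall>X\<in>P. \<forall>Y\<in>P. X \<noteq> Y \<longrightarrow> X \<inter> Y = {}) \<and>
      (\<forall>X\<in>P. edge_iso X H))"

end

theory Submission
  imports Defs "HOL-Number_Theory.Cong"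
begin

text \<open>A maximum cut \<open>A\<close> retains half of every cut, so the bipartite graph between \<open>A\<close> and its
  complement has all cuts of size at least \<open>56 * m\<^sup>2\<close>. From the edges inside the two sides a maximal
  family of disjoint bistars is removed; what remains of them is degenerate, hence orientable with
  out-degrees less than \<open>m\<close>. The bipartite graph is oriented such that in-degree and out-degree almost
  agree across every cut, and Edmonds' branching theorem reserves three highly connected subgraphs
  \<open>R1\<close>, \<open>R2\<close>, \<open>R3\<close> in which few arcs enter any vertex. The other arcs suffice to extend each
  degenerate edge to a bistar.

  It remains to decompose a bipartite graph that contains \<open>R1\<close>, \<open>R2\<close>, \<open>R3\<close>. An orientation modulo \<open>m\<close>,
  made possible by \<open>R3\<close>, splits it into one part whose degrees in \<open>A\<close> are divisible by \<open>m\<close> and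
  one part whose degrees outside of \<open>A\<close> are. In such a part each vertex of the divisible side is to be the
  \<open>l\<close>-centre of as many bistars as its degree permits. The edges at the \<open>k\<close>-centres are a subgraph with
  prescribed degrees, about \<open>k / m\<close> times the original ones; on the other side these are rounded to
  multiples of \<open>k\<close>, where an orientation modulo \<open>m\<close> of \<open>R1\<close> or \<open>R2\<close> keeps the rounding errors
  below the cut sizes. The central edges are chosen among them by the same theorem on
  degree-constrained subgraphs, and the leaves are distributed arbitrarily, which is possible because
  bipartite graphs have no triangles.

  Orientations with prescribed out-degrees modulo \<open>k\<close> exist as soon as all cuts have size at least
  \<open>12 * k\<close>. As in the work of Lovasz, Thomassen, Wu and Zhang, small cuts are contracted, edges are
  deleted where the degree condition has room, and otherwise a vertex is eliminated by pairing up its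
  edges.\<close>

section \<open>Orientations modulo an integer\<close>

text \<open>Divisibility of degrees by \<open>m\<close> is arranged on one side only, hence the
  split into two parts and two reserved subgraphs, one kept whole inside each part; the third pays
  for the split itself. Orientations modulo \<open>m\<close> cost cuts of \<open>12 * m\<close>,
  which fixes \<open>R3\<close>; replacing stars by complete graphs may halve a cut, so
  \<open>R1\<close> and \<open>R2\<close> need \<open>24 * m\<close>. Together they use at most
  \<open>60 * m\<close> entering arcs at any vertex. With \<open>n = 28 * m\<^sup>2\<close> the
  bipartite graph has cuts of \<open>2 * n\<close>, and its orientation gives every vertex other
  than in a one-vertex graph at least \<open>n - 6\<close> entering arcs. These cover the reserve,
  at most \<open>20 * m\<^sup>2\<close> because \<open>m \<ge> 3\<close>, and the needs of the
  degenerate edges. That is the origin of \<open>112 = 2 * 2 * 28\<close>. A rounding of degrees is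
  usable only if its error on every set is bounded by a fraction of the cut of that set; a bound at
  each vertex is too weak. This is why the residues come from an orientation, whose net flow out of
  a set never exceeds the cut.\<close>

definition ecut :: "'a set \<Rightarrow> ('a \<Rightarrow> 'a \<Rightarrow> nat) \<Rightarrow> ('a \<Rightarrow> nat) \<Rightarrow> 'a set \<Rightarrow> nat" where
  "ecut V w h A = (\<Sum>x\<in>A. h x + (\<Sum>y\<in>V - A. w x y))"

text \<open>\<open>h x\<close> counts the edges from \<open>x\<close> to the outer vertex, which
  lies outside of every set; the cut of \<open>V\<close> itself therefore consists of all outer
  edges.\<close>

lemma ecut_whole: "ecut V w h V = sum h V"
  by (simp add: ecut_def)

lemma ecut_singleton: "ecut V w h {x} = h x + (\<Sum>y\<in>V - {x}. w x y)"
  by (simp add: ecut_def)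

lemma ecut_union:
  assumes "finite V" "A \<subseteq> V" "B \<subseteq> V" "A \<inter> B = {}" and sym: "\<And>x y. w x y = w y x"
  shows "ecut V w h (A \<union> B) + 2 * (\<Sum>x\<in>A. \<Sum>y\<in>B. w x y) = ecut V w h A + ecut V w h B"
proof -
  have fin: "finite A" "finite B" using assms(1-3) finite_subset by auto
  have A: "V - A = B \<union> (V - (A \<union> B))" and B: "V - B = A \<union> (V - (A \<union> B))" using assms by auto
  have "ecut V w h A = (\<Sum>x\<in>A. h x + (\<Sum>y\<in>V - (A \<union> B). w x y)) + (\<Sum>x\<in>A. \<Sum>y\<in>B. w x y)"
    unfolding ecut_def A using fin assms
    by (subst sum.union_disjoint) (auto simp: sum.distrib)
  moreover have "ecut V w h B = (\<Sum>x\<in>B. h x + (\<Sum>y\<in>V - (A \<union> B). w x y)) + (\<Sum>x\<in>B. \<Sum>y\<in>A. w x y)"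
    unfolding ecut_def B using fin assms
    by (subst sum.union_disjoint) (auto simp: sum.distrib)
  moreover have "(\<Sum>x\<in>B. \<Sum>y\<in>A. w x y) = (\<Sum>x\<in>A. \<Sum>y\<in>B. w x y)"
    by (subst sum.swap) (simp add: sym)
  moreover have "ecut V w h (A \<union> B) = (\<Sum>x\<in>A. h x + (\<Sum>y\<in>V - (A \<union> B). w x y))
      + (\<Sum>x\<in>B. h x + (\<Sum>y\<in>V - (A \<union> B). w x y))"
    unfolding ecut_def using fin assms by (simp add: sum.union_disjoint)
  ultimately show ?thesis by simp
qed

text \<open>Adding the vertices one by one, each union loses an even number of edges, so the cut is
  bounded by the degree sum and has its parity.\<close>

lemma ecut_insert_le:
  assumes "finite V" "A \<subseteq> V" and sym: "\<And>x y. w x y = w y x"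
  shows "ecut V w h A \<le> (\<Sum>x\<in>A. ecut V w h {x})"
    and "even (ecut V w h A + (\<Sum>x\<in>A. ecut V w h {x}))"
proof -
  have "finite A" using assms(1,2) finite_subset by auto
  then have "A \<subseteq> V \<Longrightarrow> ecut V w h A \<le> (\<Sum>x\<in>A. ecut V w h {x})
    \<and> even (ecut V w h A + (\<Sum>x\<in>A. ecut V w h {x}))"
  proof (induction A rule: finite_induct)
    case empty
    then show ?case by (simp add: ecut_def)
  next
    case (insert a A)
    have "ecut V w h ({a} \<union> A) + 2 * (\<Sum>x\<in>{a}. \<Sum>y\<in>A. w x y) = ecut V w h {a} + ecut V w h A"
      by (rule ecut_union) (use insert assms in auto)
    then have u: "ecut V w h (insert a A) + 2 * (\<Sum>y\<in>A. w a y) = ecut V w h {a} + ecut V w h A"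
      by simp
    have IH: "ecut V w h A \<le> (\<Sum>x\<in>A. ecut V w h {x})" "even (ecut V w h A + (\<Sum>x\<in>A. ecut V w h {x}))"
      using insert by auto
    let ?S = "\<Sum>x\<in>A. ecut V w h {x}"
    have "ecut V w h (insert a A) + (ecut V w h {a} + ?S) + 2 * (\<Sum>y\<in>A. w a y)
        = (ecut V w h A + ?S) + 2 * ecut V w h {a}"
      using u by linarith
    moreover have "even ((ecut V w h A + ?S) + 2 * ecut V w h {a})" using IH by simp
    ultimately have "even (ecut V w h (insert a A) + (ecut V w h {a} + ?S))"
      by (metis dvd_add_left_iff dvd_triv_left)
    then show ?case using insert.hyps IH u by simp
  qed
  then show "ecut V w h A \<le> (\<Sum>x\<in>A. ecut V w h {x})"
    "even (ecut V w h A + (\<Sum>x\<in>A. ecut V w h {x}))" using assms by auto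
qed

lemma ecut_remove:
  assumes "finite V" "x \<in> V" and sym: "\<And>x y. w x y = w y x"
  shows "ecut V w h (V - {x}) + 2 * h x = sum h V + ecut V w h {x}"
proof -
  have "ecut V w h ({x} \<union> (V - {x})) + 2 * (\<Sum>u\<in>{x}. \<Sum>y\<in>V - {x}. w u y)
     = ecut V w h {x} + ecut V w h (V - {x})"
    by (rule ecut_union) (use assms in auto)
  moreover have "{x} \<union> (V - {x}) = V" using assms by auto
  ultimately show ?thesis by (simp add: ecut_whole ecut_singleton)
qed

lemma ecut_add:
  "ecut V (\<lambda>x y. w x y + e x y) (\<lambda>x. h x + g x) A = ecut V w h A + ecut V e g A"
  by (simp add: ecut_def sum.distrib)

text \<open>The distance from \<open>j\<close> to the nearest multiple of \<open>q\<close>. For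
  \<open>q = 2 * k\<close> it lies between 0 and \<open>k\<close>, and moving \<open>j\<close> by
  one towards such a multiple lowers it by exactly one. It is the variable part of the degree
  demanded of a vertex.\<close>

definition nrm :: "int \<Rightarrow> int \<Rightarrow> int" where
  "nrm q j = min (j mod q) ((- j) mod q)"

lemma nrm_le: "0 < k \<Longrightarrow> nrm (2 * k) j \<le> k"
  unfolding nrm_def zmod_zminus1_eq_if by auto

lemma nrm_nonneg: "0 < k \<Longrightarrow> 0 \<le> nrm (2 * k) j"
  unfolding nrm_def by auto

lemma nrm_dec:
  assumes "0 < k" "0 < j mod (2 * k)" "j mod (2 * k) \<le> k"
  shows "nrm (2 * k) (j - 1) = nrm (2 * k) j - 1"
proof -
  have 1: "(j - 1) mod (2 * k) = j mod (2 * k) - 1"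
  proof -
    have "(j - 1) mod (2 * k) = (j mod (2 * k) - 1) mod (2 * k)" by (simp add: mod_diff_left_eq)
    also have "\<dots> = j mod (2 * k) - 1" using assms by (intro mod_pos_pos_trivial) auto
    finally show ?thesis .
  qed
  show ?thesis unfolding nrm_def zmod_zminus1_eq_if[of _ "2 * k"] 1 using assms by auto
qed

lemma nrm_minus: "nrm q (- j) = nrm q j"
  by (simp add: nrm_def min.commute)

lemma nrm_inc:
  assumes "0 < k" "k \<le> j mod (2 * k)"
  shows "nrm (2 * k) (j + 1) = nrm (2 * k) j - 1"
proof -
  have "j mod (2 * k) < 2 * k" using assms by auto
  then have "nrm (2 * k) (- j - 1) = nrm (2 * k) (- j) - 1"
    using assms by (intro nrm_dec) (auto simp: zmod_zminus1_eq_if[of _ "2 * k"])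
  moreover have "- j - 1 = - (j + 1)" by simp
  ultimately show ?thesis by (metis nrm_minus)
qed

text \<open>A graph on \<open>V\<close> with edge multiplicities \<open>w\<close> together with an outer vertex whose edges
  are already oriented: \<open>ho x\<close> of them enter \<open>x\<close> and \<open>hi x\<close> of them leave \<open>x\<close>. The orientation
  \<open>d\<close> is to achieve out-degree minus in-degree \<open>b x\<close> modulo \<open>2 * k\<close> at every \<open>x\<close>.\<close>
definition orientable :: "nat \<Rightarrow> 'a set \<Rightarrow> ('a \<Rightarrow> 'a \<Rightarrow> nat) \<Rightarrow> ('a \<Rightarrow> nat) \<Rightarrow> ('a \<Rightarrow> nat) \<Rightarrow> ('a \<Rightarrow> int) \<Rightarrow> bool" where
  "orientable k V w ho hi b \<longleftrightarrow> (\<exists>d. (\<forall>x\<in>V. \<forall>y\<in>V. d x y + d y x = w x y) \<and>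
     (\<forall>x\<in>V. [(\<Sum>y\<in>V. int (d x y) - int (d y x)) + int (hi x) - int (ho x) = b x] (mod (2 * int k))))"

text \<open>Contracting a small set leaves at most \<open>18 * k\<close> outer edges. If all outer edges have the same
  direction, eliminating a vertex may add up to \<open>2 * k\<close> outer edges of the other direction.\<close>
definition slack :: "nat \<Rightarrow> nat \<Rightarrow> nat \<Rightarrow> bool" where
  "slack k p q \<longleftrightarrow> p + q \<le> 18 * k \<or> (p \<le> 18 * k \<and> q \<le> 2 * k) \<or> (p \<le> 2 * k \<and> q \<le> 18 * k)"

text \<open>Parity and congruence are necessary: out-degree minus in-degree has the parity of the
  degree, and summed over \<open>V\<close> the inner edges cancel, so that only the outer edges
  contribute.\<close>

definition consistent :: "nat \<Rightarrow> 'a set \<Rightarrow> ('a \<Rightarrow> 'a \<Rightarrow> nat) \<Rightarrow> ('a \<Rightarrow> nat) \<Rightarrow> ('a \<Rightarrow> nat) \<Rightarrow> ('a \<Rightarrow> int) \<Rightarrow> bool" where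
  "consistent k V w ho hi b \<longleftrightarrow> finite V \<and> (\<forall>x y. w x y = w y x) \<and> (\<forall>x. w x x = 0) \<and>
     (\<forall>x\<in>V. even (b x + int (ecut V w (\<lambda>x. ho x + hi x) {x}))) \<and>
     [(\<Sum>x\<in>V. b x) = (\<Sum>x\<in>V. int (hi x) - int (ho x))] (mod (2 * int k))"

text \<open>Demanding \<open>11 * k\<close> plus the distance of the target from 0, rather than
  \<open>12 * k\<close>, permits the deletion of an edge whenever this moves the target towards 0.
  The excluded cases, the set \<open>V\<close> and a sole vertex, have cuts made of outer edges
  only, which \<open>slack\<close> controls.\<close>

definition admissible :: "nat \<Rightarrow> 'a set \<Rightarrow> ('a \<Rightarrow> 'a \<Rightarrow> nat) \<Rightarrow> ('a \<Rightarrow> nat) \<Rightarrow> ('a \<Rightarrow> nat) \<Rightarrow> ('a \<Rightarrow> int) \<Rightarrow> bool" where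
  "admissible k V w ho hi b \<longleftrightarrow> consistent k V w ho hi b \<and> slack k (sum ho V) (sum hi V) \<and>
     (\<forall>x\<in>V. V \<noteq> {x} \<longrightarrow> 11 * int k + nrm (2 * int k) (b x) \<le> int (ecut V w (\<lambda>x. ho x + hi x) {x})) \<and>
     (\<forall>A\<subseteq>V. A \<noteq> V \<longrightarrow> 2 \<le> card A \<longrightarrow> 12 * k \<le> ecut V w (\<lambda>x. ho x + hi x) A)"

lemma sub_sum:
  fixes s :: "'a \<Rightarrow> nat"
  assumes "finite V" "t \<le> sum s V"
  shows "\<exists>g. (\<forall>x. g x \<le> s x) \<and> sum g V = t"
  using assms
proof (induction V arbitrary: t rule: finite_induct)
  case empty
  then show ?case by (intro exI[of _ "\<lambda>_. 0"]) auto
next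
  case (insert a V)
  have "t - min t (s a) \<le> sum s V" using insert by auto
  then obtain g where g: "\<forall>x. g x \<le> s x" "sum g V = t - min t (s a)" using insert by blast
  have "sum (g(a := min t (s a))) V = sum g V" using insert by (intro sum.cong) auto
  then show ?case using insert g by (intro exI[of _ "g(a := min t (s a))"]) auto
qed

lemma orientable_singleton:
  assumes "consistent k {x} w ho hi b"
  shows "orientable k {x} w ho hi b"
  using assms unfolding consistent_def orientable_def
  by (intro exI[of _ "\<lambda>_ _. 0"]) (auto simp: cong_sym_eq)

text \<open>With \<open>k - 1\<close> parallel edges every residue of the right parity can be attained at \<open>x\<close>.\<close>
lemma orientable_pair:
  assumes con: "consistent k {x, y} w ho hi b" and "x \<noteq> y" and w: "k - 1 \<le> w x y" and k: "0 < k"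
  shows "orientable k {x, y} w ho hi b"
proof -
  let ?q = "2 * int k"
  have sym: "w y x = w x y" and z: "w x x = 0" "w y y = 0" using con by (auto simp: consistent_def)
  have ev: "even (b x + int (ho x) + int (hi x) + int (w x y))"
  proof -
    have "{x, y} - {x} = {y}" using \<open>x \<noteq> y\<close> by auto
    then have "ecut {x, y} w (\<lambda>x. ho x + hi x) {x} = ho x + hi x + w x y" by (simp add: ecut_singleton)
    moreover have "even (b x + int (ecut {x, y} w (\<lambda>x. ho x + hi x) {x}))"
      using con by (auto simp: consistent_def)
    ultimately show ?thesis by (simp add: algebra_simps)
  qed
  have "even (b x - int (hi x) + int (ho x) + int (w x y))" using ev by presburger
  then obtain c where c: "b x - int (hi x) + int (ho x) + int (w x y) = 2 * c" by (elim evenE)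
  \<comment> \<open>Only \<open>2 * j\<close> modulo \<open>2 * k\<close> matters at
    \<open>x\<close>, so \<open>j\<close> can be taken below \<open>k\<close> and hence at most
    \<open>w x y\<close>.\<close>
  define j where "j = nat (c mod int k)"
  have j: "int j = c mod int k" using k by (simp add: j_def)
  then have jw: "j \<le> w x y" using w k pos_mod_bound[of "int k" c] by linarith
  define d where "d = (\<lambda>u v. if u = x \<and> v = y then j else if u = y \<and> v = x then w x y - j else 0)"
  have dd: "d x y = j" "d y x = w x y - j" "d x x = 0" "d y y = 0" using \<open>x \<noteq> y\<close> by (auto simp: d_def)
  have cj: "[2 * int j = 2 * c] (mod ?q)"
    unfolding j cong_def by (metis mod_mult_mult1 mod_mod_trivial)
  have X: "[int j - (int (w x y) - int j) + int (hi x) - int (ho x) = b x] (mod ?q)"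
  proof -
    have "[2 * int j + (int (hi x) - int (ho x) - int (w x y)) = 2 * c + (int (hi x) - int (ho x) - int (w x y))] (mod ?q)"
      using cj by (simp add: cong_add)
    then show ?thesis unfolding c[symmetric] by (simp add: algebra_simps)
  qed
  \<comment> \<open>The condition at \<open>y\<close> requires no further choice: it is the
    congruence for the sum of the targets minus the one at \<open>x\<close>.\<close>
  have S: "[b x + b y = int (hi x) - int (ho x) + (int (hi y) - int (ho y))] (mod ?q)"
    using con \<open>x \<noteq> y\<close> by (simp add: consistent_def)
  have Y: "[(int (w x y) - int j) - int j + int (hi y) - int (ho y) = b y] (mod ?q)"
    using cong_diff[OF cong_sym[OF S] X] by (simp add: algebra_simps)
  show ?thesis unfolding orientable_def
    by (intro exI[of _ d]) (use X Y \<open>x \<noteq> y\<close> sym z jw in \<open>auto simp: dd algebra_simps\<close>)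
qed

section \<open>Contraction of a vertex set\<close>

definition contract :: "'a set \<Rightarrow> 'a \<Rightarrow> ('a \<Rightarrow> 'a \<Rightarrow> nat) \<Rightarrow> 'a \<Rightarrow> 'a \<Rightarrow> nat" where
  "contract A a w u v = (if u = a then if v = a then 0 else (\<Sum>x\<in>A. w x v)
     else if v = a then (\<Sum>x\<in>A. w u x) else w u v)"

definition collect_at :: "'a set \<Rightarrow> 'a \<Rightarrow> ('a \<Rightarrow> 'b::comm_monoid_add) \<Rightarrow> 'a \<Rightarrow> 'b" where
  "collect_at A a h x = (if x = a then sum h A else h x)"

lemma sum_collect_at:
  assumes "finite V" "A \<subseteq> V" "a \<in> A"
  shows "sum (collect_at A a h) (insert a (V - A)) = sum h V"
proof -
  have "sum (collect_at A a h) (insert a (V - A)) = sum h A + sum h (V - A)"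
  proof -
    have "sum (collect_at A a h) (V - A) = sum h (V - A)"
      using assms by (intro sum.cong) (auto simp: collect_at_def)
    moreover have "collect_at A a h a = sum h A" by (simp add: collect_at_def)
    ultimately show ?thesis using assms by (subst sum.insert) auto
  qed
  also have "\<dots> = sum h V" using assms by (subst add.commute, intro sum.subset_diff[symmetric])
  finally show ?thesis .
qed

text \<open>The vertex \<open>a\<close> represents the whole of \<open>A\<close>, and edges inside
  \<open>A\<close> disappear. A set containing \<open>a\<close> thus has the cut of its union with
  \<open>A\<close>; every other set keeps its cut.\<close>

lemma ecut_contract:
  assumes fin: "finite V" and A: "A \<subseteq> V" "a \<in> A" and X: "X \<subseteq> insert a (V - A)"
  shows "ecut (insert a (V - A)) (contract A a w) (collect_at A a h) X
    = ecut V w h (if a \<in> X then A \<union> X else X)"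
proof (cases "a \<in> X")
  case True
  define Y where "Y = X - {a}"
  have Y: "X = insert a Y" "a \<notin> Y" "Y \<subseteq> V - A" "finite Y" using True X fin A
    by (auto simp: Y_def intro: finite_subset[OF _ fin])
  have 1: "insert a (V - A) - X = V - (A \<union> Y)" using Y A by auto
  have fA: "finite A" using A(1) fin by (rule finite_subset)
  have "ecut (insert a (V - A)) (contract A a w) (collect_at A a h) X
     = (sum h A + (\<Sum>y\<in>V - (A \<union> Y). \<Sum>x\<in>A. w x y)) + (\<Sum>x\<in>Y. h x + (\<Sum>y\<in>V - (A \<union> Y). w x y))"
  proof -
    have na: "y \<noteq> a" if "y \<in> V - (A \<union> Y) \<or> y \<in> Y" for y using that A Y by auto
    have "(\<Sum>y\<in>V - (A \<union> Y). contract A a w a y) = (\<Sum>y\<in>V - (A \<union> Y). \<Sum>x\<in>A. w x y)"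
      by (rule sum.cong[OF refl]) (simp add: contract_def na)
    moreover have "(\<Sum>x\<in>Y. collect_at A a h x + (\<Sum>y\<in>V - (A \<union> Y). contract A a w x y))
        = (\<Sum>x\<in>Y. h x + (\<Sum>y\<in>V - (A \<union> Y). w x y))"
    proof (rule sum.cong[OF refl])
      fix x assume "x \<in> Y"
      then have "x \<noteq> a" by (simp add: na)
      then show "collect_at A a h x + (\<Sum>y\<in>V - (A \<union> Y). contract A a w x y)
        = h x + (\<Sum>y\<in>V - (A \<union> Y). w x y)"
        by (simp add: collect_at_def contract_def na)
    qed
    moreover have "collect_at A a h a = sum h A" by (simp add: collect_at_def)
    moreover have "insert a (V - A) - insert a Y = V - (A \<union> Y)" using 1 Y(1) by simp
    ultimately show ?thesis unfolding ecut_def Y(1) by (simp only: sum.insert[OF Y(4,2)])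
  qed
  also have "(\<Sum>y\<in>V - (A \<union> Y). \<Sum>x\<in>A. w x y) = (\<Sum>x\<in>A. \<Sum>y\<in>V - (A \<union> Y). w x y)"
    by (rule sum.swap)
  also have "(sum h A + (\<Sum>x\<in>A. \<Sum>y\<in>V - (A \<union> Y). w x y)) + (\<Sum>x\<in>Y. h x + (\<Sum>y\<in>V - (A \<union> Y). w x y))
     = ecut V w h (A \<union> Y)"
    unfolding ecut_def using Y fA by (subst sum.union_disjoint) (auto simp: sum.distrib)
  moreover have "A \<union> X = A \<union> Y" using Y(1) A by auto
  ultimately show ?thesis using True by simp
next
  case False
  have 1: "insert a (V - A) - X = insert a (V - A - X)" using False A by auto
  have fA: "finite A" using A(1) fin by (rule finite_subset)
  have 2: "V - X = A \<union> (V - A - X)" using X False A by auto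
  have "ecut (insert a (V - A)) (contract A a w) (collect_at A a h) X
     = (\<Sum>x\<in>X. h x + ((\<Sum>y\<in>A. w x y) + (\<Sum>y\<in>V - A - X. w x y)))"
    unfolding ecut_def 1
  proof (rule sum.cong[OF refl])
    fix x assume x: "x \<in> X"
    then have "x \<noteq> a" using False by auto
    then show "collect_at A a h x + (\<Sum>y\<in>insert a (V - A - X). contract A a w x y)
       = h x + ((\<Sum>y\<in>A. w x y) + (\<Sum>y\<in>V - A - X. w x y))"
      using A fin by (subst sum.insert) (auto simp: collect_at_def contract_def intro!: sum.cong)
  qed
  also have "\<dots> = ecut V w h X"
    unfolding ecut_def 2 using fA fin by (subst sum.union_disjoint) auto
  finally show ?thesis using False by simp
qed

text \<open>Orient the contracted graph, distribute the orientation over the contracted edges, and then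
  orient \<open>A\<close> with everything outside of \<open>A\<close> already fixed.\<close>
lemma orientable_contract:
  fixes w :: "'a \<Rightarrow> 'a \<Rightarrow> nat"
  assumes con: "consistent k V w ho hi b" and A: "A \<subseteq> V" "a \<in> A"
    and quot: "orientable k (insert a (V - A)) (contract A a w) (collect_at A a ho) (collect_at A a hi) (collect_at A a b)"
    and inner: "\<And>ho' hi'. \<lbrakk>consistent k A w ho' hi' b;
        \<And>x. x \<in> A \<Longrightarrow> ho' x + hi' x = ho x + hi x + (\<Sum>y\<in>V - A. w x y)\<rbrakk> \<Longrightarrow> orientable k A w ho' hi' b"
  shows "orientable k V w ho hi b"
proof -
  have fin: "finite V" and sym: "\<And>x y. w x y = w y x" and z: "\<And>x. w x x = 0"
    and par: "\<And>x. x \<in> V \<Longrightarrow> even (b x + int (ecut V w (\<lambda>x. ho x + hi x) {x}))"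
    using con by (auto simp: consistent_def)
  have fA: "finite A" using A(1) fin by (rule finite_subset)
  obtain d where d: "\<And>x y. \<lbrakk>x \<in> insert a (V - A); y \<in> insert a (V - A)\<rbrakk> \<Longrightarrow> d x y + d y x = contract A a w x y"
    and bal: "\<And>x. x \<in> insert a (V - A) \<Longrightarrow> [(\<Sum>y\<in>insert a (V - A). int (d x y) - int (d y x))
        + int (collect_at A a hi x) - int (collect_at A a ho x) = collect_at A a b x] (mod (2 * int k))"
    using quot unfolding orientable_def by blast
  \<comment> \<open>\<open>g v x\<close> will be the number of edges between \<open>x\<close> and
    \<open>v\<close> that are directed from \<open>x\<close> to \<open>v\<close>; the
    \<open>d a v\<close> arcs from the contracted vertex to \<open>v\<close> are spread over
    \<open>A\<close> arbitrarily.\<close>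
  have "\<exists>g. (\<forall>x. g x \<le> w x v) \<and> sum g A = d a v" if "v \<in> V - A" for v
  proof (rule sub_sum[OF fA])
    show "d a v \<le> (\<Sum>x\<in>A. w x v)" 
    proof -
      have "v \<noteq> a" using that A by auto
      then have "d a v + d v a = (\<Sum>x\<in>A. w x v)" using d[of a v] that by (auto simp: contract_def)
      then show ?thesis by linarith
    qed
  qed
  then obtain g where g: "\<And>v x. v \<in> V - A \<Longrightarrow> g v x \<le> w x v" "\<And>v. v \<in> V - A \<Longrightarrow> sum (g v) A = d a v"
    by metis
  have gs: "(\<Sum>x\<in>A. int (w x v) - int (g v x)) = int (d v a)" if v: "v \<in> V - A" for v
  proof -
    have "d a v + d v a = (\<Sum>x\<in>A. w x v)" using d[of a v] v A by (auto simp: contract_def)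
    then have "int (d a v) + int (d v a) = (\<Sum>x\<in>A. int (w x v))" by (metis of_nat_add of_nat_sum)
    moreover have "int (d a v) = (\<Sum>x\<in>A. int (g v x))" using g(2)[OF v] by (metis of_nat_sum)
    ultimately show ?thesis by (simp add: sum_subtractf)
  qed
  \<comment> \<open>Seen from \<open>A\<close>, the edges to \<open>V - A\<close> have become outer
    edges: those directed into \<open>x\<close> are added to \<open>ho\<close>, those directed out
    of \<open>x\<close> to \<open>hi\<close>.\<close>
  define ho' where "ho' x = ho x + (\<Sum>y\<in>V - A. w x y - g y x)" for x
  define hi' where "hi' x = hi x + (\<Sum>y\<in>V - A. g y x)" for x
  have hh: "ho' x + hi' x = ho x + hi x + (\<Sum>y\<in>V - A. w x y)" for x
  proof -
    have "(\<Sum>y\<in>V - A. w x y - g y x) + (\<Sum>y\<in>V - A. g y x) = (\<Sum>y\<in>V - A. w x y)"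
      unfolding sum.distrib[symmetric] by (rule sum.cong) (use g in auto)
    then show ?thesis by (simp add: ho'_def hi'_def)
  qed
  have dh: "int (hi' x) - int (ho' x) = int (hi x) - int (ho x)
      + (\<Sum>y\<in>V - A. int (g y x) - (int (w x y) - int (g y x)))" for x
  proof -
    have 1: "(\<Sum>y\<in>V - A. int (w x y - g y x)) = (\<Sum>y\<in>V - A. int (w x y) - int (g y x))"
      using g(1) by (intro sum.cong) (auto simp: of_nat_diff)
    have 2: "int (hi' x) = int (hi x) + (\<Sum>y\<in>V - A. int (g y x))"
      unfolding hi'_def of_nat_add of_nat_sum ..
    have 3: "int (ho' x) = int (ho x) + ((\<Sum>y\<in>V - A. int (w x y)) - (\<Sum>y\<in>V - A. int (g y x)))"
      unfolding ho'_def of_nat_add of_nat_sum 1 sum_subtractf ..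
    show ?thesis unfolding 2 3 sum_subtractf by linarith
  qed
  have con': "consistent k A w ho' hi' b"
    unfolding consistent_def
  proof (intro conjI ballI)
    fix x assume x: "x \<in> A"
    have "V - {x} = (V - A) \<union> (A - {x})" using A x by auto
    moreover have "(\<Sum>y\<in>(V - A) \<union> (A - {x}). w x y) = (\<Sum>y\<in>V - A. w x y) + (\<Sum>y\<in>A - {x}. w x y)"
      using fin fA by (intro sum.union_disjoint) auto
    ultimately have "ecut V w (\<lambda>x. ho x + hi x) {x} = ecut A w (\<lambda>x. ho' x + hi' x) {x}"
      unfolding ecut_singleton hh by simp
    then show "even (b x + int (ecut A w (\<lambda>x. ho' x + hi' x) {x}))" using par x A by auto
  next
    have "d a a = 0" using d[of a a] by (simp add: contract_def)
    \<comment> \<open>Consistency of the inner problem is exactly the condition satisfied at the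
      contracted vertex.\<close>
    have "[sum b A = (\<Sum>y\<in>V - A. int (d a y) - int (d y a)) + int (sum hi A) - int (sum ho A)] (mod (2 * int k))"
      using bal[of a] fin A \<open>d a a = 0\<close> by (simp add: collect_at_def cong_sym_eq)
    also have "(\<Sum>y\<in>V - A. int (d a y) - int (d y a))
       = (\<Sum>y\<in>V - A. \<Sum>x\<in>A. int (g y x) - (int (w x y) - int (g y x)))"
    proof (rule sum.cong[OF refl])
      fix y assume y: "y \<in> V - A"
      show "int (d a y) - int (d y a) = (\<Sum>x\<in>A. int (g y x) - (int (w x y) - int (g y x)))"
        using gs[OF y] arg_cong[OF g(2)[OF y], of int] unfolding of_nat_sum sum_subtractf by linarith
    qed
    also have "\<dots> = (\<Sum>x\<in>A. \<Sum>y\<in>V - A. int (g y x) - (int (w x y) - int (g y x)))"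
      by (rule sum.swap)
    also have "\<dots> + int (sum hi A) - int (sum ho A) = (\<Sum>x\<in>A. int (hi' x) - int (ho' x))"
      unfolding dh by (simp add: sum.distrib sum_subtractf)
    finally show "[sum b A = (\<Sum>x\<in>A. int (hi' x) - int (ho' x))] (mod (2 * int k))" .
  qed (use fA sym z in auto)
  obtain f where f: "\<And>x y. \<lbrakk>x \<in> A; y \<in> A\<rbrakk> \<Longrightarrow> f x y + f y x = w x y"
    and fb: "\<And>x. x \<in> A \<Longrightarrow> [(\<Sum>y\<in>A. int (f x y) - int (f y x)) + int (hi' x) - int (ho' x) = b x] (mod (2 * int k))"
    using inner[OF con' hh] unfolding orientable_def by blast
  define e where "e x y = (if x \<in> A then if y \<in> A then f x y else g y x
      else if y \<in> A then w x y - g x y else d x y)" for x y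
  have VA: "V = A \<union> (V - A)" using A by auto
  show ?thesis unfolding orientable_def
  proof (intro exI[of _ e] conjI ballI)
    fix x y assume "x \<in> V" "y \<in> V"
    then show "e x y + e y x = w x y"
      using f[of x y] g(1)[of y x] g(1)[of x y] d[of x y] A sym[of x y] by (auto simp: e_def contract_def)
  next
    fix x assume x: "x \<in> V"
    have split: "(\<Sum>y\<in>V. int (e x y) - int (e y x)) = (\<Sum>y\<in>A. int (e x y) - int (e y x))
       + (\<Sum>y\<in>V - A. int (e x y) - int (e y x))"
      using fin fA A by (metis (no_types, lifting) add.commute sum.subset_diff)
    show "[(\<Sum>y\<in>V. int (e x y) - int (e y x)) + int (hi x) - int (ho x) = b x] (mod (2 * int k))"
    proof (cases "x \<in> A")
      case True
      have 1: "(\<Sum>y\<in>A. int (e x y) - int (e y x)) = (\<Sum>y\<in>A. int (f x y) - int (f y x))"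
        using True by (intro sum.cong) (auto simp: e_def)
      have 2: "(\<Sum>y\<in>V - A. int (e x y) - int (e y x)) = (\<Sum>y\<in>V - A. int (g y x) - (int (w x y) - int (g y x)))"
        using True g(1) sym by (intro sum.cong) (auto simp: e_def of_nat_diff)
      have 3: "(\<Sum>y\<in>A. int (f x y) - int (f y x)) + (\<Sum>y\<in>V - A. int (g y x) - (int (w x y) - int (g y x)))
          + int (hi x) - int (ho x) = (\<Sum>y\<in>A. int (f x y) - int (f y x)) + int (hi' x) - int (ho' x)"
        using dh[of x] by linarith
      show ?thesis unfolding split 1 2 3 by (rule fb[OF True])
    next
      case False
      then have xV: "x \<in> V - A" using x by auto
      have 1: "(\<Sum>y\<in>A. int (e x y) - int (e y x)) = int (d x a) - int (d a x)"
      proof -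
        have "(\<Sum>y\<in>A. int (e x y) - int (e y x)) = (\<Sum>y\<in>A. (int (w y x) - int (g x y)) - int (g x y))"
          using False g(1)[OF xV] sym by (intro sum.cong) (auto simp: e_def of_nat_diff)
        also have "\<dots> = int (d x a) - int (d a x)"
          using gs[OF xV] arg_cong[OF g(2)[OF xV], of int] sym unfolding of_nat_sum sum_subtractf
          by (simp add: sym)
        finally show ?thesis .
      qed
      have 2: "(\<Sum>y\<in>V - A. int (e x y) - int (e y x)) = (\<Sum>y\<in>V - A. int (d x y) - int (d y x))"
        using False by (intro sum.cong) (auto simp: e_def)
      have "x \<noteq> a" using False A by auto
      then show ?thesis using bal[of x] xV fin A unfolding split 1 2 by (simp add: collect_at_def)
    qed
  qed
qed

section \<open>Elimination of a vertex\<close>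

lemma pairing:
  fixes s :: "'a \<Rightarrow> nat"
  assumes "finite V" "sum s V = 2 * N" "\<And>y. y \<in> V \<Longrightarrow> s y \<le> N"
  shows "\<exists>e. (\<forall>y z. e y z = e z y) \<and> (\<forall>y. e y y = 0) \<and> (\<forall>y\<in>V. (\<Sum>z\<in>V. e y z) = s y)"
  using assms(2,3)
proof (induction N arbitrary: s)
  case 0
  then show ?case by (intro exI[of _ "\<lambda>_ _. 0"]) auto
next
  case (Suc N)
  have ne: "V \<noteq> {}" using Suc.prems(1) by auto
  then obtain u where u: "u \<in> V" "\<And>y. y \<in> V \<Longrightarrow> s y \<le> s u"
    using obtains_MAX[OF assms(1), of s] Max_ge[of "s ` V"] assms(1)
    by (metis finite_imageI imageI)
  have su: "sum s V = s u + sum s (V - {u})" by (rule sum.remove[OF assms(1) u(1)])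
  have pos: "0 < sum s (V - {u})" using su Suc.prems(1) Suc.prems(2)[OF u(1)] by simp
  then have "V - {u} \<noteq> {}" by (metis less_irrefl sum.empty)
  then obtain v where v: "v \<in> V - {u}" "\<And>y. y \<in> V - {u} \<Longrightarrow> s y \<le> s v"
    using obtains_MAX[of "V - {u}" s] Max_ge[of "s ` (V - {u})"] assms(1)
    by (metis finite_imageI imageI finite_Diff)
  have "0 < s v"
  proof (rule ccontr)
    assume "\<not> 0 < s v"
    then have "sum s (V - {u}) = 0" using v by (intro sum.neutral) auto
    then show False using pos by simp
  qed
  then have "0 < s u" using u(2)[of v] v(1) by auto
  \<comment> \<open>Joining the two largest demands preserves the bound: a third vertex with demand
    \<open>Suc N\<close> would make three of them, more than the total
    \<open>2 * Suc N\<close>.\<close>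
  have small: "s y \<le> N" if y: "y \<in> V" "y \<noteq> u" "y \<noteq> v" for y
  proof (rule ccontr)
    assume "\<not> s y \<le> N"
    moreover have "s y \<le> s v" "s v \<le> s u" using v(2)[of y] u(2)[of v] v(1) y by auto
    moreover have "s u \<le> Suc N" using Suc.prems(2)[OF u(1)] .
    ultimately have "s y = Suc N" "s v = Suc N" "s u = Suc N" by linarith+
    moreover have "sum s {y, v, u} \<le> sum s V" using y v u assms(1) by (intro sum_mono2) auto
    ultimately show False using y v Suc.prems(1) by auto
  qed
  define t where "t y = s y - of_bool (y = u) - of_bool (y = v)" for y
  have st: "s y = t y + of_bool (y = u) + of_bool (y = v)" for y
    using \<open>0 < s u\<close> \<open>0 < s v\<close> v(1) by (auto simp: t_def)
  have "sum s V = (\<Sum>y\<in>V. t y + (if y = u then 1 else 0) + (if y = v then 1 else 0))"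
    by (rule sum.cong) (simp_all add: st)
  also have "\<dots> = sum t V + 1 + 1" using u(1) v(1) assms(1) by (simp add: sum.distrib)
  finally have "sum s V = sum t V + 1 + 1" .
  then have "sum t V = 2 * N" using Suc.prems(1) by simp
  moreover have "t y \<le> N" if "y \<in> V" for y
    using small[OF that] Suc.prems(2)[OF that] by (auto simp: t_def)
  ultimately have "\<exists>e. (\<forall>y z. e y z = e z y) \<and> (\<forall>y. e y y = 0) \<and> (\<forall>y\<in>V. (\<Sum>z\<in>V. e y z) = t y)"
    by (rule Suc.IH)
  then obtain e where e: "\<And>y z. e y z = e z y" "\<And>y. e y y = 0" "\<And>y. y \<in> V \<Longrightarrow> (\<Sum>z\<in>V. e y z) = t y"
    by blast
  define f where "f y z = e y z + (if z = v then of_bool (y = u) else 0) + (if z = u then of_bool (y = v) else 0)" for y z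
  have "(\<Sum>z\<in>V. f y z) = s y" if "y \<in> V" for y
  proof -
    have "(\<Sum>z\<in>V. f y z) = (\<Sum>z\<in>V. e y z) + of_bool (y = u) + of_bool (y = v)"
      unfolding f_def sum.distrib using u(1) v(1) assms(1) by simp
    then show ?thesis using e(3)[OF that] st[of y] by simp
  qed
  moreover have "f y z = f z y" for y z using e(1)[of y z] by (simp add: f_def)
  moreover have "f y y = 0" for y using e(2) v(1) by (auto simp: f_def)
  ultimately show ?case by (intro exI[of _ f] conjI allI ballI) assumption+
qed

text \<open>A pair with both members in \<open>X\<close> replaces two edges that crossed the cut,
  and the double sum counts it twice. Any other edge between \<open>X\<close> and \<open>x\<close>
  still counts once for its end in \<open>X\<close>.\<close>

lemma ecut_eliminate:
  assumes "finite V" "x \<in> V" "X \<subseteq> V - {x}" and sym: "\<And>y z. w y z = w z y"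
    and r: "\<And>y. y \<in> V - {x} \<Longrightarrow> (\<Sum>z\<in>V - {x}. e y z) + r y = w x y"
  shows "ecut (V - {x}) (\<lambda>y z. w y z + e y z) (\<lambda>y. h y + r y) X + (\<Sum>y\<in>X. \<Sum>z\<in>X. e y z) = ecut V w h X"
proof -
  have "h y + r y + (\<Sum>z\<in>V - {x} - X. w y z + e y z) + (\<Sum>z\<in>X. e y z) = h y + (\<Sum>z\<in>V - X. w y z)"
    if y: "y \<in> X" for y
  proof -
    have "(\<Sum>z\<in>V - X. w y z) = w y x + (\<Sum>z\<in>V - X - {x}. w y z)"
      using assms by (intro sum.remove) auto
    moreover have "V - X - {x} = V - {x} - X" by auto
    moreover have "(\<Sum>z\<in>V - {x}. e y z) = (\<Sum>z\<in>V - {x} - X. e y z) + (\<Sum>z\<in>X. e y z)"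
      using assms by (intro sum.subset_diff) auto
    moreover have "y \<in> V - {x}" using y assms(3) by auto
    ultimately show ?thesis using r[of y] sym[of y x] by (simp add: sum.distrib)
  qed
  then show ?thesis unfolding ecut_def sum.distrib[symmetric] by (intro sum.cong) auto
qed

text \<open>The edges at \<open>x\<close> are replaced by edges \<open>e\<close> between its neighbours, except for \<open>ro\<close> edges
  directed away from \<open>x\<close> and \<open>ri\<close> edges directed towards \<open>x\<close>, which become edges of the outer vertex.\<close>
lemma orientable_eliminate:
  fixes w e :: "'a \<Rightarrow> 'a \<Rightarrow> nat"
  assumes con: "consistent k V w ho hi b" and x: "x \<in> V"
    and e: "\<And>y z. e y z = e z y" "\<And>y. e y y = 0"
    and r: "\<And>y. y \<in> V - {x} \<Longrightarrow> (\<Sum>z\<in>V - {x}. e y z) + (ro y + ri y) = w x y"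
    and bx: "[int (sum ro (V - {x})) - int (sum ri (V - {x})) + int (hi x) - int (ho x) = b x] (mod (2 * int k))"
    and sub: "orientable k (V - {x}) (\<lambda>y z. w y z + e y z) (\<lambda>y. ho y + ro y) (\<lambda>y. hi y + ri y) b"
  shows "orientable k V w ho hi b"
proof -
  let ?U = "V - {x}"
  have fin: "finite V" and sym: "\<And>x y. w x y = w y x" and z: "\<And>x. w x x = 0"
    using con by (auto simp: consistent_def)
  obtain d where d: "\<And>y z. \<lbrakk>y \<in> ?U; z \<in> ?U\<rbrakk> \<Longrightarrow> d y z + d z y = w y z + e y z"
    and bal: "\<And>y. y \<in> ?U \<Longrightarrow> [(\<Sum>z\<in>?U. int (d y z) - int (d z y)) + int (hi y + ri y) - int (ho y + ro y) = b y] (mod (2 * int k))"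
    using sub unfolding orientable_def by blast
  \<comment> \<open>An arbitrary linear order on \<open>V\<close> decides from which end of each
    pair the choice of \<open>c\<close> is made.\<close>
  obtain idx :: "'a \<Rightarrow> nat" where idx: "inj_on idx V"
    using finite_imp_inj_to_nat_seg[OF fin] by auto
  \<comment> \<open>\<open>c y z\<close> of the new edges become paths from \<open>y\<close> through
    \<open>x\<close> to \<open>z\<close>. As many as possible are taken from the arcs from the
    smaller to the larger vertex; the rest then fit into the opposite arcs.\<close>
  define c where "c y z = (if idx y < idx z then min (d y z) (e y z) else e y z - min (d z y) (e y z))" for y z
  have c: "c y z + c z y = e y z" "c y z \<le> d y z" if "y \<in> ?U" "z \<in> ?U" for y z
  proof -
    have yz: "y = z \<or> idx y < idx z \<or> idx z < idx y"
      using idx that by (metis DiffD1 inj_onD linorder_neqE_nat)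
    show "c y z + c z y = e y z" using yz e(1)[of z y] e(2) by (auto simp: c_def)
    show "c y z \<le> d y z" using yz d[OF that] e(1)[of z y] e(2) by (auto simp: c_def)
  qed
  define f where "f y z = (if y = x then if z = x then 0 else (\<Sum>v\<in>?U. c v z) + ro z
      else if z = x then (\<Sum>v\<in>?U. c y v) + ri y else d y z - c y z)" for y z
  have f1: "f y z + f z y = w y z" if yz: "y \<in> V" "z \<in> V" for y z
  proof -
    have *: "(\<Sum>v\<in>?U. c v y) + ro y + ((\<Sum>v\<in>?U. c y v) + ri y) = w x y" if "y \<in> ?U" for y
    proof -
      have "(\<Sum>v\<in>?U. c v y) + (\<Sum>v\<in>?U. c y v) = (\<Sum>v\<in>?U. e y v)"
        unfolding sum.distrib[symmetric] using c(1)[OF that] by (intro sum.cong) (auto simp: add.commute)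
      then show ?thesis using r[OF that] by simp
    qed
    consider "y = x" "z = x" | "y = x" "z \<in> ?U" | "z = x" "y \<in> ?U" | "y \<in> ?U" "z \<in> ?U" using yz by blast
    then show ?thesis
    proof cases
      case 2 then show ?thesis using *[of z] by (simp add: f_def)
    next
      case 3 then show ?thesis using *[of y] sym[of x y] by (simp add: f_def)
    next
      case 4 then show ?thesis using d[of y z] c(1)[of y z] c(2)[of y z] c(2)[of z y] by (auto simp: f_def)
    qed (simp add: f_def z)
  qed
  have V: "(\<Sum>z\<in>V. g z) = g x + (\<Sum>z\<in>?U. g z)" for g :: "'a \<Rightarrow> int"
    using fin x by (rule sum.remove)
  have "[(\<Sum>z\<in>V. int (f y z) - int (f z y)) + int (hi y) - int (ho y) = b y] (mod (2 * int k))" if y: "y \<in> V" for y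
  proof (cases "y = x")
    case True
    have "(\<Sum>z\<in>V. int (f x z) - int (f z x))
        = (\<Sum>z\<in>?U. (int (\<Sum>v\<in>?U. c v z) + int (ro z)) - (int (\<Sum>v\<in>?U. c z v) + int (ri z)))"
      unfolding V by (simp add: f_def)
    also have "\<dots> = (\<Sum>z\<in>?U. \<Sum>v\<in>?U. int (c v z)) - (\<Sum>z\<in>?U. \<Sum>v\<in>?U. int (c z v))
        + int (sum ro ?U) - int (sum ri ?U)"
      by (simp add: sum_subtractf sum.distrib)
    \<comment> \<open>The paths through \<open>x\<close> contribute equally to its out-degree and
      its in-degree, so only \<open>ro\<close> and \<open>ri\<close> remain.\<close>
    also have "(\<Sum>z\<in>?U. \<Sum>v\<in>?U. int (c v z)) = (\<Sum>z\<in>?U. \<Sum>v\<in>?U. int (c z v))" by (rule sum.swap)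
    finally show ?thesis using bx True by simp
  next
    case False
    then have yU: "y \<in> ?U" using y by auto
    have "(\<Sum>z\<in>?U. int (f y z) - int (f z y))
        = (\<Sum>z\<in>?U. (int (d y z) - int (d z y)) - (int (c y z) - int (c z y)))"
      using c(2) False yU by (intro sum.cong) (auto simp: f_def of_nat_diff)
    then have "(\<Sum>z\<in>V. int (f y z) - int (f z y)) = (\<Sum>z\<in>?U. int (d y z) - int (d z y)) + int (ri y) - int (ro y)"
      unfolding V using False by (simp add: f_def sum_subtractf)
    then have "(\<Sum>z\<in>V. int (f y z) - int (f z y)) + int (hi y) - int (ho y)
        = (\<Sum>z\<in>?U. int (d y z) - int (d z y)) + int (hi y + ri y) - int (ho y + ro y)" by simp
    then show ?thesis using bal[OF yU] by (simp only:)
  qed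
  then show ?thesis unfolding orientable_def using f1 by blast
qed

section \<open>Operations that preserve admissibility\<close>

lemma orientable_reverse:
  assumes "orientable k V w hi ho (\<lambda>x. - b x)"
  shows "orientable k V w ho hi b"
proof -
  obtain d where d: "\<forall>x\<in>V. \<forall>y\<in>V. d x y + d y x = w x y"
    and bal: "\<And>x. x \<in> V \<Longrightarrow> [(\<Sum>y\<in>V. int (d x y) - int (d y x)) + int (ho x) - int (hi x) = - b x] (mod (2 * int k))"
    using assms unfolding orientable_def by blast
  have "[(\<Sum>y\<in>V. int (d y x) - int (d x y)) + int (hi x) - int (ho x) = b x] (mod (2 * int k))" if "x \<in> V" for x
    using cong_minus_minus_iff[THEN iffD2, OF bal[OF that]] by (simp add: sum_subtractf algebra_simps)
  then show ?thesis unfolding orientable_def using d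
    by (intro exI[of _ "\<lambda>x y. d y x"]) (auto simp: add.commute)
qed

lemma admissible_reverse:
  assumes "admissible k V w ho hi b"
  shows "admissible k V w hi ho (\<lambda>x. - b x)"
proof -
  have "[- sum b V = - (\<Sum>x\<in>V. int (hi x) - int (ho x))] (mod (2 * int k))"
    using assms unfolding admissible_def consistent_def by (simp only: cong_minus_minus_iff)
  then have "[(\<Sum>x\<in>V. - b x) = (\<Sum>x\<in>V. int (ho x) - int (hi x))] (mod (2 * int k))"
    by (simp add: sum_negf sum_subtractf)
  then show ?thesis using assms unfolding admissible_def consistent_def slack_def
    by (auto simp: nrm_minus add.commute)
qed

lemma slack_mono: "\<lbrakk>slack k p q; p' \<le> p; q' \<le> q\<rbrakk> \<Longrightarrow> slack k p' q'"
  unfolding slack_def by linarith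

text \<open>Every cut of the contracted graph is a cut of the original one. Unless it is alone, the
  new vertex has a cut of at least \<open>12 * k\<close>, enough for any target since the distance
  never exceeds \<open>k\<close>.\<close>

lemma admissible_contract:
  assumes adm: "admissible k V w ho hi b" and A: "A \<subseteq> V" "a \<in> A" "2 \<le> card A" and k: "0 < k"
  shows "admissible k (insert a (V - A)) (contract A a w) (collect_at A a ho) (collect_at A a hi) (collect_at A a b)"
    and "\<And>X. X \<subseteq> insert a (V - A) \<Longrightarrow>
      ecut (insert a (V - A)) (contract A a w) (\<lambda>x. collect_at A a ho x + collect_at A a hi x) X
      = ecut V w (\<lambda>x. ho x + hi x) (if a \<in> X then A \<union> X else X)"
proof -
  let ?V = "insert a (V - A)" let ?h = "\<lambda>x. ho x + hi x"
  have con: "consistent k V w ho hi b" using adm by (simp add: admissible_def)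
  have fin: "finite V" and sym: "\<And>x y. w x y = w y x" and z: "\<And>x. w x x = 0"
    and par: "\<And>x. x \<in> V \<Longrightarrow> even (b x + int (ecut V w ?h {x}))"
    using con by (auto simp: consistent_def)
  have "(\<lambda>x. collect_at A a ho x + collect_at A a hi x) = collect_at A a ?h"
    by (auto simp: collect_at_def sum.distrib)
  then have cut: "ecut ?V (contract A a w) (\<lambda>x. collect_at A a ho x + collect_at A a hi x) X
      = ecut V w ?h (if a \<in> X then A \<union> X else X)" if "X \<subseteq> ?V" for X
    using ecut_contract[OF fin A(1,2) that] by simp
  then show "\<And>X. X \<subseteq> ?V \<Longrightarrow> ecut ?V (contract A a w) (\<lambda>x. collect_at A a ho x + collect_at A a hi x) X
      = ecut V w ?h (if a \<in> X then A \<union> X else X)" .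
  have fA: "finite A" using A(1) fin by (rule finite_subset)
  have cut1: "ecut ?V (contract A a w) (\<lambda>x. collect_at A a ho x + collect_at A a hi x) {x}
      = (if x = a then ecut V w ?h A else ecut V w ?h {x})" if "x \<in> ?V" for x
    using cut[of "{x}"] that A by (auto simp: insert_absorb)
  have "even (int (ecut V w ?h A) + (\<Sum>x\<in>A. b x))"
  proof -
    have "even (\<Sum>x\<in>A. b x + int (ecut V w ?h {x}))" using par A by (intro dvd_sum) auto
    moreover have "even (ecut V w ?h A + (\<Sum>x\<in>A. ecut V w ?h {x}))"
      by (rule ecut_insert_le) (use fin A sym in auto)
    then have "even (int (ecut V w ?h A) + (\<Sum>x\<in>A. int (ecut V w ?h {x})))"
      by (metis even_of_nat of_nat_add of_nat_sum)
    ultimately show ?thesis unfolding sum.distrib by presburger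
  qed
  then have par': "even (collect_at A a b x + int (ecut ?V (contract A a w) (\<lambda>x. collect_at A a ho x + collect_at A a hi x) {x}))"
    if "x \<in> ?V" for x
    using that par[of x] unfolding cut1[OF that] by (auto simp: collect_at_def add.commute)
  have hs: "(\<Sum>x\<in>?V. int (collect_at A a hi x) - int (collect_at A a ho x)) = (\<Sum>x\<in>V. int (hi x) - int (ho x))"
    using sum_collect_at[OF fin A(1,2), of hi] sum_collect_at[OF fin A(1,2), of ho]
    unfolding sum_subtractf of_nat_sum[symmetric] by simp
  have "consistent k ?V (contract A a w) (collect_at A a ho) (collect_at A a hi) (collect_at A a b)"
    unfolding consistent_def hs using fin par' sum_collect_at[OF fin A(1,2), of b] con sym z
    by (auto simp: consistent_def contract_def)
  moreover have "11 * int k + nrm (2 * int k) (collect_at A a b x)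
      \<le> int (ecut ?V (contract A a w) (\<lambda>x. collect_at A a ho x + collect_at A a hi x) {x})"
    if x: "x \<in> ?V" "?V \<noteq> {x}" for x
  proof (cases "x = a")
    case True
    then have "A \<noteq> V" using x by auto
    then have "12 * k \<le> ecut V w ?h A" using adm A unfolding admissible_def by blast
    then show ?thesis using cut1[OF x(1)] True nrm_le[of "int k" "collect_at A a b x"] k by simp
  next
    case False
    then have "x \<in> V" "V \<noteq> {x}" using x A by auto
    then show ?thesis using adm False cut1[OF x(1)] unfolding admissible_def by (auto simp: collect_at_def)
  qed
  moreover have "12 * k \<le> ecut ?V (contract A a w) (\<lambda>x. collect_at A a ho x + collect_at A a hi x) X"
    if X: "X \<subseteq> ?V" "X \<noteq> ?V" "2 \<le> card X" for X
  proof -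
    let ?Y = "if a \<in> X then A \<union> X else X"
    have "?Y \<subseteq> V" "?Y \<noteq> V" using X A by (auto split: if_splits)
    moreover have "2 \<le> card ?Y"
      using A(3) X(3) card_mono[of "A \<union> X" A] fA finite_subset[OF \<open>?Y \<subseteq> V\<close> fin] by (auto split: if_splits)
    ultimately show ?thesis unfolding cut[OF X(1)] using adm unfolding admissible_def by blast
  qed
  moreover have "slack k (sum (collect_at A a ho) ?V) (sum (collect_at A a hi) ?V)"
    unfolding sum_collect_at[OF fin A(1,2)] using adm by (simp add: admissible_def)
  ultimately show "admissible k ?V (contract A a w) (collect_at A a ho) (collect_at A a hi) (collect_at A a b)"
    unfolding admissible_def by blast
qed

lemma ecut_inner:
  assumes "finite V" "A \<subseteq> V" "X \<subseteq> A" and h: "\<And>x. x \<in> A \<Longrightarrow> h' x = h x + (\<Sum>y\<in>V - A. w x y)"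
  shows "ecut A w h' X = ecut V w h X"
proof -
  have "h' x + (\<Sum>y\<in>A - X. w x y) = h x + (\<Sum>y\<in>V - X. w x y)" if "x \<in> X" for x
  proof -
    have "(\<Sum>y\<in>(V - A) \<union> (A - X). w x y) = (\<Sum>y\<in>V - A. w x y) + (\<Sum>y\<in>A - X. w x y)"
      using assms(1,2) by (intro sum.union_disjoint) (auto intro: finite_subset)
    moreover have "(V - A) \<union> (A - X) = V - X" using assms(2,3) by auto
    ultimately show ?thesis using h[of x] that assms(3) by auto
  qed
  then show ?thesis unfolding ecut_def by (intro sum.cong) auto
qed

text \<open>Fixing everything outside of \<open>A\<close> turns its cut into outer edges and changes
  no cut of a subset of \<open>A\<close>; the bound \<open>18 * k\<close> is the first alternative
  of \<open>slack\<close>.\<close>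

lemma admissible_inner:
  assumes adm: "admissible k V w ho hi b" and A: "A \<subseteq> V" "A \<noteq> V" and small: "ecut V w (\<lambda>x. ho x + hi x) A \<le> 18 * k"
    and con: "consistent k A w ho' hi' b"
    and h: "\<And>x. x \<in> A \<Longrightarrow> ho' x + hi' x = ho x + hi x + (\<Sum>y\<in>V - A. w x y)"
  shows "admissible k A w ho' hi' b"
proof -
  have fin: "finite V" using adm by (simp add: admissible_def consistent_def)
  have cut: "ecut A w (\<lambda>x. ho' x + hi' x) X = ecut V w (\<lambda>x. ho x + hi x) X" if "X \<subseteq> A" for X
    by (rule ecut_inner[OF fin A(1) that]) (rule h)
  have "sum ho' A + sum hi' A = ecut A w (\<lambda>x. ho' x + hi' x) A"
    by (simp add: ecut_whole sum.distrib)
  then have "slack k (sum ho' A) (sum hi' A)" using small cut[of A] by (simp add: slack_def)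
  moreover have "11 * int k + nrm (2 * int k) (b x) \<le> int (ecut A w (\<lambda>x. ho' x + hi' x) {x})" if "x \<in> A" for x
  proof -
    have "x \<in> V" "V \<noteq> {x}" using that A by auto
    then show ?thesis using cut[of "{x}"] that adm unfolding admissible_def by auto
  qed
  moreover have "12 * k \<le> ecut A w (\<lambda>x. ho' x + hi' x) X" if "X \<subseteq> A" "2 \<le> card X" for X
  proof -
    have "X \<subseteq> V" "X \<noteq> V" using that A by auto
    then show ?thesis using cut[of X] that adm unfolding admissible_def by auto
  qed
  ultimately show ?thesis using con unfolding admissible_def by blast
qed

text \<open>Neither kind of contraction applies. The gap between \<open>18 * k\<close> here and
  \<open>12 * k\<close> in \<open>admissible\<close> is the room that edge deletion and vertex
  elimination consume.\<close>

definition irreducible_graph :: "nat \<Rightarrow> 'a set \<Rightarrow> ('a \<Rightarrow> 'a \<Rightarrow> nat) \<Rightarrow> ('a \<Rightarrow> nat) \<Rightarrow> bool" where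
  "irreducible_graph k V w h \<longleftrightarrow> (\<forall>x\<in>V. \<forall>y\<in>V. x \<noteq> y \<longrightarrow> w x y < k - 1) \<and>
     (\<forall>A\<subseteq>V. A \<noteq> V \<longrightarrow> 2 \<le> card A \<longrightarrow> 18 * k < ecut V w h A)"

lemma admissible_singleton:
  assumes "admissible k V w ho hi b" "x \<in> V" "V \<noteq> {x}"
  shows "11 * int k + nrm (2 * int k) (b x) \<le> int (ecut V w (\<lambda>x. ho x + hi x) {x})"
  using assms unfolding admissible_def by blast

text \<open>Two vertices of degree at least \<open>11 * k\<close> joined by fewer than
  \<open>k - 1\<close> edges would need more than \<open>20 * k\<close> outer edges, the most that
  \<open>slack\<close> permits.\<close>

lemma irreducible_card:
  assumes adm: "admissible k V w ho hi b" and irr: "irreducible_graph k V w (\<lambda>x. ho x + hi x)" and k: "0 < k"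
    and "2 \<le> card V"
  shows "3 \<le> card V"
proof (rule ccontr)
  assume "\<not> 3 \<le> card V"
  then have "card V = 2" using assms by simp
  then obtain x y where V: "V = {x, y}" "x \<noteq> y" by (meson card_2_iff)
  then have Vx: "V - {x} = {y}" and Vy: "V - {y} = {x}" "V \<noteq> {x}" "V \<noteq> {y}" by auto
  have nn: "0 \<le> nrm (2 * int k) j" for j using k by (simp add: nrm_nonneg)
  have "11 * int k + nrm (2 * int k) (b x) \<le> int (ecut V w (\<lambda>x. ho x + hi x) {x})"
     "11 * int k + nrm (2 * int k) (b y) \<le> int (ecut V w (\<lambda>x. ho x + hi x) {y})"
    by (rule admissible_singleton[OF adm]; use Vy V(1) in simp)+
  then have "11 * int k \<le> int (ecut V w (\<lambda>x. ho x + hi x) {x})" "11 * int k \<le> int (ecut V w (\<lambda>x. ho x + hi x) {y})"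
    using nn[of "b x"] nn[of "b y"] by linarith+
  then have "11 * k \<le> ho x + hi x + w x y" "11 * k \<le> ho y + hi y + w y x"
    unfolding ecut_singleton Vx Vy by auto
  moreover have "ho x + ho y + (hi x + hi y) \<le> 20 * k"
  proof -
    have "slack k (sum ho V) (sum hi V)" using adm by (simp add: admissible_def)
    moreover have "sum ho V = ho x + ho y" "sum hi V = hi x + hi y" using V by simp_all
    ultimately show ?thesis unfolding slack_def by linarith
  qed
  moreover have "w x y < k - 1" "w y x < k - 1" using irr V unfolding irreducible_graph_def by auto
  ultimately show False by linarith
qed

definition unit_edge :: "'a \<Rightarrow> 'a \<Rightarrow> 'a \<Rightarrow> 'a \<Rightarrow> nat" where
  "unit_edge x y u v = of_bool (u = x \<and> v = y \<or> u = y \<and> v = x)"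

lemma ecut_unit_edge:
  assumes "finite V" "A \<subseteq> V" "x \<in> V" "y \<in> V" "x \<noteq> y"
  shows "ecut V (unit_edge x y) (\<lambda>_. 0) A = of_bool ((x \<in> A) \<noteq> (y \<in> A))"
proof -
  have fA: "finite A" using assms(1,2) by (rule finite_subset[rotated])
  have 1: "(\<Sum>v\<in>V - A. unit_edge x y u v) = of_bool (u = x \<and> y \<notin> A) + of_bool (u = y \<and> x \<notin> A)" for u
  proof -
    have "unit_edge x y u v = (if v = y then of_bool (u = x) else 0) + (if v = x then of_bool (u = y) else 0)" for v
      using assms(5) by (auto simp: unit_edge_def)
    then show ?thesis using assms by (simp add: sum.distrib)
  qed
  have "ecut V (unit_edge x y) (\<lambda>_. 0) A = (\<Sum>u\<in>A. (if u = x then of_bool (y \<notin> A) else 0) + (if u = y then of_bool (x \<notin> A) else 0))"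
    unfolding ecut_def 1 by (intro sum.cong) auto
  then show ?thesis using fA by (auto simp: sum.distrib)
qed

text \<open>The vertex can give up an outgoing edge, which lowers its target and its degree by one:
  either the target moves towards 0, or the degree exceeds the \<open>12 * k\<close> that suffice
  for any target.\<close>

definition good_out :: "nat \<Rightarrow> int \<Rightarrow> nat \<Rightarrow> bool" where
  "good_out k j d \<longleftrightarrow> 0 < j mod (2 * int k) \<and> j mod (2 * int k) \<le> int k \<or> 12 * k < d"

definition good_in :: "nat \<Rightarrow> int \<Rightarrow> nat \<Rightarrow> bool" where
  "good_in k j d \<longleftrightarrow> int k \<le> j mod (2 * int k) \<or> 12 * k < d"

lemma good_out:
  assumes "good_out k j d" "0 < k" "11 * int k + nrm (2 * int k) j \<le> int d"
  shows "11 * int k + nrm (2 * int k) (j - 1) \<le> int d - 1"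
  using assms nrm_dec[of "int k" j] nrm_le[of "int k" "j - 1"] unfolding good_out_def by auto

lemma good_in:
  assumes "good_in k j d" "0 < k" "11 * int k + nrm (2 * int k) j \<le> int d"
  shows "11 * int k + nrm (2 * int k) (j + 1) \<le> int d - 1"
  using assms nrm_inc[of "int k" j] nrm_le[of "int k" "j + 1"] unfolding good_in_def by auto

text \<open>The deleted edge is directed from \<open>x\<close> to \<open>y\<close> in advance, so
  the target drops at \<open>x\<close> and rises at \<open>y\<close>. Larger sets lose at most one
  edge, which is harmless as their cuts exceed \<open>18 * k\<close>.\<close>

lemma delete_edge:
  assumes adm: "admissible k V w ho hi b" and irr: "irreducible_graph k V w (\<lambda>x. ho x + hi x)" and k: "0 < k"
    and xy: "x \<in> V" "y \<in> V" "x \<noteq> y" "0 < w x y"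
    and good: "good_out k (b x) (ecut V w (\<lambda>x. ho x + hi x) {x})" "good_in k (b y) (ecut V w (\<lambda>x. ho x + hi x) {y})"
    and IH: "\<And>w' b'. \<lbrakk>admissible k V w' ho hi b';
       (\<Sum>z\<in>V. ecut V w' (\<lambda>x. ho x + hi x) {z}) < (\<Sum>z\<in>V. ecut V w (\<lambda>x. ho x + hi x) {z})\<rbrakk>
       \<Longrightarrow> orientable k V w' ho hi b'"
  shows "orientable k V w ho hi b"
proof -
  let ?h = "\<lambda>x. ho x + hi x"
  have fin: "finite V" and sym: "\<And>x y. w x y = w y x" and z: "\<And>x. w x x = 0"
    and par: "\<And>x. x \<in> V \<Longrightarrow> even (b x + int (ecut V w ?h {x}))"
    using adm by (auto simp: admissible_def consistent_def)
  define w' where "w' u v = w u v - unit_edge x y u v" for u v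
  have w: "w u v = w' u v + unit_edge x y u v" for u v
    using xy sym[of x y] by (auto simp: w'_def unit_edge_def)
  define b' where "b' v = b v - of_bool (v = x) + of_bool (v = y)" for v
  have wf: "(\<lambda>u v. w' u v + unit_edge x y u v) = w" by (intro ext) (rule w[symmetric])
  have cut: "ecut V w ?h A = ecut V w' ?h A + of_bool ((x \<in> A) \<noteq> (y \<in> A))" if "A \<subseteq> V" for A
    using ecut_add[of V w' "unit_edge x y" ?h "\<lambda>_. 0" A] ecut_unit_edge[OF fin that xy(1-3)]
    unfolding wf by simp
  have cut1: "ecut V w ?h {v} = ecut V w' ?h {v} + of_bool (v = x) + of_bool (v = y)" if "v \<in> V" for v
    using cut[of "{v}"] that xy by auto
  have sb: "sum b' V = sum b V" unfolding b'_def using xy fin by (simp add: sum.distrib sum_subtractf of_bool_def)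
  have adm': "admissible k V w' ho hi b'"
    unfolding admissible_def consistent_def
  proof (intro conjI ballI allI impI)
    fix u v
    have "unit_edge x y u v = unit_edge x y v u" by (auto simp: unit_edge_def)
    then show "w' u v = w' v u" unfolding w'_def sym[of u v] by (rule arg_cong)
  next
    fix v assume v: "v \<in> V"
    show "even (b' v + int (ecut V w' ?h {v}))"
      using par[OF v] cut1[OF v] by (auto simp: b'_def)
  next
    fix v assume v: "v \<in> V" "V \<noteq> {v}"
    then have old: "11 * int k + nrm (2 * int k) (b v) \<le> int (ecut V w ?h {v})"
      by (rule admissible_singleton[OF adm])
    show "11 * int k + nrm (2 * int k) (b' v) \<le> int (ecut V w' ?h {v})"
      using old good_out[OF good(1) k] good_in[OF good(2) k] cut1[OF v(1)] xy(3)
      by (auto simp: b'_def)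
  next
    fix A assume A: "A \<subseteq> V" "A \<noteq> V" "2 \<le> card A"
    then have "18 * k < ecut V w ?h A" using irr unfolding irreducible_graph_def by blast
    then show "12 * k \<le> ecut V w' ?h A" using cut[OF A(1)] k by (auto simp: of_bool_def split: if_splits)
  next
    show "[sum b' V = (\<Sum>x\<in>V. int (hi x) - int (ho x))] (mod (2 * int k))"
      unfolding sb using adm by (simp add: admissible_def consistent_def)
  next
    show "slack k (sum ho V) (sum hi V)" using adm by (simp add: admissible_def)
  qed (simp_all add: fin z w'_def)
  have "(\<Sum>v\<in>V. ecut V w' ?h {v}) < (\<Sum>v\<in>V. ecut V w ?h {v})"
  proof (rule sum_strict_mono_ex1[OF fin])
    show "\<exists>v\<in>V. ecut V w' ?h {v} < ecut V w ?h {v}" using cut1[OF xy(1)] xy(1) by (intro bexI[of _ x]) auto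
  qed (use cut1 in auto)
  then obtain d where d: "\<And>u v. \<lbrakk>u \<in> V; v \<in> V\<rbrakk> \<Longrightarrow> d u v + d v u = w' u v"
    and bal: "\<And>u. u \<in> V \<Longrightarrow> [(\<Sum>v\<in>V. int (d u v) - int (d v u)) + int (hi u) - int (ho u) = b' u] (mod (2 * int k))"
    using IH[OF adm'] unfolding orientable_def by blast
  define f where "f u v = d u v + of_bool (u = x \<and> v = y)" for u v
  have "f u v + f v u = w u v" if "u \<in> V" "v \<in> V" for u v
    using d[OF that] w[of u v] xy(3) by (auto simp: f_def unit_edge_def)
  moreover have "[(\<Sum>v\<in>V. int (f u v) - int (f v u)) + int (hi u) - int (ho u) = b u] (mod (2 * int k))" if u: "u \<in> V" for u
  proof -
    have "(\<Sum>v\<in>V. int (f u v) - int (f v u)) = (\<Sum>v\<in>V. int (d u v) - int (d v u))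
        + (\<Sum>v\<in>V. (if v = y then of_bool (u = x) else 0)) - (\<Sum>v\<in>V. (if v = x then of_bool (u = y) else 0))"
      unfolding sum.distrib[symmetric] sum_subtractf[symmetric]
      by (intro sum.cong) (auto simp: f_def)
    also have "\<dots> = (\<Sum>v\<in>V. int (d u v) - int (d v u)) + of_bool (u = x) - of_bool (u = y)"
      using fin xy by simp
    finally have eq: "(\<Sum>v\<in>V. int (f u v) - int (f v u)) + int (hi u) - int (ho u)
      = ((\<Sum>v\<in>V. int (d u v) - int (d v u)) + int (hi u) - int (ho u)) + (b u - b' u)"
      by (simp add: b'_def)
    show ?thesis unfolding eq
      by (rule cong_trans[OF cong_add[OF bal[OF u] cong_refl]]) simp
  qed
  ultimately show ?thesis unfolding orientable_def by blast
qed

text \<open>An outer edge leaving \<open>x\<close> already has its direction; dropping it lowers the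
  target of \<open>x\<close> by one. Outer edges entering a vertex are reduced to this case by
  reversal.\<close>

lemma delete_outer_edge:
  assumes adm: "admissible k V w ho hi b" and irr: "irreducible_graph k V w (\<lambda>x. ho x + hi x)" and k: "0 < k"
    and x: "x \<in> V" "0 < hi x" and good: "good_out k (b x) (ecut V w (\<lambda>x. ho x + hi x) {x})"
    and IH: "\<And>hi' b'. \<lbrakk>admissible k V w ho hi' b';
       (\<Sum>z\<in>V. ecut V w (\<lambda>x. ho x + hi' x) {z}) < (\<Sum>z\<in>V. ecut V w (\<lambda>x. ho x + hi x) {z})\<rbrakk>
       \<Longrightarrow> orientable k V w ho hi' b'"
  shows "orientable k V w ho hi b"
proof -
  let ?h = "\<lambda>x. ho x + hi x"
  have fin: "finite V" and sym: "\<And>x y. w x y = w y x" and z: "\<And>x. w x x = 0"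
    and par: "\<And>x. x \<in> V \<Longrightarrow> even (b x + int (ecut V w ?h {x}))"
    using adm by (auto simp: admissible_def consistent_def)
  define hi' where "hi' v = hi v - of_bool (v = x)" for v
  define b' where "b' v = b v - of_bool (v = x)" for v
  let ?h' = "\<lambda>x. ho x + hi' x"
  have hi: "hi v = hi' v + of_bool (v = x)" for v using x by (auto simp: hi'_def)
  have cut: "ecut V w ?h A = ecut V w ?h' A + of_bool (x \<in> A)" if "A \<subseteq> V" for A
  proof -
    have "ecut V w ?h A = ecut V w ?h' A + ecut V (\<lambda>_ _. 0) (\<lambda>v. of_bool (v = x)) A"
      using ecut_add[of V w "\<lambda>_ _. 0" ?h' "\<lambda>v. of_bool (v = x)" A] by (simp add: hi add.assoc)
    then show ?thesis using finite_subset[OF that fin] by (simp add: ecut_def of_bool_def)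
  qed
  have cut1: "ecut V w ?h {v} = ecut V w ?h' {v} + of_bool (v = x)" if "v \<in> V" for v
    using cut[of "{v}"] that by auto
  have sb: "sum b' V = sum b V - 1" unfolding b'_def using x fin by (simp add: sum_subtractf of_bool_def)
  have sh: "sum hi V = sum hi' V + 1" unfolding hi using x fin by (simp add: sum.distrib of_bool_def)
  have adm': "admissible k V w ho hi' b'"
    unfolding admissible_def consistent_def
  proof (intro conjI ballI allI impI)
    fix v assume v: "v \<in> V"
    show "even (b' v + int (ecut V w ?h' {v}))"
      using par[OF v] cut1[OF v] by (auto simp: b'_def)
  next
    have 1: "[sum b V = int (sum hi V) - int (sum ho V)] (mod (2 * int k))"
      using adm by (simp add: admissible_def consistent_def sum_subtractf)
    have "[sum b V - 1 = int (sum hi V) - int (sum ho V) - 1] (mod (2 * int k))"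
      by (rule cong_diff[OF 1 cong_refl])
    then show "[sum b' V = (\<Sum>x\<in>V. int (hi' x) - int (ho x))] (mod (2 * int k))"
      unfolding sb sum_subtractf of_nat_sum[symmetric] using sh by (simp add: algebra_simps)
  next
    fix v assume v: "v \<in> V" "V \<noteq> {v}"
    then have old: "11 * int k + nrm (2 * int k) (b v) \<le> int (ecut V w ?h {v})"
      by (rule admissible_singleton[OF adm])
    show "11 * int k + nrm (2 * int k) (b' v) \<le> int (ecut V w ?h' {v})"
      using old good_out[OF good(1) k] cut1[OF v(1)] by (auto simp: b'_def)
  next
    fix A assume A: "A \<subseteq> V" "A \<noteq> V" "2 \<le> card A"
    then have "18 * k < ecut V w ?h A" using irr unfolding irreducible_graph_def by blast
    then show "12 * k \<le> ecut V w ?h' A" using cut[OF A(1)] k by (auto simp: of_bool_def split: if_splits)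
  next
    show "slack k (sum ho V) (sum hi' V)"
      using adm sh slack_mono[of k "sum ho V" "sum hi V" "sum ho V" "sum hi' V"] by (auto simp: admissible_def)
  qed (use fin z sym in auto)
  have "(\<Sum>v\<in>V. ecut V w ?h' {v}) < (\<Sum>v\<in>V. ecut V w ?h {v})"
  proof (rule sum_strict_mono_ex1[OF fin])
    show "\<exists>v\<in>V. ecut V w ?h' {v} < ecut V w ?h {v}" using cut1[OF x(1)] x(1) by (intro bexI[of _ x]) auto
  qed (use cut1 in auto)
  then obtain d where d: "\<forall>u\<in>V. \<forall>v\<in>V. d u v + d v u = w u v"
    and bal: "\<And>u. u \<in> V \<Longrightarrow> [(\<Sum>v\<in>V. int (d u v) - int (d v u)) + int (hi' u) - int (ho u) = b' u] (mod (2 * int k))"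
    using IH[OF adm'] unfolding orientable_def by blast
  have "[(\<Sum>v\<in>V. int (d u v) - int (d v u)) + int (hi u) - int (ho u) = b u] (mod (2 * int k))" if u: "u \<in> V" for u
  proof -
    have "(\<Sum>v\<in>V. int (d u v) - int (d v u)) + int (hi u) - int (ho u)
      = ((\<Sum>v\<in>V. int (d u v) - int (d v u)) + int (hi' u) - int (ho u)) + (b u - b' u)"
      by (simp add: b'_def hi)
    then show ?thesis using cong_add[OF bal[OF u] cong_refl, of "b u - b' u"] by (simp only: add_diff_cancel_left' diff_add_cancel add_diff_eq)
  qed
  then show ?thesis unfolding orientable_def using d by blast
qed

text \<open>Exactly \<open>p + q\<close> edges at \<open>x\<close> become outer edges and settle the
  target of \<open>x\<close>; the others are paired, which preserves the degrees of all remaining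
  vertices. Cuts of larger sets may shrink.\<close>

lemma eliminate_vertex:
  assumes adm: "admissible k V w ho hi b" and irr: "irreducible_graph k V w (\<lambda>x. ho x + hi x)" and k: "0 < k"
    and V3: "3 \<le> card V" and x: "x \<in> V" "ecut V w (\<lambda>x. ho x + hi x) {x} \<le> 12 * k"
    and pq: "p + q < 2 * k" "[int p - int q + int (hi x) - int (ho x) = b x] (mod (2 * int k))"
    and sl: "slack k (sum ho (V - {x}) + p) (sum hi (V - {x}) + q)"
    and IH: "\<And>w' ho' hi'. \<lbrakk>admissible k (V - {x}) w' ho' hi' b;
       \<And>y. y \<in> V - {x} \<Longrightarrow> ecut (V - {x}) w' (\<lambda>x. ho' x + hi' x) {y} = ecut V w (\<lambda>x. ho x + hi x) {y}\<rbrakk>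
       \<Longrightarrow> orientable k (V - {x}) w' ho' hi' b"
  shows "orientable k V w ho hi b"
proof -
  let ?h = "\<lambda>x. ho x + hi x" and ?U = "V - {x}"
  have con: "consistent k V w ho hi b" using adm by (simp add: admissible_def)
  have fin: "finite V" and sym: "\<And>x y. w x y = w y x" and z: "\<And>x. w x x = 0"
    and par: "\<And>x. x \<in> V \<Longrightarrow> even (b x + int (ecut V w ?h {x}))"
    and sb: "[sum b V = (\<Sum>x\<in>V. int (hi x) - int (ho x))] (mod (2 * int k))"
    using con by (auto simp: consistent_def)
  have cU: "card ?U = card V - 1" using x fin by simp
  have Vx: "V \<noteq> {x}" using V3 by auto
  define L where "L = (\<Sum>y\<in>?U. w x y)"
  have L: "ecut V w ?h {x} = ?h x + L" by (simp add: ecut_singleton L_def)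
  have big: "18 * k < ecut V w ?h A" if "A \<subseteq> V" "A \<noteq> V" "2 \<le> card A" for A
    using irr that unfolding irreducible_graph_def by blast
  \<comment> \<open>Here \<open>c\<close> is the cut of \<open>V - {x}\<close>, and \<open>h\<close>
    and \<open>l\<close> count the outer and inner edges at \<open>x\<close>. The conditions on
    \<open>c\<close>, \<open>s\<close> and \<open>d\<close> give \<open>h < 2 * k + l\<close>, and
    then \<open>11 * k \<le> h + l\<close> forces \<open>4 * k < l\<close>.\<close>
  have arith: "\<lbrakk>18 * k < c; c + 2 * h = s + d; s \<le> 20 * k; 11 * k \<le> d; d = h + l\<rbrakk> \<Longrightarrow> 4 * k < l"
    for c h s d l :: nat using k by linarith
  have "18 * k < ecut V w ?h ?U" using cU V3 x(1) by (intro big) auto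
  moreover have "ecut V w ?h ?U + 2 * ?h x = sum ?h V + ecut V w ?h {x}"
    by (rule ecut_remove[OF fin x(1) sym])
  moreover have "sum ?h V \<le> 20 * k"
  proof -
    have "slack k (sum ho V) (sum hi V)" using adm by (simp add: admissible_def)
    then show ?thesis unfolding slack_def sum.distrib by linarith
  qed
  moreover have "11 * k \<le> ecut V w ?h {x}"
    using admissible_singleton[OF adm x(1) Vx] nrm_nonneg[of "int k" "b x"] k by linarith
  ultimately have L4: "4 * k < L" using L by (rule arith)
  have "2 * int k dvd (int p - int q + int (hi x) - int (ho x)) - b x"
    using pq(2) by (simp add: cong_iff_dvd_diff)
  then have "even ((int p - int q + int (hi x) - int (ho x)) - b x)" by (rule dvd_mult_left)
  moreover have "even (b x + int (ho x) + int (hi x) + int L)" using par[OF x(1)] unfolding L by (simp add: add.assoc)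
  ultimately have "even (int p + int q + int L)" by presburger
  then have "even (L - (p + q))" using L4 pq(1) by (simp add: even_diff_nat flip: of_nat_add)
  then obtain N where N: "L - (p + q) = 2 * N" by (elim evenE)
  have Lpq: "L = 2 * N + (p + q)" using N L4 pq(1) by linarith
  \<comment> \<open>Pairing requires every multiplicity to be at most half of the number
    \<open>2 * N\<close> of paired edges; multiplicities are below \<open>k - 1\<close>, and more
    than \<open>2 * k\<close> edges remain to be paired.\<close>
  have Nk: "k \<le> N" using N L4 pq(1) by linarith
  have fU: "finite ?U" using fin by simp
  have "\<exists>s. (\<forall>y. s y \<le> w x y) \<and> sum s ?U = 2 * N"
    by (rule sub_sum[OF fU]) (use Lpq in \<open>simp add: L_def\<close>)
  then obtain s where s: "\<And>y. s y \<le> w x y" "sum s ?U = 2 * N" by blast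
  have sN: "s y \<le> N" if "y \<in> ?U" for y
  proof -
    have "w x y < k - 1" using irr that x(1) unfolding irreducible_graph_def by auto
    then show ?thesis using s(1)[of y] Nk by linarith
  qed
  obtain e where e: "\<And>y z. e y z = e z y" "\<And>y. e y y = 0" "\<And>y. y \<in> ?U \<Longrightarrow> (\<Sum>z\<in>?U. e y z) = s y"
    using pairing[OF fU s(2) sN] by blast
  have rest: "(\<Sum>y\<in>?U. w x y - s y) = p + q"
  proof -
    have "(\<Sum>y\<in>?U. w x y - s y) + sum s ?U = L"
      unfolding L_def sum.distrib[symmetric] by (rule sum.cong) (use s in auto)
    then show ?thesis using s(2) Lpq by simp
  qed
  have "\<exists>ro. (\<forall>y. ro y \<le> w x y - s y) \<and> sum ro ?U = p"
    by (rule sub_sum[OF fU]) (simp add: rest)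
  then obtain ro where ro: "\<And>y. ro y \<le> w x y - s y" "sum ro ?U = p" by blast
  define ri where "ri y = w x y - s y - ro y" for y
  have ri: "ro y + ri y = w x y - s y" for y using ro(1)[of y] by (simp add: ri_def)
  have "sum ro ?U + sum ri ?U = p + q" unfolding sum.distrib[symmetric] ri rest ..
  then have sri: "sum ri ?U = q" using ro(2) by simp
  have r: "(\<Sum>z\<in>?U. e y z) + (ro y + ri y) = w x y" if "y \<in> ?U" for y
    using e(3)[OF that] s(1)[of y] ri[of y] by simp
  let ?w = "\<lambda>y z. w y z + e y z" and ?ho = "\<lambda>y. ho y + ro y" and ?hi = "\<lambda>y. hi y + ri y"
  have hh: "(\<lambda>y. ?ho y + ?hi y) = (\<lambda>y. ?h y + (ro y + ri y))" by auto
  have cut: "ecut ?U ?w (\<lambda>y. ?ho y + ?hi y) X + (\<Sum>y\<in>X. \<Sum>z\<in>X. e y z) = ecut V w ?h X" if "X \<subseteq> ?U" for X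
    unfolding hh by (rule ecut_eliminate[where r = "\<lambda>y. ro y + ri y", OF fin x(1) that])
      (use sym r in auto)
  have cut1: "ecut ?U ?w (\<lambda>y. ?ho y + ?hi y) {y} = ecut V w ?h {y}" if "y \<in> ?U" for y
    using cut[of "{y}"] that e(2) by simp
  have "admissible k ?U ?w ?ho ?hi b"
    unfolding admissible_def consistent_def
  proof (intro conjI ballI allI impI)
    fix y z show "?w y z = ?w z y" using sym[of y z] e(1)[of y z] by simp
  next
    fix y assume "y \<in> ?U"
    then show "even (b y + int (ecut ?U ?w (\<lambda>y. ?ho y + ?hi y) {y}))" using par[of y] cut1[of y] by auto
  next
    have 1: "(\<Sum>y\<in>?U. int (?hi y) - int (?ho y))
      = (\<Sum>y\<in>V. int (hi y) - int (ho y)) - (int p - int q + int (hi x) - int (ho x))"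
      using ro(2) sri sum.remove[OF fin x(1), of "\<lambda>y. int (hi y) - int (ho y)"]
      by (simp add: sum_subtractf sum.distrib flip: of_nat_sum)
    have 2: "sum b ?U = sum b V - b x" using sum.remove[OF fin x(1), of b] by simp
    show "[sum b ?U = (\<Sum>y\<in>?U. int (?hi y) - int (?ho y))] (mod (2 * int k))"
      unfolding 1 2 by (rule cong_diff[OF sb cong_sym[OF pq(2)]])
  next
    show "slack k (sum ?ho ?U) (sum ?hi ?U)" using sl by (simp add: sum.distrib ro(2) sri)
  next
    fix y assume y: "y \<in> ?U" "?U \<noteq> {y}"
    have "V \<noteq> {y}" using y x by auto
    then show "11 * int k + nrm (2 * int k) (b y) \<le> int (ecut ?U ?w (\<lambda>y. ?ho y + ?hi y) {y})"
      unfolding cut1[OF y(1)] using y by (intro admissible_singleton[OF adm]) auto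
  next
    fix A assume A: "A \<subseteq> ?U" "A \<noteq> ?U" "2 \<le> card A"
    have fA: "finite A" using A(1) fU by (rule finite_subset)
    have "18 * k < ecut V w ?h A" using A x by (intro big) auto
    moreover have "card A \<le> card ({x} \<union> A)" using fA by (intro card_mono) auto
    then have "18 * k < ecut V w ?h ({x} \<union> A)" using A x by (intro big) auto
    moreover have "ecut V w ?h ({x} \<union> A) + 2 * (\<Sum>u\<in>{x}. \<Sum>y\<in>A. w u y) = ecut V w ?h {x} + ecut V w ?h A"
      by (rule ecut_union[OF fin _ _ _ sym]) (use A x in auto)
    moreover have "(\<Sum>y\<in>A. \<Sum>z\<in>A. e y z) \<le> (\<Sum>y\<in>A. w x y)"
    proof (rule sum_mono)
      fix y assume y: "y \<in> A"
      have "(\<Sum>z\<in>A. e y z) \<le> (\<Sum>z\<in>?U. e y z)" using A(1) fU by (intro sum_mono2) auto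
      moreover have "y \<in> ?U" using y A(1) by auto
      ultimately show "(\<Sum>z\<in>A. e y z) \<le> w x y" using r[of y] by linarith
    qed
    \<comment> \<open>The old cut minus the edges from \<open>x\<close> to \<open>A\<close> is half
      of: the cut of \<open>A\<close>, plus the cut of \<open>{x} \<union> A\<close>, minus the
      degree of \<open>x\<close>. This exceeds \<open>(18 + 18 - 12) * k / 2\<close>, which is where
      \<open>18\<close> comes from.\<close>
    ultimately show "12 * k \<le> ecut ?U ?w (\<lambda>y. ?ho y + ?hi y) A"
      using cut[OF A(1)] x(2) by simp
  qed (use fU z e in auto)
  then have "orientable k ?U ?w ?ho ?hi b" using cut1 by (intro IH) auto
  then show ?thesis
    by (intro orientable_eliminate[where e = e and ro = ro and ri = ri, OF con x(1) e(1,2) r])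
       (use pq(2) ro(2) sri in simp_all)
qed

text \<open>If no edge can be deleted, then all vertices have degree at most \<open>12 * k\<close> and no edge joins \<open>P\<close>,
  the vertices that could lose an outgoing edge, to the others. Both \<open>P\<close> and its complement have
  boundary at least \<open>11 * k\<close> unless one of them is empty, but there are at most \<open>20 * k\<close> outer edges.\<close>
theorem orientable_if_admissible:
  assumes "0 < k" "admissible k V w ho hi b"
  shows "orientable k V w ho hi b"
  using assms(2)
proof (induction "card V + (\<Sum>x\<in>V. ecut V w (\<lambda>x. ho x + hi x) {x})" arbitrary: V w ho hi b rule: less_induct)
  case less
  let ?h = "\<lambda>x. ho x + hi x"
  have k: "0 < k" by fact
  have adm: "admissible k V w ho hi b" by fact
  then have con: "consistent k V w ho hi b" by (simp add: admissible_def)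
  then have fin: "finite V" and sym: "\<And>x y. w x y = w y x" by (auto simp: consistent_def)
  show ?case
  proof (cases "card V \<le> 1")
    case True
    show ?thesis
    proof (cases "V = {}")
      case False
      then obtain x where "V = {x}" using True fin by (metis card_1_singletonE card_0_eq le_antisym not_less_eq_eq One_nat_def le_zero_eq)
      then show ?thesis using con orientable_singleton[of k x w ho hi b] by simp
    qed (simp add: orientable_def)
  next
    case False
    have contract: "orientable k (insert a (V - A)) (contract A a w) (collect_at A a ho) (collect_at A a hi) (collect_at A a b)"
      if A: "A \<subseteq> V" "a \<in> A" "2 \<le> card A" for A a
    proof (rule less(1)[rotated])
      show "admissible k (insert a (V - A)) (contract A a w) (collect_at A a ho) (collect_at A a hi) (collect_at A a b)"
        by (rule admissible_contract[OF adm A k])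
      let ?V = "insert a (V - A)"
      have fA: "finite A" using A(1) fin by (rule finite_subset)
      have "card ?V = card V - card A + 1" using A fin fA by (simp add: card_Diff_subset)
      moreover have "card A \<le> card V" using A(1) fin by (intro card_mono)
      ultimately have "card ?V < card V" using A(3) by linarith
      moreover have "(\<Sum>x\<in>?V. ecut ?V (contract A a w) (\<lambda>x. collect_at A a ho x + collect_at A a hi x) {x})
         \<le> (\<Sum>x\<in>V. ecut V w ?h {x})"
      proof -
        have "(\<Sum>x\<in>?V. ecut ?V (contract A a w) (\<lambda>x. collect_at A a ho x + collect_at A a hi x) {x})
          = (\<Sum>x\<in>?V. ecut V w ?h (if x = a then A else {x}))"
          using admissible_contract(2)[OF adm A k] A(2) by (intro sum.cong) (auto simp: insert_absorb)
        also have "\<dots> = ecut V w ?h A + (\<Sum>x\<in>V - A. ecut V w ?h {x})"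
        proof -
          have "(\<Sum>x\<in>V - A. ecut V w ?h (if x = a then A else {x})) = (\<Sum>x\<in>V - A. ecut V w ?h {x})"
            using A(2) by (intro sum.cong) auto
          then show ?thesis using A(2) fin by (subst sum.insert) auto
        qed
        also have "\<dots> \<le> (\<Sum>x\<in>A. ecut V w ?h {x}) + (\<Sum>x\<in>V - A. ecut V w ?h {x})"
          using ecut_insert_le(1)[OF fin A(1) sym] by simp
        also have "\<dots> = (\<Sum>x\<in>V. ecut V w ?h {x})"
          using sum.subset_diff[OF A(1) fin, of "\<lambda>x. ecut V w ?h {x}"] by simp
        finally show ?thesis .
      qed
      ultimately show "card ?V + (\<Sum>x\<in>?V. ecut ?V (contract A a w) (\<lambda>x. collect_at A a ho x + collect_at A a hi x) {x})
        < card V + (\<Sum>x\<in>V. ecut V w ?h {x})" by linarith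
    qed
    show ?thesis
    proof (cases "irreducible_graph k V w ?h")
      case False
      then consider (pair) x y where "x \<in> V" "y \<in> V" "x \<noteq> y" "k - 1 \<le> w x y"
        | (set) A where "A \<subseteq> V" "A \<noteq> V" "2 \<le> card A" "ecut V w ?h A \<le> 18 * k"
        unfolding irreducible_graph_def by (meson not_le)
      then show ?thesis
      proof cases
        case pair
        show ?thesis
        proof (rule orientable_contract[OF con])
          show "orientable k (insert x (V - {x, y})) (contract {x, y} x w) (collect_at {x, y} x ho)
            (collect_at {x, y} x hi) (collect_at {x, y} x b)"
            using pair by (intro contract) auto
          show "orientable k {x, y} w ho' hi' b" if "consistent k {x, y} w ho' hi' b" for ho' hi'
            by (rule orientable_pair[OF that pair(3,4) k])
        qed (use pair in auto)
      next
        case set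
        then obtain a where a: "a \<in> A" by fastforce
        show ?thesis
        proof (rule orientable_contract[OF con set(1) a contract[OF set(1) a set(3)]])
          fix ho' hi' assume con': "consistent k A w ho' hi' b"
            and h: "\<And>x. x \<in> A \<Longrightarrow> ho' x + hi' x = ho x + hi x + (\<Sum>y\<in>V - A. w x y)"
          have "card A < card V" using set fin by (intro psubset_card_mono) auto
          moreover have "(\<Sum>x\<in>A. ecut A w (\<lambda>x. ho' x + hi' x) {x}) = (\<Sum>x\<in>A. ecut V w ?h {x})"
            by (intro sum.cong refl ecut_inner[OF fin set(1)] h) auto
          moreover have "(\<Sum>x\<in>A. ecut V w ?h {x}) \<le> (\<Sum>x\<in>V. ecut V w ?h {x})"
            using set fin by (intro sum_mono2) auto
          ultimately show "orientable k A w ho' hi' b"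
            by (intro less(1) admissible_inner[OF adm set(1,2,4) con' h]) auto
        qed
      qed
    next
      case irr: True
      have V3: "3 \<le> card V" using irreducible_card[OF adm irr k] False by simp
      have Vx: "V \<noteq> {x}" for x using V3 by auto
      let ?go = "\<lambda>x. good_out k (b x) (ecut V w ?h {x})" and ?gi = "\<lambda>x. good_in k (b x) (ecut V w ?h {x})"
      have rev: "admissible k V w hi ho (\<lambda>x. - b x)" by (rule admissible_reverse[OF adm])
      have hs: "(\<lambda>x. hi x + ho x) = ?h" by auto
      have irr': "irreducible_graph k V w (\<lambda>x. hi x + ho x)" unfolding hs by (rule irr)
      consider (edge) x y where "x \<in> V" "y \<in> V" "x \<noteq> y" "0 < w x y" "?go x" "?gi y"
        | (out) x where "x \<in> V" "0 < hi x" "?go x"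
        | (inn) x where "x \<in> V" "0 < ho x" "?gi x"
        | (none) "\<And>x y. \<lbrakk>x \<in> V; y \<in> V; x \<noteq> y; ?go x; ?gi y\<rbrakk> \<Longrightarrow> w x y = 0"
           "\<And>x. \<lbrakk>x \<in> V; ?go x\<rbrakk> \<Longrightarrow> hi x = 0" "\<And>x. \<lbrakk>x \<in> V; ?gi x\<rbrakk> \<Longrightarrow> ho x = 0"
        by blast
      then show ?thesis
      proof cases
        case edge
        show ?thesis
          by (rule delete_edge[OF adm irr k edge]) (rule less(1), auto)
      next
        case out
        show ?thesis
          by (rule delete_outer_edge[OF adm irr k out]) (rule less(1), auto)
      next
        case inn
        have go: "good_out k (- b x) (ecut V w (\<lambda>x. hi x + ho x) {x})"
          using inn(3) k unfolding hs good_in_def good_out_def by (auto simp: zmod_zminus1_eq_if[of _ "2 * int k"])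
        show ?thesis
          by (rule orientable_reverse, rule delete_outer_edge[OF rev irr' k inn(1,2) go])
             (rule less(1), auto simp: add.commute)
      next
        case none
        have sub: "orientable k (V - {x}) w' ho' hi' b"
          if "x \<in> V" "admissible k (V - {x}) w' ho' hi' b"
            and c: "\<And>y. y \<in> V - {x} \<Longrightarrow> ecut (V - {x}) w' (\<lambda>x. ho' x + hi' x) {y} = ecut V w ?h {y}"
          for x w' ho' hi'
        proof (rule less(1)[OF _ that(2)])
          have "card (V - {x}) < card V" using that(1) fin by (intro psubset_card_mono) auto
          moreover have "(\<Sum>y\<in>V - {x}. ecut (V - {x}) w' (\<lambda>x. ho' x + hi' x) {y}) = (\<Sum>y\<in>V - {x}. ecut V w ?h {y})"
            using c by (intro sum.cong) auto
          moreover have "\<dots> \<le> (\<Sum>y\<in>V. ecut V w ?h {y})" using fin by (intro sum_mono2) auto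
          ultimately show "card (V - {x}) + (\<Sum>y\<in>V - {x}. ecut (V - {x}) w' (\<lambda>x. ho' x + hi' x) {y})
            < card V + (\<Sum>x\<in>V. ecut V w ?h {x})" by linarith
        qed
        have elim: "orientable k V w ho hi b"
          if "x \<in> V" "ecut V w ?h {x} \<le> 12 * k" "p + q < 2 * k"
            "[int p - int q + int (hi x) - int (ho x) = b x] (mod (2 * int k))"
            "slack k (sum ho (V - {x}) + p) (sum hi (V - {x}) + q)" for x p q
          by (rule eliminate_vertex[OF adm irr k V3 that sub[OF that(1)]])
        have sl: "slack k (sum ho V) (sum hi V)" using adm by (simp add: admissible_def)
        have sho: "sum ho V = ho x + sum ho (V - {x})" and shi: "sum hi V = hi x + sum hi (V - {x})" if "x \<in> V" for x
          by (rule sum.remove[OF fin that])+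
        show ?thesis
        \<comment> \<open>A vertex with target 0 and degree at most \<open>12 * k\<close> can lose
          no edge, but eliminating it is free: the new outer edges have the direction prevailing
          among its old ones and are no more numerous, so \<open>slack\<close> is kept.\<close>
        proof (cases "\<exists>x\<in>V. b x mod (2 * int k) = 0 \<and> ecut V w ?h {x} \<le> 12 * k")
          case True
          then obtain x where "x \<in> V" and x': "b x mod (2 * int k) = 0 \<and> ecut V w ?h {x} \<le> 12 * k" by (rule bexE)
          then have x: "x \<in> V" "b x mod (2 * int k) = 0" "ecut V w ?h {x} \<le> 12 * k" by simp_all
          have b0: "[0 = b x] (mod (2 * int k))" using x(2) by (simp add: cong_def)
          show ?thesis
          proof (cases "hi x \<le> ho x")
            case True
            let ?p = "(ho x - hi x) mod (2 * k)"
            have "[int ?p = int (ho x) - int (hi x)] (mod (2 * int k))"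
              unfolding cong_def using True
              by (simp only: zmod_int of_nat_diff of_nat_mult of_nat_numeral mod_mod_trivial)
            then have "[int ?p + (int (hi x) - int (ho x)) = int (ho x) - int (hi x) + (int (hi x) - int (ho x))] (mod (2 * int k))"
              by (rule cong_add[OF _ cong_refl])
            then have "[int ?p - int 0 + int (hi x) - int (ho x) = b x] (mod (2 * int k))"
              using cong_trans[OF _ b0] by (simp add: algebra_simps)
            moreover have "?p \<le> ho x" using mod_less_eq_dividend[of "ho x - hi x" "2 * k"] by linarith
            then have "slack k (sum ho (V - {x}) + ?p) (sum hi (V - {x}) + 0)"
              using sho[OF x(1)] shi[OF x(1)] by (intro slack_mono[OF sl]) auto
            ultimately show ?thesis using k by (intro elim[OF x(1,3), of ?p 0]) auto
          next
            case False
            let ?p = "(hi x - ho x) mod (2 * k)"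
            have "[int ?p = int (hi x) - int (ho x)] (mod (2 * int k))"
              unfolding cong_def using False
              by (simp only: zmod_int of_nat_diff of_nat_mult of_nat_numeral mod_mod_trivial not_le less_imp_le)
            then have "[int (hi x) - int (ho x) - int ?p = int (hi x) - int (ho x) - (int (hi x) - int (ho x))] (mod (2 * int k))"
              by (rule cong_diff[OF cong_refl])
            then have "[int 0 - int ?p + int (hi x) - int (ho x) = b x] (mod (2 * int k))"
              using cong_trans[OF _ b0] by (simp add: algebra_simps)
            moreover have "?p \<le> hi x" using mod_less_eq_dividend[of "hi x - ho x" "2 * k"] by linarith
            then have "slack k (sum ho (V - {x}) + 0) (sum hi (V - {x}) + ?p)"
              using sho[OF x(1)] shi[OF x(1)] by (intro slack_mono[OF sl]) auto
            ultimately show ?thesis using k by (intro elim[OF x(1,3), of 0 ?p]) auto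
          qed
        next
          case no_zero: False
          have good: "?go y \<or> ?gi y" if "y \<in> V" for y
          proof -
            have "0 \<le> b y mod (2 * int k)" using k by simp
            then show ?thesis using no_zero that unfolding good_out_def good_in_def by force
          qed
          \<comment> \<open>A vertex of larger degree could lose edges of both directions, while
            every vertex can lose one of some direction; with nothing deletable it would have no
            edges at all.\<close>
          have thin: "ecut V w ?h {x} \<le> 12 * k" if x: "x \<in> V" for x
          proof (rule ccontr)
            assume "\<not> ecut V w ?h {x} \<le> 12 * k"
            then have gx: "?go x" "?gi x" by (auto simp: good_out_def good_in_def)
            have "w x y = 0" if "y \<in> V - {x}" for y
              using good[of y] none(1)[of x y] none(1)[of y x] sym[of x y] gx x that by auto
            then have "ecut V w ?h {x} = 0" using none(2,3)[OF x] gx by (simp add: ecut_singleton)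
            then show False using admissible_singleton[OF adm x Vx] nrm_nonneg[of "int k" "b x"] k by simp
          qed
          have nz: "0 < b x mod (2 * int k)" if "x \<in> V" for x
          proof -
            have "0 \<le> b x mod (2 * int k)" using k by simp
            then show ?thesis using no_zero thin[OF that] that by force
          qed
          have low: "11 * k \<le> ecut V w ?h A" if A: "A \<subseteq> V" "A \<noteq> V" "A \<noteq> {}" for A
          proof (cases "2 \<le> card A")
            case True
            then have "18 * k < ecut V w ?h A" using irr A unfolding irreducible_graph_def by blast
            then show ?thesis by linarith
          next
            case False
            have "finite A" using A(1) fin by (rule finite_subset)
            then have "card A = 1" using False A(3) by (metis Suc_1 Suc_leI card_gt_0_iff le_neq_implies_less One_nat_def)
            then obtain x where x: "A = {x}" by (rule card_1_singletonE)
            then have "x \<in> V" using A by auto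
            then have "11 * int k + nrm (2 * int k) (b x) \<le> int (ecut V w ?h {x})"
              by (rule admissible_singleton[OF adm _ Vx])
            then show ?thesis using nrm_nonneg[of "int k" "b x"] k x by simp
          qed
          define P where "P = {x \<in> V. b x mod (2 * int k) \<le> int k}"
          have goP: "?go x" if "x \<in> P" for x using nz that by (auto simp: P_def good_out_def)
          have giN: "?gi x" if "x \<in> V - P" for x using that by (auto simp: P_def good_in_def)
          have PV: "P \<subseteq> V" by (auto simp: P_def)
          have fP: "finite P" using PV fin by (rule finite_subset)
          have "P = V \<or> P = {}"
          proof (rule ccontr)
            assume "\<not> (P = V \<or> P = {})"
            then have ne: "P \<noteq> V" "P \<noteq> {}" "V - P \<noteq> {}" "V - P \<noteq> V" using PV by auto
            have "(\<Sum>x\<in>P. \<Sum>y\<in>V - P. w x y) = 0"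
            proof (intro sum.neutral ballI)
              fix x y assume "x \<in> P" "y \<in> V - P"
              then show "w x y = 0" using none(1)[of x y] goP giN PV by auto
            qed
            moreover have "ecut V w ?h (P \<union> (V - P)) + 2 * (\<Sum>x\<in>P. \<Sum>y\<in>V - P. w x y) = ecut V w ?h P + ecut V w ?h (V - P)"
              by (rule ecut_union[OF fin PV _ _ sym]) auto
            moreover have "P \<union> (V - P) = V" using PV by auto
            moreover have "sum ?h V \<le> 20 * k" using sl unfolding slack_def sum.distrib by linarith
            ultimately have "ecut V w ?h P + ecut V w ?h (V - P) \<le> 20 * k" by (simp add: ecut_whole)
            moreover have "11 * k \<le> ecut V w ?h P" "11 * k \<le> ecut V w ?h (V - P)"
              using ne PV by (auto intro: low)
            ultimately show False using k by linarith
          qed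
          moreover have "V \<noteq> {}" using V3 by auto
          then obtain x where x: "x \<in> V" by blast
          ultimately consider "P = V" | "P = {}" by blast
          then show ?thesis
          proof cases
            \<comment> \<open>All vertices can lose an outgoing edge, so no outer edge leaves
              \<open>V\<close>. The elimination creates fewer than \<open>2 * k\<close> of them,
              which the second alternative of \<open>slack\<close> allows.\<close>
            case 1
            then have hi: "hi y = 0" if "y \<in> V" for y using none(2)[OF that] goP that by blast
            let ?q = "nat ((- (b x + int (ho x))) mod (2 * int k))"
            have q: "int ?q = (- (b x + int (ho x))) mod (2 * int k)" using k by simp
            have "[int ?q = - (b x + int (ho x))] (mod (2 * int k))" unfolding q by (simp add: cong_def)
            then have "[- int ?q - int (ho x) = - (- (b x + int (ho x))) - int (ho x)] (mod (2 * int k))"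
              by (intro cong_diff cong_refl) (simp only: cong_minus_minus_iff)
            then have "[int 0 - int ?q + int (hi x) - int (ho x) = b x] (mod (2 * int k))"
              using hi[OF x] by simp
            moreover have q2: "?q < 2 * k"
            proof -
              have "int ?q < int (2 * k)" unfolding q using k by simp
              then show ?thesis by (simp only: of_nat_less_iff)
            qed
            moreover have "slack k (sum ho (V - {x}) + 0) (sum hi (V - {x}) + ?q)"
              using sl sho[OF x] hi q2 unfolding slack_def by auto
            ultimately show ?thesis by (intro elim[OF x thin[OF x], of 0 ?q]) auto
          next
            case 2
            then have ho: "ho y = 0" if "y \<in> V" for y using none(3)[OF that] giN that by blast
            let ?p = "nat ((b x - int (hi x)) mod (2 * int k))"
            have p: "int ?p = (b x - int (hi x)) mod (2 * int k)" using k by simp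
            have "[int ?p = b x - int (hi x)] (mod (2 * int k))" unfolding p by (simp add: cong_def)
            then have "[int ?p + int (hi x) = b x - int (hi x) + int (hi x)] (mod (2 * int k))"
              by (intro cong_add cong_refl)
            then have "[int ?p - int 0 + int (hi x) - int (ho x) = b x] (mod (2 * int k))"
              using ho[OF x] by simp
            moreover have p2: "?p < 2 * k"
            proof -
              have "int ?p < int (2 * k)" unfolding p using k by simp
              then show ?thesis by (simp only: of_nat_less_iff)
            qed
            moreover have "slack k (sum ho (V - {x}) + ?p) (sum hi (V - {x}) + 0)"
              using sl shi[OF x] ho p2 unfolding slack_def by auto
            ultimately show ?thesis by (intro elim[OF x thin[OF x], of ?p 0]) auto
          qed
        qed
      qed
    qed
  qed
qed

text \<open>If \<open>b\<close> is twice the prescribed out-degree minus the degree, a condition on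
  the balance modulo \<open>2 * k\<close> is one on the out-degree modulo \<open>k\<close>. There
  are no outer edges, and cuts of \<open>12 * k\<close> serve every target.\<close>

theorem modular_orientation:
  fixes w :: "'a \<Rightarrow> 'a \<Rightarrow> nat" and p :: "'a \<Rightarrow> int"
  assumes fin: "finite V" and sym: "\<And>x y. w x y = w y x" and z: "\<And>x. w x x = 0" and k: "0 < k"
    and cuts: "\<And>X. \<lbrakk>X \<subseteq> V; X \<noteq> {}; X \<noteq> V\<rbrakk> \<Longrightarrow> 12 * k \<le> (\<Sum>x\<in>X. \<Sum>y\<in>V - X. w x y)"
    and total: "[2 * sum p V = int (\<Sum>x\<in>V. \<Sum>y\<in>V. w x y)] (mod (2 * int k))"
  shows "\<exists>d. (\<forall>x\<in>V. \<forall>y\<in>V. d x y + d y x = w x y) \<and>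
    (\<forall>x\<in>V. [int (\<Sum>y\<in>V. d x y) = p x] (mod int k))"
proof -
  define b where "b x = 2 * p x - int (\<Sum>y\<in>V. w x y)" for x
  let ?z = "\<lambda>_. 0 :: nat" and ?zz = "\<lambda>x. (0::nat) + 0"
  have cut: "ecut V w ?zz X = (\<Sum>x\<in>X. \<Sum>y\<in>V - X. w x y)" for X by (simp add: ecut_def)
  have cut1: "ecut V w ?zz {x} = (\<Sum>y\<in>V. w x y)" if "x \<in> V" for x
    unfolding cut using sum.remove[OF fin that, of "w x"] z by simp
  have con: "consistent k V w ?z ?z b"
    unfolding consistent_def
  proof (intro conjI ballI)
    fix x assume "x \<in> V"
    then show "even (b x + int (ecut V w ?zz {x}))" unfolding b_def by (subst cut1) simp_all
  next
    have "[2 * sum p V - int (\<Sum>x\<in>V. \<Sum>y\<in>V. w x y) = int (\<Sum>x\<in>V. \<Sum>y\<in>V. w x y) - int (\<Sum>x\<in>V. \<Sum>y\<in>V. w x y)] (mod (2 * int k))"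
      by (rule cong_diff[OF total cong_refl])
    then show "[sum b V = (\<Sum>x\<in>V. int 0 - int 0)] (mod (2 * int k))"
      by (simp add: b_def sum_subtractf sum_distrib_left)
  qed (use fin sym z in auto)
  have "admissible k V w ?z ?z b"
    unfolding admissible_def
  proof (intro conjI ballI allI impI con)
    fix x assume x: "x \<in> V" "V \<noteq> {x}"
    have "12 * k \<le> ecut V w ?zz {x}" unfolding cut by (rule cuts) (use x in auto)
    then show "11 * int k + nrm (2 * int k) (b x) \<le> int (ecut V w ?zz {x})"
      using nrm_le[of "int k" "b x"] k by linarith
  next
    fix A assume "A \<subseteq> V" "A \<noteq> V" "2 \<le> card A"
    then show "12 * k \<le> ecut V w ?zz A" unfolding cut by (intro cuts) auto
  qed (simp add: slack_def)
  then have "orientable k V w ?z ?z b" by (rule orientable_if_admissible[OF k])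
  then obtain d where d: "\<forall>x\<in>V. \<forall>y\<in>V. d x y + d y x = w x y"
    and bal: "\<forall>x\<in>V. [(\<Sum>y\<in>V. int (d x y) - int (d y x)) + int 0 - int 0 = b x] (mod (2 * int k))"
    unfolding orientable_def by (elim exE conjE)
  have "[int (\<Sum>y\<in>V. d x y) = p x] (mod int k)" if x: "x \<in> V" for x
  proof -
    have "(\<Sum>y\<in>V. int (d x y) - int (d y x)) = (\<Sum>y\<in>V. 2 * int (d x y) - int (w x y))"
    proof (rule sum.cong[OF refl])
      fix y assume "y \<in> V"
      then have "d x y + d y x = w x y" using d x by simp
      then show "int (d x y) - int (d y x) = 2 * int (d x y) - int (w x y)" by linarith
    qed
    also have "\<dots> = 2 * int (\<Sum>y\<in>V. d x y) - int (\<Sum>y\<in>V. w x y)"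
      by (simp add: sum_subtractf sum_distrib_left)
    finally have eq: "(\<Sum>y\<in>V. int (d x y) - int (d y x)) + int 0 - int 0 - b x = 2 * (int (\<Sum>y\<in>V. d x y) - p x)"
      by (simp add: b_def)
    have "2 * int k dvd (\<Sum>y\<in>V. int (d x y) - int (d y x)) + int 0 - int 0 - b x"
      using bspec[OF bal x] by (simp only: cong_iff_dvd_diff)
    then have "2 * int k dvd 2 * (int (\<Sum>y\<in>V. d x y) - p x)" unfolding eq .
    then have "int k dvd int (\<Sum>y\<in>V. d x y) - p x" by (simp only: dvd_mult_cancel_left) simp
    then show ?thesis by (simp only: cong_iff_dvd_diff)
  qed
  then show ?thesis using d by (intro exI[of _ d] conjI ballI) simp_all
qed

section \<open>Bounded orientations and branchings\<close>

text \<open>If neither end of the last edge can own it, there are tight sets around both ends separating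
  them, and by supermodularity their union is overfull.\<close>
theorem bounded_ownership:
  fixes E :: "('a \<times> 'a) set" and f :: "'a \<Rightarrow> nat"
  assumes V: "finite V" and E: "E \<subseteq> V \<times> V" "\<And>v. (v, v) \<notin> E"
    and f: "\<And>X. X \<subseteq> V \<Longrightarrow> card (E \<inter> X \<times> X) \<le> sum f X"
  shows "\<exists>S\<subseteq>E. \<forall>v\<in>V. card {e \<in> S. fst e = v} + card {e \<in> E - S. snd e = v} \<le> f v"
proof -
  have finE: "finite E" using V E(1) by (meson finite_SigmaI finite_subset)
  then show ?thesis using E f
  proof (induction E arbitrary: f rule: finite_induct)
    case empty
    then show ?case by auto
  next
    case (insert e E)
    obtain u v where e: "e = (u, v)" by (cases e)
    have uv: "u \<in> V" "v \<in> V" "u \<noteq> v" using insert.prems(1,2) e by auto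
    let ?E = "insert e E"
    have finX: "finite X" if "X \<subseteq> V" for X using that V by (rule finite_subset)
    have f: "card (?E \<inter> X \<times> X) \<le> sum f X" if "X \<subseteq> V" for X using insert.prems(3)[OF that] .
    have in_both: "card (?E \<inter> X \<times> X) = Suc (card (E \<inter> X \<times> X))" if "u \<in> X" "v \<in> X" for X
    proof -
      have "?E \<inter> X \<times> X = insert e (E \<inter> X \<times> X)" using that e by auto
      then show ?thesis using insert.hyps by simp
    qed
    have not_both: "?E \<inter> X \<times> X = E \<inter> X \<times> X" if "\<not> (u \<in> X \<and> v \<in> X)" for X
      using that e by auto
    \<comment> \<open>The end \<open>x\<close> may own the last edge, at the price of one unit of
      \<open>f x\<close>, if every set containing \<open>x\<close> but not both ends has room to
      spare.\<close>
    have red: "\<exists>S\<subseteq>E. \<forall>y\<in>V. card {e \<in> S. fst e = y} + card {e \<in> E - S. snd e = y} \<le> (f(x := f x - 1)) y"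
      if x: "x = u \<or> x = v" and nt: "\<And>X. \<lbrakk>X \<subseteq> V; x \<in> X; \<not> (u \<in> X \<and> v \<in> X)\<rbrakk> \<Longrightarrow> card (?E \<inter> X \<times> X) < sum f X" for x
    proof (rule insert.IH)
      have xV: "x \<in> V" using x uv by auto
      have pos: "0 < f x" using nt[of "{x}"] x uv by auto
      fix X assume X: "X \<subseteq> V"
      have sx: "sum (f(x := f x - 1)) X + 1 = sum f X" if "x \<in> X"
        using pos that finX[OF X] by (simp add: sum.remove[of X x])
      show "card (E \<inter> X \<times> X) \<le> sum (f(x := f x - 1)) X"
      proof (cases "x \<in> X")
        case True
        show ?thesis
        proof (cases "u \<in> X \<and> v \<in> X")
          case True
          then show ?thesis using in_both[of X] f[OF X] sx x by auto
        next
          case False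
          then show ?thesis using nt[OF X True False] not_both[OF False] sx[OF True] by simp
        qed
      next
        case False
        then have "\<not> (u \<in> X \<and> v \<in> X)" using x by auto
        moreover have "sum (f(x := f x - 1)) X = sum f X" using False by (intro sum.cong) auto
        ultimately show ?thesis using not_both[of X] f[OF X] by simp
      qed
    qed (use insert.prems(1,2) in auto)
    have "(\<forall>X\<subseteq>V. u \<in> X \<longrightarrow> v \<notin> X \<longrightarrow> card (?E \<inter> X \<times> X) < sum f X)
      \<or> (\<forall>X\<subseteq>V. v \<in> X \<longrightarrow> u \<notin> X \<longrightarrow> card (?E \<inter> X \<times> X) < sum f X)"
    proof (rule ccontr)
      assume "\<not> ?thesis"
      then obtain X Y where X: "X \<subseteq> V" "u \<in> X" "v \<notin> X" "sum f X \<le> card (?E \<inter> X \<times> X)"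
        and Y: "Y \<subseteq> V" "v \<in> Y" "u \<notin> Y" "sum f Y \<le> card (?E \<inter> Y \<times> Y)" by (auto simp: not_less)
      let ?X = "?E \<inter> X \<times> X" and ?Y = "?E \<inter> Y \<times> Y"
      have fin: "finite ?X" "finite ?Y" using insert.hyps by auto
      have "card ?X + card ?Y = card (?X \<union> ?Y) + card (?X \<inter> ?Y)" using fin by (rule card_Un_Int)
      moreover have "e \<notin> ?X \<union> ?Y" using X Y e by auto
      then have "card (?X \<union> ?Y) + 1 = card (insert e (?X \<union> ?Y))" using fin by simp
      moreover have "card (insert e (?X \<union> ?Y)) \<le> card (?E \<inter> (X \<union> Y) \<times> (X \<union> Y))"
        using insert.hyps X Y e by (intro card_mono) auto
      moreover have "card (?X \<inter> ?Y) = card (?E \<inter> (X \<inter> Y) \<times> (X \<inter> Y))" by (rule arg_cong[of _ _ card]) auto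
      moreover have "card (?E \<inter> (X \<union> Y) \<times> (X \<union> Y)) \<le> sum f (X \<union> Y)" using X Y by (intro f) auto
      moreover have "card (?E \<inter> (X \<inter> Y) \<times> (X \<inter> Y)) \<le> sum f (X \<inter> Y)" using X Y by (intro f) auto
      moreover have "sum f (X \<union> Y) + sum f (X \<inter> Y) = sum f X + sum f Y"
        using X Y finX by (intro sum.union_inter) auto
      ultimately show False using X(4) Y(4) by linarith
    qed
    then show ?case
    proof
      assume nt: "\<forall>X\<subseteq>V. u \<in> X \<longrightarrow> v \<notin> X \<longrightarrow> card (?E \<inter> X \<times> X) < sum f X"
      then obtain S where S: "S \<subseteq> E" "\<And>y. y \<in> V \<Longrightarrow> card {e \<in> S. fst e = y} + card {e \<in> E - S. snd e = y} \<le> (f(u := f u - 1)) y"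
        using red[of u] by auto
      have "0 < f u" using nt[rule_format, of "{u}"] uv by auto
      have fS: "finite S" using S(1) insert.hyps by (auto intro: finite_subset)
      have D: "?E - insert e S = E - S" using insert.hyps by auto
      have "card {a \<in> insert e S. fst a = y} + card {a \<in> ?E - insert e S. snd a = y} \<le> f y" if y: "y \<in> V" for y
      proof (cases "y = u")
        case True
        have "{a \<in> insert e S. fst a = y} = insert e {a \<in> S. fst a = y}" using True e by auto
        moreover have "card (insert e {a \<in> S. fst a = y}) = Suc (card {a \<in> S. fst a = y})"
          using fS S(1) insert.hyps by (subst card_insert_disjoint) auto
        ultimately show ?thesis using S(2)[OF y] True \<open>0 < f u\<close> unfolding D by simp
      next
        case False
        have "{a \<in> insert e S. fst a = y} = {a \<in> S. fst a = y}" using False e by auto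
        then show ?thesis using S(2)[OF y] False unfolding D by simp
      qed
      then show ?case using S(1) by (intro exI[of _ "insert e S"]) auto
    next
      assume nt: "\<forall>X\<subseteq>V. v \<in> X \<longrightarrow> u \<notin> X \<longrightarrow> card (?E \<inter> X \<times> X) < sum f X"
      then obtain S where S: "S \<subseteq> E" "\<And>y. y \<in> V \<Longrightarrow> card {e \<in> S. fst e = y} + card {e \<in> E - S. snd e = y} \<le> (f(v := f v - 1)) y"
        using red[of v] by auto
      have "0 < f v" using nt[rule_format, of "{v}"] uv by auto
      have D: "?E - S = insert e (E - S)" using insert.hyps S(1) by auto
      have "card {a \<in> S. fst a = y} + card {a \<in> ?E - S. snd a = y} \<le> f y" if y: "y \<in> V" for y
      proof (cases "y = v")
        case True
        have "{a \<in> insert e (E - S). snd a = y} = insert e {a \<in> E - S. snd a = y}" using True e by auto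
        moreover have "card (insert e {a \<in> E - S. snd a = y}) = Suc (card {a \<in> E - S. snd a = y})"
          using insert.hyps by (subst card_insert_disjoint) auto
        ultimately show ?thesis using S(2)[OF y] True \<open>0 < f v\<close> unfolding D by simp
      next
        case False
        have "{a \<in> insert e (E - S). snd a = y} = {a \<in> E - S. snd a = y}" using False e by auto
        then show ?thesis using S(2)[OF y] False unfolding D by simp
      qed
      then show ?case using S(1) by (intro exI[of _ S]) auto
    qed
  qed
qed

section \<open>Arc-disjoint branchings\<close>

definition entering :: "('a \<times> 'a) set \<Rightarrow> 'a set \<Rightarrow> ('a \<times> 'a) set" where
  "entering D X = {e \<in> D. fst e \<notin> X \<and> snd e \<in> X}"

lemma entering_submodular:
  assumes "finite D"
  shows "card (entering D (X \<inter> Y)) + card (entering D (X \<union> Y)) \<le> card (entering D X) + card (entering D Y)"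
proof -
  let ?a = "entering D (X \<inter> Y)" and ?b = "entering D (X \<union> Y)"
  have fin: "finite (entering D Z)" for Z using assms by (simp add: entering_def)
  have "card ?a + card ?b = card (?a \<union> ?b) + card (?a \<inter> ?b)" by (rule card_Un_Int[OF fin fin])
  also have "\<dots> \<le> card (entering D X \<union> entering D Y) + card (entering D X \<inter> entering D Y)"
    by (intro add_mono card_mono finite_UnI finite_Int fin disjI1) (auto simp: entering_def)
  also have "\<dots> = card (entering D X) + card (entering D Y)" by (rule card_Un_Int[OF fin fin, symmetric])
  finally show ?thesis .
qed

text \<open>Growing a branching as in Lovasz's proof of Edmonds' theorem: the next arc is chosen inside a
  minimal critical set that is not yet covered.\<close>
lemma extend_branching:
  fixes D T :: "('a \<times> 'a) set"
  assumes V: "finite V" "finite D" "D \<subseteq> V \<times> V"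
    and D: "\<And>X. \<lbrakk>X \<subseteq> V - {r}; X \<noteq> {}\<rbrakk> \<Longrightarrow> Suc t \<le> card (entering D X)"
    and S: "r \<in> S" "S \<subseteq> V"
    and T: "T \<subseteq> D" "snd ` T \<subseteq> S" "\<And>v. card {e \<in> T. snd e = v} \<le> 1"
      "\<And>X. \<lbrakk>X \<subseteq> V - {r}; X \<noteq> {}\<rbrakk> \<Longrightarrow> t \<le> card (entering (D - T) X)"
      "\<And>X. \<lbrakk>X \<subseteq> V - {r}; X \<inter> S \<noteq> {}\<rbrakk> \<Longrightarrow> entering T X \<noteq> {}"
  shows "\<exists>T\<subseteq>D. (\<forall>v. card {e \<in> T. snd e = v} \<le> 1) \<and>
    (\<forall>X\<subseteq>V - {r}. X \<noteq> {} \<longrightarrow> t \<le> card (entering (D - T) X) \<and> entering T X \<noteq> {})"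
  using S T
proof (induction "card (V - S)" arbitrary: S T rule: less_induct)
  case less
  note S = less.prems(1,2) and T = less.prems(3-7)
  show ?case
  proof (cases "S = V")
    case True
    have "entering T X \<noteq> {}" if "X \<subseteq> V - {r}" "X \<noteq> {}" for X
      using T(5)[of X] that True by auto
    then show ?thesis using T by (intro exI[of _ T]) auto
  next
    case False
    \<comment> \<open>Arcs entering such a set must not be used, since only \<open>t\<close> of them
      are left. Sets inside \<open>S\<close> are not listed because every new arc has its head
      outside of \<open>S\<close>.\<close>
    let ?crit = "\<lambda>X. X \<subseteq> V - {r} \<and> \<not> X \<subseteq> S \<and> card (entering (D - T) X) = t"
    have fD: "finite (D - T)" using V by simp
    have fin: "finite (entering (D - T) X)" for X using V(2) by (simp add: entering_def)
    have new: "entering (D - T) X = entering D X" if "X \<inter> S = {}" for X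
      using T(2) that by (auto simp: entering_def)
    obtain u v where uv: "(u, v) \<in> D - T" "u \<in> S" "v \<notin> S"
      and ok: "\<And>Y. \<lbrakk>Y \<subseteq> V - {r}; u \<notin> Y; v \<in> Y\<rbrakk> \<Longrightarrow> t < card (entering (D - T) Y)"
    proof (cases "\<exists>X. ?crit X")
      case True
      define X where "X = arg_min card ?crit"
      have X: "?crit X" and Xmin: "\<And>Y. ?crit Y \<Longrightarrow> card X \<le> card Y"
        unfolding X_def using True arg_min_nat_lemma[of ?crit _ card] by blast+
      have fX: "finite X" using X V by (meson finite_Diff finite_subset)
      \<comment> \<open>No arc of \<open>T\<close> ends in \<open>X - S\<close>, so more than
        \<open>t\<close> remaining arcs enter this set, and one of them starts in \<open>X\<close>,
        hence in \<open>X \<inter> S\<close>.\<close>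
      have "Suc t \<le> card (entering (D - T) (X - S))"
        unfolding new[OF Diff_disjoint[THEN trans[OF Int_commute]]] by (rule D) (use X in auto)
      then have "\<not> entering (D - T) (X - S) \<subseteq> entering (D - T) X"
        using X card_mono[OF fin, of "entering (D - T) (X - S)" X] by auto
      then obtain e where e: "e \<in> entering (D - T) (X - S)" "e \<notin> entering (D - T) X" by blast
      obtain u v where uv: "e = (u, v)" by (cases e)
      have 1: "(u, v) \<in> D - T" "u \<in> X" "u \<in> S" "v \<in> X" "v \<notin> S" using e uv by (auto simp: entering_def)
      have "t < card (entering (D - T) Y)" if Y: "Y \<subseteq> V - {r}" "u \<notin> Y" "v \<in> Y" for Y
      proof (rule ccontr)
        assume "\<not> t < card (entering (D - T) Y)"
        moreover have "card (entering (D - T) (X \<inter> Y)) + card (entering (D - T) (X \<union> Y))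
            \<le> card (entering (D - T) X) + card (entering (D - T) Y)" by (rule entering_submodular[OF fD])
        moreover have "t \<le> card (entering (D - T) (X \<union> Y))" using X Y 1 by (intro T(4)) auto
        moreover have "t \<le> card (entering (D - T) (X \<inter> Y))" using X Y 1 by (intro T(4)) auto
        \<comment> \<open>Submodularity makes the intersection critical as well; it lacks
          \<open>u\<close>, which contradicts the minimality of \<open>X\<close>.\<close>
        ultimately have "card (entering (D - T) (X \<inter> Y)) = t" using X by linarith
        then have "?crit (X \<inter> Y)" using X Y 1 by auto
        then have "card X \<le> card (X \<inter> Y)" by (rule Xmin)
        moreover have "X \<inter> Y \<subset> X" using 1 Y by auto
        then have "card (X \<inter> Y) < card X" by (rule psubset_card_mono[OF fX])
        ultimately show False by simp
      qed
      then show ?thesis using 1 that by blast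
    next
      case no_crit: False
      have "Suc t \<le> card (entering (D - T) (V - S))"
        unfolding new[OF Diff_disjoint[THEN trans[OF Int_commute]]] by (rule D) (use S False in auto)
      then have "entering (D - T) (V - S) \<noteq> {}" by auto
      then obtain e where e: "e \<in> entering (D - T) (V - S)" by blast
      obtain u v where uv: "e = (u, v)" by (cases e)
      have 1: "(u, v) \<in> D - T" "u \<in> S" "v \<notin> S" using e uv V(3) by (auto simp: entering_def)
      have "t < card (entering (D - T) Y)" if Y: "Y \<subseteq> V - {r}" "u \<notin> Y" "v \<in> Y" for Y
        using T(4)[of Y] no_crit Y 1 by (metis empty_iff le_neq_implies_less subsetD)
      then show ?thesis using 1 that by blast
    qed
    have vV: "v \<in> V" using uv V(3) by auto
    let ?T = "insert (u, v) T" and ?S = "insert v S"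
    show ?thesis
    proof (rule less.hyps[of ?S ?T])
      show "card (V - ?S) < card (V - S)" using vV uv V by (intro psubset_card_mono) auto
      show "card {e \<in> ?T. snd e = x} \<le> 1" for x
      proof (cases "x = v")
        case True
        have "{e \<in> ?T. snd e = x} = {(u, v)}" using T(2) uv True by auto
        then show ?thesis by simp
      next
        case False
        then have "{e \<in> ?T. snd e = x} = {e \<in> T. snd e = x}" by auto
        then show ?thesis using T(3) by simp
      qed
      show "t \<le> card (entering (D - ?T) X)" if X: "X \<subseteq> V - {r}" "X \<noteq> {}" for X
      proof (cases "u \<notin> X \<and> v \<in> X")
        case True
        have "entering (D - T) X = insert (u, v) (entering (D - ?T) X)"
          using uv True by (auto simp: entering_def)
        moreover have "(u, v) \<notin> entering (D - ?T) X" by (simp add: entering_def)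
        moreover have "finite (entering (D - ?T) X)" using V by (simp add: entering_def)
        ultimately have "card (entering (D - T) X) = Suc (card (entering (D - ?T) X))" by simp
        then show ?thesis using ok[of X] X True by simp
      next
        case False
        have "entering (D - ?T) X = entering (D - T) X" using False by (auto simp: entering_def)
        then show ?thesis using T(4)[OF X] by simp
      qed
      show "entering ?T X \<noteq> {}" if X: "X \<subseteq> V - {r}" "X \<inter> ?S \<noteq> {}" for X
      proof (cases "X \<inter> S = {}")
        case True
        then have "(u, v) \<in> entering ?T X" using X uv by (auto simp: entering_def)
        then show ?thesis by blast
      next
        case False
        then have "entering T X \<noteq> {}" using T(5) X by blast
        then show ?thesis by (auto simp: entering_def)
      qed
    qed (use S T uv vV in auto)
  qed
qed

text \<open>\<open>R\<close> is a union of \<open>s\<close> branchings removed one at a time. Each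
  supplies an entering arc to every nonempty set avoiding the root and at most one arc to every
  head, so that connectivity \<open>s\<close> costs in-degree at most \<open>s\<close>.\<close>

theorem branching_packing:
  fixes D :: "('a \<times> 'a) set"
  assumes V: "finite V" "finite D" "D \<subseteq> V \<times> V" "r \<in> V"
    and "\<And>X. \<lbrakk>X \<subseteq> V - {r}; X \<noteq> {}\<rbrakk> \<Longrightarrow> s + t \<le> card (entering D X)"
  shows "\<exists>R\<subseteq>D. (\<forall>X\<subseteq>V - {r}. X \<noteq> {} \<longrightarrow> s \<le> card (entering R X) \<and> t \<le> card (entering (D - R) X)) \<and>
    (\<forall>v. card {e \<in> R. snd e = v} \<le> s)"
  using assms(5)
proof (induction s arbitrary: t)
  case 0
  then show ?case by (intro exI[of _ "{}"]) auto
next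
  case (Suc s)
  obtain R where R: "R \<subseteq> D" "\<And>X. \<lbrakk>X \<subseteq> V - {r}; X \<noteq> {}\<rbrakk> \<Longrightarrow> s \<le> card (entering R X)"
      "\<And>X. \<lbrakk>X \<subseteq> V - {r}; X \<noteq> {}\<rbrakk> \<Longrightarrow> Suc t \<le> card (entering (D - R) X)"
      "\<And>v. card {e \<in> R. snd e = v} \<le> s"
    using Suc.IH[of "Suc t"] Suc.prems by auto
  have "\<exists>T\<subseteq>D - R. (\<forall>v. card {e \<in> T. snd e = v} \<le> 1) \<and>
    (\<forall>X\<subseteq>V - {r}. X \<noteq> {} \<longrightarrow> t \<le> card (entering (D - R - T) X) \<and> entering T X \<noteq> {})"
  proof (rule extend_branching[where S = "{r}" and T = "{}"])
    show "Suc t \<le> card (entering (D - R) X)" if "X \<subseteq> V - {r}" "X \<noteq> {}" for X using that by (rule R(3))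
    show "t \<le> card (entering (D - R - {}) X)" if "X \<subseteq> V - {r}" "X \<noteq> {}" for X
      using Suc_leD[OF R(3)[OF that]] by simp
  qed (use V in auto)
  then obtain T where T1: "T \<subseteq> D - R" "\<forall>v. card {e \<in> T. snd e = v} \<le> 1"
    and T2: "\<forall>X\<subseteq>V - {r}. X \<noteq> {} \<longrightarrow> t \<le> card (entering (D - R - T) X) \<and> entering T X \<noteq> {}"
    by (elim exE conjE) (rule that)
  have T: "T \<subseteq> D - R" "\<And>v. card {e \<in> T. snd e = v} \<le> 1"
     "\<And>X. \<lbrakk>X \<subseteq> V - {r}; X \<noteq> {}\<rbrakk> \<Longrightarrow> t \<le> card (entering (D - R - T) X)"
     "\<And>X. \<lbrakk>X \<subseteq> V - {r}; X \<noteq> {}\<rbrakk> \<Longrightarrow> entering T X \<noteq> {}"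
    using T1 T2 by simp_all
  have fin: "finite R" "finite T" using R(1) T(1) V(2) by (auto intro: finite_subset)
  have disj: "R \<inter> T = {}" using T(1) by auto
  show ?case
  proof (intro exI[of _ "R \<union> T"] conjI allI impI)
    show "R \<union> T \<subseteq> D" using R(1) T(1) by auto
    fix X assume X: "X \<subseteq> V - {r}" "X \<noteq> {}"
    have "entering (R \<union> T) X = entering R X \<union> entering T X" by (auto simp: entering_def)
    moreover have "card (entering R X \<union> entering T X) = card (entering R X) + card (entering T X)"
      using fin disj by (intro card_Un_disjoint) (auto simp: entering_def)
    moreover have "0 < card (entering T X)" using T(4)[OF X] fin by (simp add: card_gt_0_iff entering_def)
    ultimately show "Suc s \<le> card (entering (R \<union> T) X)" using R(2)[OF X] by simp
    have "D - (R \<union> T) = D - R - T" by auto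
    then show "t \<le> card (entering (D - (R \<union> T)) X)" using T(3)[OF X] by simp
  next
    fix v
    have "{e \<in> R \<union> T. snd e = v} = {e \<in> R. snd e = v} \<union> {e \<in> T. snd e = v}" by auto
    then have "card {e \<in> R \<union> T. snd e = v} \<le> card {e \<in> R. snd e = v} + card {e \<in> T. snd e = v}"
      by (simp add: card_Un_le)
    then show "card {e \<in> R \<union> T. snd e = v} \<le> Suc s" using R(4)[of v] T(2)[of v] by linarith
  qed
qed

section \<open>Decompositions of bipartite graphs\<close>

definition out_deg :: "('a \<times> 'a) set \<Rightarrow> 'a \<Rightarrow> nat" where
  "out_deg F v = card {e \<in> F. fst e = v}"

definition in_deg :: "('a \<times> 'a) set \<Rightarrow> 'a \<Rightarrow> nat" where
  "in_deg F v = card {e \<in> F. snd e = v}"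

definition crossing :: "('a \<times> 'a) set \<Rightarrow> 'a set \<Rightarrow> ('a \<times> 'a) set" where
  "crossing F X = {e \<in> F. (fst e \<in> X) \<noteq> (snd e \<in> X)}"

lemma sum_out_deg: "finite F \<Longrightarrow> finite Y \<Longrightarrow> (\<Sum>a\<in>Y. out_deg F a) = card {e \<in> F. fst e \<in> Y}"
proof -
  assume fin: "finite F" "finite Y"
  let ?S = "{e \<in> F. fst e \<in> Y}"
  have "(\<Sum>y\<in>Y. sum (\<lambda>_. 1::nat) {x \<in> ?S. fst x = y}) = sum (\<lambda>_. 1) ?S"
    by (rule sum.group) (use fin in auto)
  moreover have "{x \<in> ?S. fst x = y} = {e \<in> F. fst e = y}" if "y \<in> Y" for y using that by auto
  ultimately show ?thesis by (simp add: out_deg_def)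
qed

lemma sum_in_deg: "finite F \<Longrightarrow> finite Y \<Longrightarrow> (\<Sum>a\<in>Y. in_deg F a) = card {e \<in> F. snd e \<in> Y}"
proof -
  assume fin: "finite F" "finite Y"
  let ?S = "{e \<in> F. snd e \<in> Y}"
  have "(\<Sum>y\<in>Y. sum (\<lambda>_. 1::nat) {x \<in> ?S. snd x = y}) = sum (\<lambda>_. 1) ?S"
    by (rule sum.group) (use fin in auto)
  moreover have "{x \<in> ?S. snd x = y} = {e \<in> F. snd e = y}" if "y \<in> Y" for y using that by auto
  ultimately show ?thesis by (simp add: in_deg_def)
qed

lemma out_deg_Diff: "finite F \<Longrightarrow> S \<subseteq> F \<Longrightarrow> out_deg (F - S) v + out_deg S v = out_deg F v"
  unfolding out_deg_def
  by (subst card_Un_disjoint[symmetric]) (auto intro: finite_subset arg_cong[of _ _ card])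

lemma in_deg_Diff: "finite F \<Longrightarrow> S \<subseteq> F \<Longrightarrow> in_deg (F - S) v + in_deg S v = in_deg F v"
  unfolding in_deg_def
  by (subst card_Un_disjoint[symmetric]) (auto intro: finite_subset arg_cong[of _ _ card])

text \<open>A selected edge is owned by its end in \<open>A\<close>, any other edge by its end in
  \<open>B\<close>. The capacities \<open>x a\<close> and \<open>in_deg F b - y b\<close> bound the
  degrees from one side each, and the equality of the two sums makes all bounds exact.\<close>

lemma degree_constrained_subgraph:
  fixes F :: "('a \<times> 'a) set" and x y :: "'a \<Rightarrow> nat"
  assumes fin: "finite A" "finite B" and AB: "A \<inter> B = {}" and F: "F \<subseteq> A \<times> B"
    and le: "\<And>b. b \<in> B \<Longrightarrow> y b \<le> in_deg F b"
    and eq: "sum x A = sum y B"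
    and cond: "\<And>X Y. \<lbrakk>Y \<subseteq> A; X \<subseteq> B\<rbrakk> \<Longrightarrow> card (F \<inter> Y \<times> X) + sum y X \<le> sum x Y + (\<Sum>b\<in>X. in_deg F b)"
  shows "\<exists>P\<subseteq>F. (\<forall>a\<in>A. out_deg P a = x a) \<and> (\<forall>b\<in>B. in_deg P b = y b)"
proof -
  have finF: "finite F" using fin F by (meson finite_SigmaI finite_subset)
  define f where "f v = (if v \<in> A then x v else in_deg F v - y v)" for v
  have "\<exists>P\<subseteq>F. \<forall>v\<in>A \<union> B. card {e \<in> P. fst e = v} + card {e \<in> F - P. snd e = v} \<le> f v"
  proof (rule bounded_ownership)
    show "finite (A \<union> B)" "F \<subseteq> (A \<union> B) \<times> (A \<union> B)" "(v, v) \<notin> F" for v using fin F AB by auto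
    fix Z assume Z: "Z \<subseteq> A \<union> B"
    have "F \<inter> Z \<times> Z = F \<inter> (Z \<inter> A) \<times> (Z \<inter> B)" using F by auto
    moreover have "sum f Z = sum x (Z \<inter> A) + (\<Sum>b\<in>Z \<inter> B. in_deg F b - y b)"
    proof -
      have "Z = (Z \<inter> A) \<union> (Z \<inter> B)" using Z by auto
      then have "sum f Z = sum f (Z \<inter> A) + sum f (Z \<inter> B)"
        using fin AB by (metis (no_types, lifting) finite_Int inf_assoc inf_bot_right inf_commute sum.union_disjoint)
      moreover have "sum f (Z \<inter> B) = (\<Sum>b\<in>Z \<inter> B. in_deg F b - y b)"
        by (rule sum.cong) (use AB in \<open>auto simp: f_def\<close>)
      moreover have "sum f (Z \<inter> A) = sum x (Z \<inter> A)"
        by (rule sum.cong) (auto simp: f_def)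
      ultimately show ?thesis by simp
    qed
    moreover have "(\<Sum>b\<in>Z \<inter> B. in_deg F b - y b) + sum y (Z \<inter> B) = (\<Sum>b\<in>Z \<inter> B. in_deg F b)"
      unfolding sum.distrib[symmetric] by (rule sum.cong) (use le in auto)
    moreover have "card (F \<inter> (Z \<inter> A) \<times> (Z \<inter> B)) + sum y (Z \<inter> B) \<le> sum x (Z \<inter> A) + (\<Sum>b\<in>Z \<inter> B. in_deg F b)"
      by (rule cond) auto
    ultimately show "card (F \<inter> Z \<times> Z) \<le> sum f Z" by simp
  qed
  then obtain P where P: "P \<subseteq> F" "\<And>v. v \<in> A \<union> B \<Longrightarrow> out_deg P v + in_deg (F - P) v \<le> f v"
    unfolding out_deg_def in_deg_def by blast
  have finP: "finite P" using P(1) finF by (rule finite_subset)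
  have oP: "out_deg P a \<le> x a" if "a \<in> A" for a using P(2)[of a] that by (simp add: f_def)
  have iP: "y b \<le> in_deg P b" if "b \<in> B" for b
  proof -
    have "b \<notin> A" using that AB by auto
    then show ?thesis using P(2)[of b] that le[OF that] in_deg_Diff[OF finF P(1), of b] by (simp add: f_def)
  qed
  have "sum (out_deg P) A = card P" "sum (in_deg P) B = card P"
    using sum_out_deg[OF finP fin(1)] sum_in_deg[OF finP fin(2)] P(1) F
    by (auto intro!: arg_cong[of _ _ card])
  moreover have "sum (out_deg P) A \<le> sum x A" "sum y B \<le> sum (in_deg P) B"
    using oP iP by (auto intro: sum_mono)
  ultimately have e: "sum (out_deg P) A = sum x A" "sum y B = sum (in_deg P) B" using eq by linarith+
  have "out_deg P a = x a" if "a \<in> A" for a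
  proof (rule ccontr)
    assume "out_deg P a \<noteq> x a"
    then have "sum (out_deg P) A < sum x A"
      using that oP fin by (intro sum_strict_mono_ex1) (auto intro!: bexI[of _ a] simp: le_neq_implies_less)
    then show False using e by simp
  qed
  moreover have "in_deg P b = y b" if "b \<in> B" for b
  proof (rule ccontr)
    assume "in_deg P b \<noteq> y b"
    then have "sum y B < sum (in_deg P) B"
      using that iP fin by (intro sum_strict_mono_ex1) (auto intro!: bexI[of _ b] simp: le_neq_implies_less)
    then show False using e by simp
  qed
  ultimately show ?thesis using P(1) by blast
qed

lemma card_inner_le:
  assumes "finite F"
  shows "finite Y \<Longrightarrow> card (F \<inter> Y \<times> X) \<le> (\<Sum>a\<in>Y. out_deg F a)"
    and "finite X \<Longrightarrow> card (F \<inter> Y \<times> X) \<le> (\<Sum>b\<in>X. in_deg F b)"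
  by (auto simp: sum_out_deg sum_in_deg assms intro!: card_mono)

text \<open>The constant weight \<open>1 / k\<close> witnesses the cut condition.\<close>
lemma divide_degrees:
  fixes P :: "('a \<times> 'a) set" and x y :: "'a \<Rightarrow> nat"
  assumes fin: "finite A" "finite B" and AB: "A \<inter> B = {}" and P: "P \<subseteq> A \<times> B" and k: "0 < k"
    and x: "\<And>a. a \<in> A \<Longrightarrow> out_deg P a = k * x a" and y: "\<And>b. b \<in> B \<Longrightarrow> in_deg P b = k * y b"
  shows "\<exists>M\<subseteq>P. (\<forall>a\<in>A. out_deg M a = x a) \<and> (\<forall>b\<in>B. in_deg M b = y b)"
proof (rule degree_constrained_subgraph[OF fin AB P])
  have finP: "finite P" using fin P by (meson finite_SigmaI finite_subset)
  have fs: "finite Y" "finite X" if "Y \<subseteq> A" "X \<subseteq> B" for X Y using that fin by (auto intro: finite_subset)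
  have sx: "(\<Sum>a\<in>Y. out_deg P a) = k * sum x Y" if "Y \<subseteq> A" for Y
    using that x by (simp add: sum_distrib_left subset_eq)
  have sy: "(\<Sum>b\<in>X. in_deg P b) = k * sum y X" if "X \<subseteq> B" for X
    using that y by (simp add: sum_distrib_left subset_eq)
  have "{e \<in> P. fst e \<in> A} = {e \<in> P. snd e \<in> B}" using P by auto
  then have "k * sum x A = k * sum y B"
    using sx[of A] sy[of B] sum_out_deg[OF finP fin(1)] sum_in_deg[OF finP fin(2)] by simp
  then show "sum x A = sum y B" using k by simp
  show "y b \<le> in_deg P b" if "b \<in> B" for b using y[OF that] k by simp
  fix X Y assume XY: "Y \<subseteq> A" "X \<subseteq> B"
  define c where "c = card (P \<inter> Y \<times> X)"
  have 1: "c \<le> k * sum x Y" unfolding c_def sx[OF XY(1), symmetric]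
    by (rule card_inner_le[OF finP]) (rule fs[OF XY])
  have 2: "c \<le> k * sum y X" unfolding c_def sy[OF XY(2), symmetric]
    by (rule card_inner_le[OF finP]) (rule fs[OF XY])
  obtain j where j: "k = Suc j" using k by (cases k) auto
  \<comment> \<open>The two bounds on \<open>c\<close> are averaged with weights
    \<open>1 / k\<close> and \<open>(k - 1) / k\<close>, multiplied through by
    \<open>k\<close>.\<close>
  have "k * c = c + j * c" by (simp add: j)
  also have "\<dots> \<le> k * sum x Y + j * (k * sum y X)" using 1 2 by (intro add_mono mult_le_mono2)
  also have "\<dots> = k * (sum x Y + j * sum y X)" by (simp add: algebra_simps)
  finally have "c \<le> sum x Y + j * sum y X" using k by simp
  then show "card (P \<inter> Y \<times> X) + sum y X \<le> sum x Y + (\<Sum>b\<in>X. in_deg P b)"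
    unfolding sy[OF XY(2)] c_def by (simp add: j)
qed

section \<open>Rounding degrees with errors bounded by cuts\<close>

lemma card_crossing:
  assumes fin: "finite A" "finite B" and AB: "A \<inter> B = {}" and R: "R \<subseteq> A \<times> B" and XY: "X \<subseteq> B" "Y \<subseteq> A"
  shows "card (crossing R (X \<union> Y)) = (\<Sum>v\<in>A. if v \<in> Y then card ({u. (v, u) \<in> R} - X) else card ({u. (v, u) \<in> R} \<inter> X))"
proof -
  have finR: "finite R" using fin R by (meson finite_SigmaI finite_subset)
  have "crossing R (X \<union> Y) = (SIGMA v:A. if v \<in> Y then {u. (v, u) \<in> R} - X else {u. (v, u) \<in> R} \<inter> X)"
  proof -
    have R': "a \<in> A" "b \<in> B" "a \<notin> X" "b \<notin> Y" if "(a, b) \<in> R" for a b using that R AB XY by auto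
    then show ?thesis unfolding crossing_def by (auto split: if_splits)
  qed
  moreover have "finite {u. (v, u) \<in> R}" for v
    by (rule finite_subset[OF _ fin(2)]) (use R in auto)
  ultimately show ?thesis using fin by (simp add: if_distrib cong: if_cong)
qed

text \<open>Every star centred in \<open>A\<close> is replaced by a complete graph on its leaves, suitably weighted;
  this costs at most half of the connectivity and makes the flow through \<open>A\<close> conservative.\<close>
lemma balanced_residues:
  fixes R :: "('a \<times> 'a) set" and c :: "'a \<Rightarrow> int"
  assumes fin: "finite A" "finite B" and AB: "A \<inter> B = {}" and R: "R \<subseteq> A \<times> B" and m: "0 < m"
    and ne: "A \<noteq> {}" "B \<noteq> {}"
    and conn: "\<And>X. \<lbrakk>X \<subseteq> A \<union> B; X \<noteq> {}; X \<noteq> A \<union> B\<rbrakk> \<Longrightarrow> 24 * m \<le> card (crossing R X)"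
    and c: "int m dvd sum c B"
  shows "\<exists>b. (\<forall>u\<in>B. int m dvd b u - c u) \<and> sum b B = 0 \<and>
    (\<forall>X\<subseteq>B. \<forall>Y\<subseteq>A. 2 * sum b X \<le> int (card (crossing R (X \<union> Y))))"
proof -
  have finR: "finite R" using fin R by (meson finite_SigmaI finite_subset)
  define nb where "nb v = {u. (v, u) \<in> R}" for v
  define r where "r v = card (nb v)" for v
  define j where "j X v = card (nb v \<inter> X)" for X v
  have nbB: "nb v \<subseteq> B" for v using R by (auto simp: nb_def)
  have finnb: "finite (nb v)" for v using nbB fin(2) by (rule finite_subset)
  have cr: "card (crossing R (X \<union> Y)) = (\<Sum>v\<in>A. if v \<in> Y then r v - j X v else j X v)"
    if "X \<subseteq> B" "Y \<subseteq> A" for X Y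
    unfolding card_crossing[OF fin AB R that] nb_def[symmetric] r_def j_def
    using finnb by (intro sum.cong) (auto simp: card_Diff_subset_Int)
  have r2: "2 \<le> r v" if v: "v \<in> A" for v
  proof -
    have "24 * m \<le> card (crossing R ({} \<union> {v}))" by (rule conn) (use v ne AB in auto)
    also have "\<dots> = (\<Sum>u\<in>A. if u = v then r u else 0)"
      by (subst cr) (use v in \<open>auto simp: j_def intro!: sum.cong\<close>)
    also have "\<dots> = r v" using v fin(1) by simp
    finally show ?thesis using m by linarith
  qed
  \<comment> \<open>An even common multiple of all \<open>r v - 1\<close>, positive because
    \<open>r v \<ge> 2\<close>; evenness makes half of each weighted degree an integer.\<close>
  define L where "L = 2 * (\<Prod>v\<in>A. r v - 1)"
  have L0: "0 < L" unfolding L_def using r2 by (auto intro!: prod_pos simp: Suc_le_eq dest!: r2)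
  \<comment> \<open>In the complete graph on the \<open>r v\<close> leaves with edge weight
    \<open>q v\<close> every leaf has degree \<open>L\<close>, independently of
    \<open>v\<close>.\<close>
  define q where "q v = L div (r v - 1)" for v
  have q: "q v * (r v - 1) = L" if v: "v \<in> A" for v
  proof -
    have "r v - 1 dvd L" unfolding L_def using v fin(1) by (intro dvd_mult dvd_prodI)
    then show ?thesis by (simp add: q_def)
  qed
  define w where "w u u' = (if u = u' then 0 else \<Sum>v\<in>A. if u \<in> nb v \<and> u' \<in> nb v then q v else 0)" for u u'
  have sym: "w u u' = w u' u" for u u' by (auto simp: w_def conj_commute)
  have jX: "j X v + j (B - X) v = r v" if "X \<subseteq> B" for X v
  proof -
    have "nb v = (nb v \<inter> X) \<union> (nb v \<inter> (B - X))" using nbB by auto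
    then show ?thesis unfolding j_def r_def using finnb by (metis card_Un_disjoint finite_Int inf.left_idem Diff_disjoint inf_assoc inf_bot_right inf_commute)
  qed
  have jle: "j X v \<le> r v" for X v unfolding j_def r_def by (intro card_mono finnb) auto
  have cut: "(\<Sum>x\<in>X. \<Sum>y\<in>B - X. w x y) = (\<Sum>v\<in>A. q v * (j X v * (r v - j X v)))" if X: "X \<subseteq> B" for X
  proof -
    have "(\<Sum>x\<in>X. \<Sum>y\<in>B - X. w x y) = (\<Sum>x\<in>X. \<Sum>y\<in>B - X. \<Sum>v\<in>A. (if x \<in> nb v then if y \<in> nb v then q v else 0 else 0))"
      by (intro sum.cong refl) (auto simp: w_def intro!: sum.cong)
    also have "\<dots> = (\<Sum>x\<in>X. \<Sum>v\<in>A. \<Sum>y\<in>B - X. (if x \<in> nb v then if y \<in> nb v then q v else 0 else 0))"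
      by (intro sum.cong refl sum.swap)
    also have "\<dots> = (\<Sum>v\<in>A. \<Sum>x\<in>X. \<Sum>y\<in>B - X. (if x \<in> nb v then if y \<in> nb v then q v else 0 else 0))"
      by (rule sum.swap)
    also have "\<dots> = (\<Sum>v\<in>A. q v * (j X v * (r v - j X v)))"
    proof (intro sum.cong refl)
      fix v
      have fX: "finite X" using X fin(2) by (rule finite_subset)
      have 1: "(\<Sum>y\<in>Z. if y \<in> nb v then n else 0) = n * j Z v" if "finite Z" for Z and n :: nat
        using that by (simp add: sum.If_cases j_def Int_commute[of Z] Collect_mem_eq)
      have "(\<Sum>x\<in>X. \<Sum>y\<in>B - X. (if x \<in> nb v then if y \<in> nb v then q v else 0 else 0))
        = (\<Sum>x\<in>X. if x \<in> nb v then q v * j (B - X) v else 0)"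
        using fin(2) by (intro sum.cong) (auto simp: 1)
      also have "\<dots> = q v * (j X v * (r v - j X v))"
      proof -
        have "r v - j X v = j (B - X) v" using jX[OF X, of v] by linarith
        then show ?thesis using 1[OF fX] by simp
      qed
      finally show "(\<Sum>x\<in>X. \<Sum>y\<in>B - X. (if x \<in> nb v then if y \<in> nb v then q v else 0 else 0))
        = q v * (j X v * (r v - j X v))" .
    qed
    finally show ?thesis .
  qed
  \<comment> \<open>If a star has \<open>j\<close> leaves in \<open>X\<close> and
    \<open>r - j\<close> outside, then \<open>j * (r - j)\<close> leaf pairs cross, which lies
    between half of and all of \<open>r - 1\<close> times the smaller part. The upper estimate holds
    for any placement \<open>Y\<close> of the centres.\<close>
  have upper: "(\<Sum>x\<in>X. \<Sum>y\<in>B - X. w x y) \<le> L * card (crossing R (X \<union> Y))" if XY: "X \<subseteq> B" "Y \<subseteq> A" for X Y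
    unfolding cut[OF XY(1)] cr[OF XY] sum_distrib_left
  proof (rule sum_mono)
    fix v assume v: "v \<in> A"
    let ?t = "if v \<in> Y then r v - j X v else j X v"
    have "j X v * (r v - j X v) \<le> (r v - 1) * ?t"
    proof (cases "j X v = 0 \<or> r v - j X v = 0")
      case False
      then have "r v - j X v \<le> r v - 1" "j X v \<le> r v - 1" by auto
      then show ?thesis by (auto simp: mult.commute intro: mult_le_mono)
    qed auto
    then have "q v * (j X v * (r v - j X v)) \<le> q v * ((r v - 1) * ?t)" by (rule mult_le_mono2)
    then show "q v * (j X v * (r v - j X v)) \<le> L * ?t" unfolding q[OF v, symmetric] by (simp add: mult.assoc)
  qed
  have lower: "12 * (L * m) \<le> (\<Sum>x\<in>X. \<Sum>y\<in>B - X. w x y)" if X: "X \<subseteq> B" "X \<noteq> {}" "X \<noteq> B" for X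
  proof -
    \<comment> \<open>Each centre joins the majority of its leaves, so that its star crosses in the
      smaller part only.\<close>
    define Y where "Y = {v \<in> A. r v - j X v < j X v}"
    have YA: "Y \<subseteq> A" by (auto simp: Y_def)
    have "24 * m \<le> card (crossing R (X \<union> Y))" by (rule conn) (use X YA AB in auto)
    then have "L * (24 * m) \<le> L * card (crossing R (X \<union> Y))" by (rule mult_le_mono2)
    also have "\<dots> \<le> (\<Sum>v\<in>A. 2 * (q v * (j X v * (r v - j X v))))"
      unfolding cr[OF X(1) YA] sum_distrib_left
    proof (rule sum_mono)
      fix v assume v: "v \<in> A"
      let ?t = "if v \<in> Y then r v - j X v else j X v"
      have "(r v - 1) * ?t \<le> 2 * (j X v * (r v - j X v))"
      proof (cases "v \<in> Y")
        case True
        then have "r v - 1 \<le> 2 * j X v" by (auto simp: Y_def)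
        then show ?thesis using True mult_le_mono1[of "r v - 1" "2 * j X v" "r v - j X v"] by simp
      next
        case False
        then have "r v - 1 \<le> 2 * (r v - j X v)" using v by (auto simp: Y_def)
        then show ?thesis using False mult_le_mono2[of "r v - 1" "2 * (r v - j X v)" "j X v"] by (simp add: algebra_simps)
      qed
      then have "q v * ((r v - 1) * ?t) \<le> q v * (2 * (j X v * (r v - j X v)))" by (rule mult_le_mono2)
      then show "L * ?t \<le> 2 * (q v * (j X v * (r v - j X v)))" unfolding q[OF v, symmetric] by (simp add: mult.assoc mult.left_commute)
    qed
    also have "\<dots> = 2 * (\<Sum>x\<in>X. \<Sum>y\<in>B - X. w x y)" unfolding cut[OF X(1)] sum_distrib_left ..
    finally show ?thesis by simp
  qed
  have deg: "(\<Sum>y\<in>B. w u y) = L * in_deg R u" if u: "u \<in> B" for u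
  proof -
    have "(\<Sum>y\<in>B. w u y) = (\<Sum>x\<in>{u}. \<Sum>y\<in>B - {u}. w x y)"
      using sum.remove[OF fin(2) u, of "w u"] by (simp add: w_def)
    also have "\<dots> = (\<Sum>v\<in>A. if u \<in> nb v then L else 0)"
    proof (subst cut, use u in simp, rule sum.cong[OF refl])
      fix v assume v: "v \<in> A"
      show "q v * (j {u} v * (r v - j {u} v)) = (if u \<in> nb v then L else 0)"
        using q[OF v] by (simp add: j_def)
    qed
    also have "\<dots> = L * card {v \<in> A. u \<in> nb v}" using fin(1) by (simp add: sum.If_cases Int_def mult.commute)
    also have "card {v \<in> A. u \<in> nb v} = in_deg R u"
    proof -
      have "{e \<in> R. snd e = u} = (\<lambda>v. (v, u)) ` {v \<in> A. u \<in> nb v}" using R by (auto simp: nb_def)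
      then show ?thesis unfolding in_deg_def by (simp add: card_image inj_on_def)
    qed
    finally show ?thesis .
  qed
  \<comment> \<open>Half of the weighted degree plus \<open>L\<close> times the wanted residue. The
    deviation of the out-degree from half of the degree, divided by \<open>L\<close>, is then an
    integer congruent to \<open>c u\<close> modulo \<open>m\<close>.\<close>
  define p where "p u = int (L div 2) * int (in_deg R u) + int L * c u" for u
  have L2: "2 * (L div 2) = L" by (simp add: L_def)
  have tot: "2 * sum p B = int (\<Sum>x\<in>B. \<Sum>y\<in>B. w x y) + 2 * int L * sum c B"
  proof -
    have "2 * sum p B = (\<Sum>u\<in>B. int (2 * (L div 2)) * int (in_deg R u) + 2 * int L * c u)"
      unfolding sum_distrib_left p_def by (rule sum.cong) (simp_all add: algebra_simps)
    also have "\<dots> = int (\<Sum>x\<in>B. \<Sum>y\<in>B. w x y) + 2 * int L * sum c B"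
      unfolding L2 sum.distrib of_nat_sum sum_distrib_left using deg
      by (intro arg_cong2[where f = "(+)"] sum.cong refl) (simp_all flip: of_nat_sum)
    finally show ?thesis .
  qed
  have "\<exists>d. (\<forall>x\<in>B. \<forall>y\<in>B. d x y + d y x = w x y) \<and> (\<forall>x\<in>B. [int (\<Sum>y\<in>B. d x y) = p x] (mod int (L * m)))"
  proof (rule modular_orientation[OF fin(2) sym _ _ lower])
    have "2 * int (L * m) dvd 2 * int L * sum c B" using c by (simp add: mult_dvd_mono)
    then show "[2 * sum p B = int (\<Sum>x\<in>B. \<Sum>y\<in>B. w x y)] (mod (2 * int (L * m)))"
      unfolding tot cong_iff_dvd_diff by simp
  qed (use L0 m in \<open>simp_all add: w_def\<close>)
  then obtain d where d: "\<And>x y. \<lbrakk>x \<in> B; y \<in> B\<rbrakk> \<Longrightarrow> d x y + d y x = w x y"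
    and dp: "\<And>x. x \<in> B \<Longrightarrow> [int (\<Sum>y\<in>B. d x y) = p x] (mod int (L * m))" by blast
  define b where "b u = (int (\<Sum>y\<in>B. d u y) - int (L div 2) * int (in_deg R u)) div int L" for u
  have b1: "int L * int m dvd int (\<Sum>y\<in>B. d u y) - int (L div 2) * int (in_deg R u) - int L * c u" if u: "u \<in> B" for u
    using dp[OF u] unfolding cong_iff_dvd_diff p_def by (simp add: algebra_simps)
  have b: "int L * b u = int (\<Sum>y\<in>B. d u y) - int (L div 2) * int (in_deg R u)" if u: "u \<in> B" for u
  proof -
    have "int L dvd (int (\<Sum>y\<in>B. d u y) - int (L div 2) * int (in_deg R u) - int L * c u) + int L * c u"
      by (rule dvd_add[OF dvd_mult_left[OF b1[OF u]]]) simp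
    then show ?thesis unfolding b_def by simp
  qed
  have bc: "int m dvd b u - c u" if u: "u \<in> B" for u
  proof -
    have "int L * int m dvd int L * (b u - c u)"
      using b1[OF u] unfolding b[OF u, symmetric] right_diff_distrib .
    then show ?thesis using L0 by simp
  qed
  \<comment> \<open>Up to the factor \<open>2 * L\<close>, the sum of \<open>b\<close> over
    \<open>X\<close> is the net flow out of \<open>X\<close>, which the weight of the cut
    bounds.\<close>
  have b2: "2 * int L * sum b X = (\<Sum>x\<in>X. \<Sum>y\<in>B. int (d x y) - int (d y x))" if X: "X \<subseteq> B" for X
  proof -
    have "2 * int L * sum b X = (\<Sum>x\<in>X. 2 * (int L * b x))" by (simp add: sum_distrib_left mult.assoc)
    also have "\<dots> = (\<Sum>x\<in>X. \<Sum>y\<in>B. int (d x y) - int (d y x))"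
    proof (rule sum.cong[OF refl])
      fix x assume "x \<in> X"
      then have x: "x \<in> B" using X by auto
      have "(\<Sum>y\<in>B. int (d x y) - int (d y x)) = (\<Sum>y\<in>B. 2 * int (d x y) - int (w x y))"
      proof (rule sum.cong[OF refl])
        fix y assume "y \<in> B"
        then have "d x y + d y x = w x y" by (rule d[OF x])
        then show "int (d x y) - int (d y x) = 2 * int (d x y) - int (w x y)" by linarith
      qed
      also have "\<dots> = 2 * int (\<Sum>y\<in>B. d x y) - int (\<Sum>y\<in>B. w x y)"
        by (simp add: sum_subtractf sum_distrib_left)
      also have "int (\<Sum>y\<in>B. w x y) = 2 * (int (L div 2) * int (in_deg R x))"
      proof -
        have "int (\<Sum>y\<in>B. w x y) = int (2 * (L div 2)) * int (in_deg R x)" unfolding deg[OF x] L2 by simp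
        then show ?thesis by simp
      qed
      finally show "2 * (int L * b x) = (\<Sum>y\<in>B. int (d x y) - int (d y x))" unfolding b[OF x] by simp
    qed
    finally show ?thesis .
  qed
  have anti: "(\<Sum>x\<in>X. \<Sum>y\<in>X. int (d x y) - int (d y x)) = 0" for X
    unfolding sum_subtractf by (subst (2) sum.swap) simp
  have "sum b B = 0" using b2[of B] anti[of B] L0 by simp
  moreover have "2 * sum b X \<le> int (card (crossing R (X \<union> Y)))" if XY: "X \<subseteq> B" "Y \<subseteq> A" for X Y
  proof -
    have fX: "finite X" using XY(1) fin(2) by (rule finite_subset)
    have "int L * (2 * sum b X) = (\<Sum>x\<in>X. \<Sum>y\<in>B. int (d x y) - int (d y x))"
      using b2[OF XY(1)] by (simp add: algebra_simps)
    also have "\<dots> = (\<Sum>x\<in>X. (\<Sum>y\<in>B - X. int (d x y) - int (d y x)) + (\<Sum>y\<in>X. int (d x y) - int (d y x)))"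
      by (intro sum.cong refl sum.subset_diff[OF XY(1) fin(2)])
    also have "\<dots> = (\<Sum>x\<in>X. \<Sum>y\<in>B - X. int (d x y) - int (d y x))" by (simp add: sum.distrib anti)
    also have "\<dots> \<le> (\<Sum>x\<in>X. \<Sum>y\<in>B - X. int (w x y))"
    proof (intro sum_mono)
      fix x y assume "x \<in> X" "y \<in> B - X"
      then have "d x y + d y x = w x y" using XY by (intro d) auto
      then show "int (d x y) - int (d y x) \<le> int (w x y)" by linarith
    qed
    also have "\<dots> = int (\<Sum>x\<in>X. \<Sum>y\<in>B - X. w x y)" by simp
    also have "\<dots> \<le> int (L * card (crossing R (X \<union> Y)))" using upper[OF XY] by (simp only: of_nat_le_iff)
    also have "\<dots> = int L * int (card (crossing R (X \<union> Y)))" by simp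
    finally show ?thesis using L0 by (simp only: mult_le_cancel_left_pos of_nat_0_less_iff)
  qed
  ultimately show ?thesis using bc by blast
qed

text \<open>\<open>M\<close> consists of the central edges of the bistars and \<open>P\<close> of all their edges at the
  \<open>k\<close>-centres, which lie in \<open>B\<close>; the edges of \<open>F - P\<close> are the leaf edges at the \<open>l\<close>-centres.\<close>
theorem one_sided_decomposition:
  fixes F R :: "('a \<times> 'a) set"
  assumes fin: "finite A" "finite B" and AB: "A \<inter> B = {}" and F: "F \<subseteq> A \<times> B" and R: "R \<subseteq> F"
    and m: "1 < k" "k \<le> l" "m = k + l - 1"
    and dvd: "\<And>a. a \<in> A \<Longrightarrow> m dvd out_deg F a"
    and conn: "\<And>X. \<lbrakk>X \<subseteq> A \<union> B; X \<noteq> {}; X \<noteq> A \<union> B\<rbrakk> \<Longrightarrow> 24 * m \<le> card (crossing R X)"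
  shows "\<exists>P M. P \<subseteq> F \<and> M \<subseteq> P \<and> (\<forall>a\<in>A. out_deg F a = m * out_deg M a \<and> out_deg P a = k * out_deg M a) \<and>
    (\<forall>b\<in>B. in_deg P b = k * in_deg M b)"
proof (cases "F = {}")
  case True
  then show ?thesis by (intro exI[of _ "{}"]) (simp add: out_deg_def in_deg_def)
next
  case False
  then have ne: "A \<noteq> {}" "B \<noteq> {}" using F by auto
  have m0: "0 < m" "m = k + (l - 1)" "k \<le> 2 * (l - 1)" using m by auto
  have finF: "finite F" using fin F by (meson finite_SigmaI finite_subset)
  have FA: "{e \<in> F. fst e \<in> A} = F" and FB: "{e \<in> F. snd e \<in> B} = F" using F by auto
  have sF: "(\<Sum>a\<in>A. out_deg F a) = card F" "(\<Sum>b\<in>B. in_deg F b) = card F"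
    unfolding sum_out_deg[OF finF fin(1)] sum_in_deg[OF finF fin(2)] FA FB by simp_all
  have "m dvd card F" unfolding sF(1)[symmetric] by (intro dvd_sum dvd)
  then have "int m dvd (\<Sum>u\<in>B. - int (in_deg F u))"
    by (simp add: sum_negf sF flip: of_nat_sum)
  \<comment> \<open>The correction \<open>b\<close> makes \<open>in_deg F u + b u\<close> divisible
    by \<open>m\<close>; the quotient will be the number of bistars with \<open>k\<close>-centre
    \<open>u\<close>.\<close>
  then have "\<exists>b. (\<forall>u\<in>B. int m dvd b u - (- int (in_deg F u))) \<and> sum b B = 0 \<and>
    (\<forall>X\<subseteq>B. \<forall>Y\<subseteq>A. 2 * sum b X \<le> int (card (crossing R (X \<union> Y))))"
    by (intro balanced_residues[OF fin AB _ m0(1) ne conn]) (use R F in auto)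
  then obtain b where b0: "\<forall>u\<in>B. int m dvd b u - (- int (in_deg F u))" "sum b B = 0"
    "\<forall>X\<subseteq>B. \<forall>Y\<subseteq>A. 2 * sum b X \<le> int (card (crossing R (X \<union> Y)))" by (elim exE conjE) (rule that)
  have b: "\<And>u. u \<in> B \<Longrightarrow> int m dvd b u - (- int (in_deg F u))" "sum b B = 0"
    "\<And>X Y. \<lbrakk>X \<subseteq> B; Y \<subseteq> A\<rbrakk> \<Longrightarrow> 2 * sum b X \<le> int (card (crossing R (X \<union> Y)))"
    using b0 by simp_all
  have cross: "card (crossing R X) \<le> card (crossing F X)" for X
    using finF R by (intro card_mono) (auto simp: crossing_def)
  define x where "x a = out_deg F a div m" for a
  have x: "m * x a = out_deg F a" if "a \<in> A" for a using dvd[OF that] by (simp add: x_def)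
  define t where "t u = (int (in_deg F u) + b u) div int m" for u
  have t: "int m * t u = int (in_deg F u) + b u" if "u \<in> B" for u
    using b(1)[OF that] by (simp add: t_def add.commute)
  have bu: "2 * b u \<le> int (in_deg F u)" "- 2 * b u \<le> 2 * int (in_deg F u)" if u: "u \<in> B" for u
  proof -
    have "crossing F ({u} \<union> {}) \<subseteq> {e \<in> F. snd e = u}" "crossing F ((B - {u}) \<union> A) \<subseteq> {e \<in> F. snd e = u}"
      using F u AB by (auto simp: crossing_def)
    then have c: "card (crossing F ({u} \<union> {})) \<le> in_deg F u" "card (crossing F ((B - {u}) \<union> A)) \<le> in_deg F u"
      unfolding in_deg_def using finF by (auto intro!: card_mono)
    show "2 * b u \<le> int (in_deg F u)"
      using b(3)[of "{u}" "{}"] cross[of "{u} \<union> {}"] c(1) u by simp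
    have "sum b (B - {u}) = - b u" using b(2) sum.remove[OF fin(2) u, of b] by simp
    then have "- 2 * b u \<le> int (card (crossing R ((B - {u}) \<union> A)))"
      using b(3)[of "B - {u}" A] by simp
    also have "\<dots> \<le> int (in_deg F u)" using cross[of "(B - {u}) \<union> A"] c(2) by linarith
    finally show "- 2 * b u \<le> 2 * int (in_deg F u)" by linarith
  qed
  have t0: "0 \<le> t u" if u: "u \<in> B" for u
  proof -
    have "0 \<le> int m * t u" unfolding t[OF u] using bu[OF u] by linarith
    then show ?thesis using m0(1) by (simp add: zero_le_mult_iff)
  qed
  define y where "y u = nat (t u)" for u
  have y: "int (y u) = t u" if "u \<in> B" for u using t0[OF that] by (simp add: y_def)
  have sx: "m * sum x Y = (\<Sum>a\<in>Y. out_deg F a)" if "Y \<subseteq> A" for Y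
    unfolding sum_distrib_left by (rule sum.cong) (use that x in auto)
  have sy: "int m * int (sum y X) = int (\<Sum>u\<in>X. in_deg F u) + sum b X" if "X \<subseteq> B" for X
  proof -
    have "int m * int (sum y X) = (\<Sum>u\<in>X. int m * t u)"
      unfolding of_nat_sum sum_distrib_left by (rule sum.cong) (use that y in auto)
    also have "\<dots> = (\<Sum>u\<in>X. int (in_deg F u) + b u)" by (rule sum.cong) (use that t in auto)
    finally show ?thesis by (simp add: sum.distrib)
  qed
  have "\<exists>P\<subseteq>F. (\<forall>a\<in>A. out_deg P a = k * x a) \<and> (\<forall>u\<in>B. in_deg P u = k * y u)"
  proof (rule degree_constrained_subgraph[OF fin AB F])
    show "k * y u \<le> in_deg F u" if u: "u \<in> B" for u
    proof -
      have "int k * (2 * b u) \<le> int k * int (in_deg F u)" using bu(1)[OF u] by (intro mult_left_mono) auto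
      also have "\<dots> \<le> int (2 * (l - 1)) * int (in_deg F u)" using m0(3) by (intro mult_right_mono) auto
      finally have "int k * b u \<le> int (l - 1) * int (in_deg F u)" by simp
      moreover have "int m * (int k * t u) = int k * int (in_deg F u) + int k * b u"
        using t[OF u] by (simp add: algebra_simps flip: distrib_left)
      moreover have "int m * int (in_deg F u) = int k * int (in_deg F u) + int (l - 1) * int (in_deg F u)"
        unfolding m0(2) by (simp add: algebra_simps)
      ultimately have "int m * (int k * t u) \<le> int m * int (in_deg F u)" by linarith
      then have "int k * t u \<le> int (in_deg F u)" using m0(1) by simp
      then have "int (k * y u) \<le> int (in_deg F u)" using y[OF u] by simp
      then show ?thesis by (simp only: of_nat_le_iff)
    qed
    have "int m * int (sum x A) = int m * int (sum y B)"
    proof -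
      have "int m * int (sum x A) = int (card F)" using sx[of A] sF by (metis of_nat_mult order_refl)
      moreover have "int m * int (sum y B) = int (card F)" using sy[of B] sF b(2) by simp
      ultimately show ?thesis by simp
    qed
    then have "int (sum x A) = int (sum y B)" using m0(1) by (simp del: of_nat_sum)
    then have "sum x A = sum y B" by (simp only: of_nat_eq_iff)
    then show "(\<Sum>a\<in>A. k * x a) = (\<Sum>u\<in>B. k * y u)" by (simp flip: sum_distrib_left)
    fix X Y assume XY: "Y \<subseteq> A" "X \<subseteq> B"
    have fXY: "finite X" "finite Y" using XY fin by (auto intro: finite_subset)
    define e where "e = card (F \<inter> Y \<times> X)"
    define dA where "dA = card {e \<in> F. fst e \<in> Y \<and> snd e \<notin> X}"
    define dB where "dB = card {e \<in> F. fst e \<notin> Y \<and> snd e \<in> X}"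
    have eA: "(\<Sum>a\<in>Y. out_deg F a) = e + dA"
      unfolding sum_out_deg[OF finF fXY(2)] e_def dA_def
      using finF by (subst card_Un_disjoint[symmetric]) (auto intro!: arg_cong[of _ _ card])
    have eB: "(\<Sum>u\<in>X. in_deg F u) = e + dB"
      unfolding sum_in_deg[OF finF fXY(1)] e_def dB_def
      using finF by (subst card_Un_disjoint[symmetric]) (auto intro!: arg_cong[of _ _ card])
    have "crossing F (X \<union> Y) = {e \<in> F. fst e \<in> Y \<and> snd e \<notin> X} \<union> {e \<in> F. fst e \<notin> Y \<and> snd e \<in> X}"
    proof -
      have F': "u \<notin> X" "v \<notin> Y" if "(u, v) \<in> F" for u v using that F AB XY by auto
      show ?thesis unfolding crossing_def by (auto dest: F')
    qed
    then have "card (crossing F (X \<union> Y)) \<le> dA + dB" unfolding dA_def dB_def by (simp add: card_Un_le)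
    then have bX: "2 * sum b X \<le> int dA + int dB" using b(3)[OF XY(2,1)] cross[of "X \<union> Y"] by linarith
    have "int k * (2 * sum b X) \<le> int k * (int dA + int dB)" using bX by (intro mult_left_mono) auto
    also have "\<dots> \<le> int k * int dA + int (2 * (l - 1)) * int dB"
      unfolding distrib_left using m0(3) by (intro add_mono mult_right_mono) auto
    also have "\<dots> \<le> 2 * (int k * int dA + int (l - 1) * int dB)" by simp
    \<comment> \<open>This is the cut condition multiplied by \<open>m\<close> after cancellation of
      common terms. It follows from \<open>2 * sum b X \<le> dA + dB\<close> because
      \<open>k \<le> 2 * (l - 1)\<close>, a consequence of \<open>1 < k\<close> and
      \<open>k \<le> l\<close>.\<close>
    finally have kb: "int k * sum b X \<le> int k * int dA + int (l - 1) * int dB" by simp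
    have Y1: "int m * int (\<Sum>a\<in>Y. k * x a) = int k * (int e + int dA)"
    proof -
      have "m * (\<Sum>a\<in>Y. k * x a) = k * (e + dA)"
        using sx[OF XY(1)] unfolding eA sum_distrib_left[symmetric] by (metis mult.left_commute)
      then show ?thesis by (metis of_nat_add of_nat_mult)
    qed
    have X1: "int m * int (\<Sum>u\<in>X. k * y u) = int k * (int e + int dB) + int k * sum b X"
    proof -
      have "int m * int (\<Sum>u\<in>X. k * y u) = int k * (int m * int (sum y X))"
        unfolding sum_distrib_left[symmetric] by simp
      then show ?thesis unfolding sy[OF XY(2)] eB by (simp add: distrib_left)
    qed
    have "int m * (int e + int (\<Sum>u\<in>X. k * y u)) \<le> int m * (int (\<Sum>a\<in>Y. k * x a) + (int e + int dB))"
    proof -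
      have "int m * (int e + int dB) = int m * int e + int k * int dB + int (l - 1) * int dB"
        unfolding m0(2) by (simp add: algebra_simps)
      then show ?thesis unfolding distrib_left X1 Y1 using kb by linarith
    qed
    then have "int e + int (\<Sum>u\<in>X. k * y u) \<le> int (\<Sum>a\<in>Y. k * x a) + (int e + int dB)"
      using m0(1) by simp
    then show "card (F \<inter> Y \<times> X) + (\<Sum>u\<in>X. k * y u) \<le> (\<Sum>a\<in>Y. k * x a) + (\<Sum>u\<in>X. in_deg F u)"
      unfolding eB e_def[symmetric] by (simp only: flip: of_nat_add)
  qed
  then obtain P where P: "P \<subseteq> F" "\<And>a. a \<in> A \<Longrightarrow> out_deg P a = k * x a" "\<And>u. u \<in> B \<Longrightarrow> in_deg P u = k * y u" by meson
  have "\<exists>M\<subseteq>P. (\<forall>a\<in>A. out_deg M a = x a) \<and> (\<forall>u\<in>B. in_deg M u = y u)"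
    by (rule divide_degrees[where k = k, OF fin AB]) (use P F m in auto)
  then obtain M where "M \<subseteq> P" "\<And>a. a \<in> A \<Longrightarrow> out_deg M a = x a" "\<And>u. u \<in> B \<Longrightarrow> in_deg M u = y u" by meson
  then show ?thesis using P x by (intro exI[of _ P] exI[of _ M]) simp
qed

section \<open>From labelled edges to bistars\<close>

definition und :: "'a \<times> 'a \<Rightarrow> 'a set" where
  "und e = {fst e, snd e}"

lemma equal_groups:
  assumes "finite X" "finite Y" "card X = n * card Y"
  shows "\<exists>g. (\<forall>x\<in>X. g x \<in> Y) \<and> (\<forall>y\<in>Y. card {x \<in> X. g x = y} = n)"
proof -
  have "card X = card (Y \<times> {..<n})" using assms by (simp add: card_cartesian_product)
  then obtain h where h: "bij_betw h X (Y \<times> {..<n})"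
    using finite_same_card_bij[of X "Y \<times> {..<n}"] assms by auto
  have "card {x \<in> X. fst (h x) = y} = n" if y: "y \<in> Y" for y
  proof -
    have "h ` {x \<in> X. fst (h x) = y} = {y} \<times> {..<n}"
    proof (intro set_eqI iffI)
      fix p assume "p \<in> {y} \<times> {..<n}"
      then have p: "p \<in> Y \<times> {..<n}" "fst p = y" using y by auto
      then obtain x where "x \<in> X" "p = h x" using h unfolding bij_betw_def by blast
      then show "p \<in> h ` {x \<in> X. fst (h x) = y}" using p(2) by simp
    next
      fix p assume "p \<in> h ` {x \<in> X. fst (h x) = y}"
      then obtain x where x: "x \<in> X" "p = h x" "fst p = y" by blast
      then have "p \<in> Y \<times> {..<n}" using h unfolding bij_betw_def by blast
      then show "p \<in> {y} \<times> {..<n}" using x(3) by (cases p) simp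
    qed
    moreover have "inj_on h {x \<in> X. fst (h x) = y}" using h by (auto simp: bij_betw_def inj_on_def)
    ultimately have "card {x \<in> X. fst (h x) = y} = card ({y} \<times> {..<n})"
      using card_image[of h "{x \<in> X. fst (h x) = y}"] by simp
    then show ?thesis by (simp add: card_cartesian_product_singleton)
  qed
  moreover have "fst (h x) \<in> Y" if "x \<in> X" for x
  proof -
    have "h x \<in> Y \<times> {..<n}" using h that unfolding bij_betw_def by blast
    then show ?thesis by (simp add: mem_Times_iff)
  qed
  ultimately show ?thesis by (intro exI[of _ "\<lambda>x. fst (h x)"]) auto
qed

text \<open>Each fibre is divided separately. The elements of \<open>X\<close> will be leaf edges
  and those of \<open>Y\<close> central edges, lying over the centre that they share.\<close>

lemma equal_groups_over:
  assumes fin: "finite X" "finite Y" and maps: "\<And>x. x \<in> X \<Longrightarrow> p x \<in> I"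
    and card: "\<And>i. i \<in> I \<Longrightarrow> card {x \<in> X. p x = i} = n * card {y \<in> Y. q y = i}"
  shows "\<exists>g. (\<forall>x\<in>X. g x \<in> Y \<and> q (g x) = p x) \<and> (\<forall>y\<in>Y. q y \<in> I \<longrightarrow> card {x \<in> X. g x = y} = n)"
proof -
  have "\<forall>i\<in>I. \<exists>g. (\<forall>x\<in>{x \<in> X. p x = i}. g x \<in> {y \<in> Y. q y = i}) \<and>
     (\<forall>y\<in>{y \<in> Y. q y = i}. card {x \<in> {x \<in> X. p x = i}. g x = y} = n)"
    by (intro ballI equal_groups) (use fin card in auto)
  then obtain G where G0: "\<forall>i\<in>I. (\<forall>x\<in>{x \<in> X. p x = i}. G i x \<in> {y \<in> Y. q y = i}) \<and>
     (\<forall>y\<in>{y \<in> Y. q y = i}. card {x \<in> {x \<in> X. p x = i}. G i x = y} = n)"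
    by (elim bchoice[THEN exE])
  have G: "\<And>i x. \<lbrakk>i \<in> I; x \<in> X; p x = i\<rbrakk> \<Longrightarrow> G i x \<in> Y \<and> q (G i x) = i"
    "\<And>i y. \<lbrakk>i \<in> I; y \<in> Y; q y = i\<rbrakk> \<Longrightarrow> card {x \<in> {x \<in> X. p x = i}. G i x = y} = n"
    using G0 by simp_all
  have 1: "G (p x) x \<in> Y \<and> q (G (p x) x) = p x" if "x \<in> X" for x
    using G(1)[OF maps[OF that] that refl] .
  have "card {x \<in> X. G (p x) x = y} = n" if "y \<in> Y" "q y \<in> I" for y
  proof -
    have "{x \<in> X. G (p x) x = y} = {x \<in> {x \<in> X. p x = q y}. G (q y) x = y}"
      using 1 by auto
    then show ?thesis using G(2)[OF that(2,1) refl] by simp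
  qed
  then show ?thesis using 1 by (intro exI[of _ "\<lambda>x. G (p x) x"]) auto
qed

lemma edge_iso_bistar:
  assumes fin: "finite X" "finite Y" and card: "card X = k - 1" "card Y = l - 1" and kl: "0 < k" "0 < l"
    and ab: "a \<noteq> b" "a \<notin> X \<union> Y" "b \<notin> X \<union> Y" "X \<inter> Y = {}"
  shows "edge_iso (insert {a, b} ((\<lambda>x. {a, x}) ` X \<union> (\<lambda>y. {b, y}) ` Y)) (bistar k l)"
proof -
  let ?F = "insert {a, b} ((\<lambda>x. {a, x}) ` X \<union> (\<lambda>y. {b, y}) ` Y)"
  have bi: "bistar k l = insert {0, 1} ((\<lambda>x. {0, x}) ` {2..k} \<union> (\<lambda>y. {1, y}) ` {k + 1..k + l - 1})"
    unfolding bistar_def by auto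
  obtain g where g: "bij_betw g X {2..k}"
    using finite_same_card_bij[of X "{2..k}"] fin card by auto
  obtain h where h: "bij_betw h Y {k + 1..k + l - 1}"
    using finite_same_card_bij[of Y "{k + 1..k + l - 1}"] fin card by auto
  define f where "f v = (if v = a then 0 else if v = b then 1 else if v \<in> X then g v else h v)" for v
  have fa: "f a = 0" "f b = 1" using ab by (auto simp: f_def)
  have fX: "f x = g x" if "x \<in> X" for x using that ab by (auto simp: f_def)
  have fY: "f y = h y" if "y \<in> Y" for y using that ab by (auto simp: f_def)
  have gX: "g ` X = {2..k}" and hY: "h ` Y = {k + 1..k + l - 1}" using g h by (auto simp: bij_betw_def)
  have "bij_betw f X {2..k}" using g fX by (simp cong: bij_betw_cong)
  moreover have "bij_betw f Y {k + 1..k + l - 1}" using h fY by (simp cong: bij_betw_cong)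
  ultimately have fXY: "bij_betw f (X \<union> Y) ({2..k} \<union> {k + 1..k + l - 1})"
    by (rule bij_betw_combine) auto
  have fab: "bij_betw f {a, b} {0, 1}" using fa ab by (auto simp: bij_betw_def)
  have "bij_betw f ({a, b} \<union> (X \<union> Y)) ({0, 1} \<union> ({2..k} \<union> {k + 1..k + l - 1}))"
    by (rule bij_betw_combine[OF fab fXY]) (use kl in auto)
  moreover have "\<Union>?F = {a, b} \<union> (X \<union> Y)" by auto
  moreover have "\<Union>(bistar k l) = {0, 1} \<union> ({2..k} \<union> {k + 1..k + l - 1})" unfolding bi by auto
  ultimately have "bij_betw f (\<Union>?F) (\<Union>(bistar k l))" by simp
  moreover have "(\<lambda>e. f ` e) ` ?F = bistar k l"
  proof -
    have "(\<lambda>e. f ` e) ` (\<lambda>x. {a, x}) ` X = (\<lambda>x. {0, x}) ` g ` X"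
      unfolding image_image by (rule image_cong) (simp_all add: fa fX)
    moreover have "(\<lambda>e. f ` e) ` (\<lambda>x. {b, x}) ` Y = (\<lambda>x. {1, x}) ` h ` Y"
      unfolding image_image by (rule image_cong) (simp_all add: fa fY)
    ultimately show ?thesis unfolding bi gX hY by (simp add: image_Un fa)
  qed
  ultimately show ?thesis unfolding edge_iso_def by blast
qed

lemma has_decomposition_Un:
  assumes "has_decomposition H E1" "has_decomposition H E2" "E1 \<inter> E2 = {}"
  shows "has_decomposition H (E1 \<union> E2)"
proof -
  obtain P Q where P: "\<Union>P = E1" "\<forall>X\<in>P. \<forall>Y\<in>P. X \<noteq> Y \<longrightarrow> X \<inter> Y = {}" "\<forall>X\<in>P. edge_iso X H"
    and Q: "\<Union>Q = E2" "\<forall>X\<in>Q. \<forall>Y\<in>Q. X \<noteq> Y \<longrightarrow> X \<inter> Y = {}" "\<forall>X\<in>Q. edge_iso X H"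
    using assms(1,2) unfolding has_decomposition_def by (elim exE conjE) (rule that)
  have PQ: "X \<inter> Y = {}" if "X \<in> P" "Y \<in> Q" for X Y using that P(1) Q(1) assms(3) by blast
  have "\<forall>X\<in>P \<union> Q. \<forall>Y\<in>P \<union> Q. X \<noteq> Y \<longrightarrow> X \<inter> Y = {}"
  proof (intro ballI impI)
    fix X Y assume "X \<in> P \<union> Q" "Y \<in> P \<union> Q" "X \<noteq> Y"
    then consider "X \<in> P" "Y \<in> P" | "X \<in> Q" "Y \<in> Q" | "X \<in> P" "Y \<in> Q" | "X \<in> Q" "Y \<in> P" by blast
    then show "X \<inter> Y = {}"
    proof cases
      case 1 then show ?thesis using P(2) \<open>X \<noteq> Y\<close> by simp
    next
      case 2 then show ?thesis using Q(2) \<open>X \<noteq> Y\<close> by simp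
    next
      case 3 then show ?thesis by (rule PQ)
    next
      case 4 then show ?thesis using PQ[of Y X] by (simp add: Int_commute)
    qed
  qed
  moreover have "\<Union>(P \<union> Q) = E1 \<union> E2" using P(1) Q(1) by auto
  moreover have "\<forall>X\<in>P \<union> Q. edge_iso X H" using P(3) Q(3) by auto
  ultimately show ?thesis unfolding has_decomposition_def by blast
qed

lemma has_decomposition_family:
  assumes "\<And>c. c \<in> C \<Longrightarrow> edge_iso (T c) H" "\<And>c d. \<lbrakk>c \<in> C; d \<in> C; c \<noteq> d\<rbrakk> \<Longrightarrow> T c \<inter> T d = {}"
  shows "has_decomposition H (\<Union>c\<in>C. T c)"
  unfolding has_decomposition_def
  by (intro exI[of _ "T ` C"] conjI ballI impI refl) (use assms in auto)

lemma inj_on_und: "A \<inter> B = {} \<Longrightarrow> inj_on und (A \<times> B)"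
  by (auto simp: inj_on_def und_def doubleton_eq_iff)

text \<open>A central edge receives \<open>k - 1\<close> edges of \<open>P - M\<close> at its end in
  \<open>B\<close> and \<open>l - 1\<close> edges of \<open>F - P\<close> at its end in
  \<open>A\<close>. The former lead to leaves in \<open>A\<close>, the latter to leaves in
  \<open>B\<close>, so no leaf occurs twice.\<close>

lemma decomposition_from_labels:
  fixes F :: "('a \<times> 'a) set"
  assumes fin: "finite F" and AB: "A \<inter> B = {}" and F: "F \<subseteq> A \<times> B" and sub: "P \<subseteq> F" "M \<subseteq> P" and kl: "0 < k" "0 < l"
    and A: "\<And>a. a \<in> A \<Longrightarrow> out_deg (F - P) a = (l - 1) * out_deg M a"
    and B: "\<And>b. b \<in> B \<Longrightarrow> in_deg (P - M) b = (k - 1) * in_deg M b"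
  shows "has_decomposition (bistar k l) (und ` F)"
proof -
  have finite: "finite (F - P)" "finite (P - M)" "finite M" using fin sub by (auto intro: finite_subset)
  have "\<exists>g. (\<forall>e\<in>P - M. g e \<in> M \<and> snd (g e) = snd e) \<and>
     (\<forall>c\<in>M. snd c \<in> B \<longrightarrow> card {e \<in> P - M. g e = c} = k - 1)"
    by (rule equal_groups_over) (use finite sub F B in \<open>auto simp: in_deg_def\<close>)
  then obtain g where g0: "\<forall>e\<in>P - M. g e \<in> M \<and> snd (g e) = snd e"
    "\<forall>c\<in>M. snd c \<in> B \<longrightarrow> card {e \<in> P - M. g e = c} = k - 1" by (elim exE conjE) (rule that)
  have g: "\<And>e. e \<in> P - M \<Longrightarrow> g e \<in> M \<and> snd (g e) = snd e"
    "\<And>c. c \<in> M \<Longrightarrow> card {e \<in> P - M. g e = c} = k - 1"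
  proof -
    fix c assume c: "c \<in> M"
    then have "c \<in> A \<times> B" using F sub by blast
    then have "snd c \<in> B" by (simp add: mem_Times_iff)
    then show "card {e \<in> P - M. g e = c} = k - 1" using g0(2) c by blast
  qed (use g0(1) in blast)
  have "\<exists>h. (\<forall>e\<in>F - P. h e \<in> M \<and> fst (h e) = fst e) \<and>
     (\<forall>c\<in>M. fst c \<in> A \<longrightarrow> card {e \<in> F - P. h e = c} = l - 1)"
    by (rule equal_groups_over) (use finite sub F A in \<open>auto simp: out_deg_def\<close>)
  then obtain h where h0: "\<forall>e\<in>F - P. h e \<in> M \<and> fst (h e) = fst e"
    "\<forall>c\<in>M. fst c \<in> A \<longrightarrow> card {e \<in> F - P. h e = c} = l - 1" by (elim exE conjE) (rule that)
  have h: "\<And>e. e \<in> F - P \<Longrightarrow> h e \<in> M \<and> fst (h e) = fst e"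
    "\<And>c. c \<in> M \<Longrightarrow> card {e \<in> F - P. h e = c} = l - 1"
  proof -
    fix c assume c: "c \<in> M"
    then have "c \<in> A \<times> B" using F sub by blast
    then have "fst c \<in> A" by (simp add: mem_Times_iff)
    then show "card {e \<in> F - P. h e = c} = l - 1" using h0(2) c by blast
  qed (use h0(1) in blast)
  define T where "T c = insert c ({e \<in> P - M. g e = c} \<union> {e \<in> F - P. h e = c})" for c
  have TF: "T c \<subseteq> F" if "c \<in> M" for c using that sub by (auto simp: T_def)
  have "(\<Union>c\<in>M. T c) = F"
  proof (intro equalityI subsetI)
    fix e assume "e \<in> (\<Union>c\<in>M. T c)"
    then show "e \<in> F" using TF by blast
  next
    fix e assume "e \<in> F"
    then consider "e \<in> M" | "e \<in> P - M" | "e \<in> F - P" by blast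
    then show "e \<in> (\<Union>c\<in>M. T c)"
    proof cases
      case 1 then show ?thesis by (auto simp: T_def)
    next
      case 2 then show ?thesis using g(1)[OF 2] by (intro UN_I[of "g e"]) (simp_all add: T_def)
    next
      case 3 then show ?thesis using h(1)[OF 3] by (intro UN_I[of "h e"]) (simp_all add: T_def)
    qed
  qed
  then have "und ` F = (\<Union>c\<in>M. und ` T c)" by auto
  moreover have "has_decomposition (bistar k l) (\<Union>c\<in>M. und ` T c)"
  proof (rule has_decomposition_family)
    fix c d assume cd: "c \<in> M" "d \<in> M" "c \<noteq> d"
    have "T c \<inter> T d = {}" using cd sub by (auto simp: T_def)
    then show "und ` T c \<inter> und ` T d = {}"
      using inj_on_image_Int[OF inj_on_subset[OF inj_on_und[OF AB] F] TF[OF cd(1)] TF[OF cd(2)]] by simp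
  next
    fix c assume c: "c \<in> M"
    obtain a b where ab: "c = (a, b)" by (cases c)
    have "a \<in> A" "b \<in> B" using c ab sub F by auto
    let ?X = "fst ` {e \<in> P - M. g e = c}" and ?Y = "snd ` {e \<in> F - P. h e = c}"
    have sX: "snd e = b" if "e \<in> P - M" "g e = c" for e using g(1)[OF that(1)] that(2) ab by simp
    have fY: "fst e = a" if "e \<in> F - P" "h e = c" for e using h(1)[OF that(1)] that(2) ab by simp
    have cX: "card ?X = k - 1"
      unfolding g(2)[OF c, symmetric] by (rule card_image) (use sX in \<open>auto simp: inj_on_def prod_eq_iff\<close>)
    have cY: "card ?Y = l - 1"
      unfolding h(2)[OF c, symmetric] by (rule card_image) (use fY in \<open>auto simp: inj_on_def prod_eq_iff\<close>)
    have "edge_iso (insert {b, a} ((\<lambda>x. {b, x}) ` ?X \<union> (\<lambda>y. {a, y}) ` ?Y)) (bistar k l)"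
    proof (rule edge_iso_bistar[OF _ _ cX cY kl])
      have XA: "?X \<subseteq> A" and YB: "?Y \<subseteq> B" using F sub by auto
      show "b \<noteq> a" "?X \<inter> ?Y = {}" using AB \<open>a \<in> A\<close> \<open>b \<in> B\<close> XA YB by auto
      have "a \<notin> ?X"
      proof
        assume "a \<in> ?X"
        then obtain e where e: "e \<in> P - M" "g e = c" "fst e = a" by auto
        then have "e = c" using sX[OF e(1,2)] ab by (simp add: prod_eq_iff)
        then show False using e(1) c by simp
      qed
      moreover have "b \<notin> ?Y"
      proof
        assume "b \<in> ?Y"
        then obtain e where e: "e \<in> F - P" "h e = c" "snd e = b" by auto
        then have "e = c" using fY[OF e(1,2)] ab by (simp add: prod_eq_iff)
        then show False using e(1) c sub by auto
      qed
      ultimately show "b \<notin> ?X \<union> ?Y" "a \<notin> ?X \<union> ?Y" using AB \<open>a \<in> A\<close> \<open>b \<in> B\<close> XA YB by auto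
    qed (use finite in auto)
    moreover have "und ` T c = insert {b, a} ((\<lambda>x. {b, x}) ` ?X \<union> (\<lambda>y. {a, y}) ` ?Y)"
    proof -
      have "und ` {e \<in> P - M. g e = c} = (\<lambda>x. {b, x}) ` ?X"
        unfolding image_image by (rule image_cong) (use sX in \<open>auto simp: und_def\<close>)
      moreover have "und ` {e \<in> F - P. h e = c} = (\<lambda>x. {a, x}) ` ?Y"
        unfolding image_image by (rule image_cong) (use fY in \<open>auto simp: und_def\<close>)
      moreover have "und c = {b, a}" using ab by (auto simp: und_def)
      ultimately show ?thesis unfolding T_def by (simp add: image_Un)
    qed
    ultimately show "edge_iso (und ` T c) (bistar k l)" by simp
  qed
  ultimately show ?thesis by simp
qed

section \<open>Splitting a bipartite graph into two one-sided parts\<close>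

lemma sum_adjacency:
  fixes H :: "('a \<times> 'a) set"
  assumes fin: "finite V" and H: "H \<subseteq> V \<times> V" "\<And>x y. (x, y) \<in> H \<Longrightarrow> (y, x) \<notin> H" and X: "X \<subseteq> V" "Y \<subseteq> V"
  shows "(\<Sum>x\<in>X. \<Sum>y\<in>Y. of_bool ((x, y) \<in> H \<or> (y, x) \<in> H)) = card (H \<inter> X \<times> Y) + card (H \<inter> Y \<times> X)"
proof -
  have fXY: "finite X" "finite Y" using X fin by (auto intro: finite_subset)
  have finH: "finite H" using fin H(1) by (meson finite_SigmaI finite_subset)
  have 1: "(\<Sum>x\<in>X. \<Sum>y\<in>Y. of_bool ((x, y) \<in> G)) = card (G \<inter> X \<times> Y)"
    if "finite X" "finite Y" for G :: "('a \<times> 'a) set" and X Y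
  proof -
    have "(\<Sum>x\<in>X. \<Sum>y\<in>Y. of_bool ((x, y) \<in> G)) = (\<Sum>p\<in>X \<times> Y. of_bool (p \<in> G))"
      by (simp add: sum.cartesian_product case_prod_beta)
    also have "\<dots> = card (G \<inter> X \<times> Y)" using that by (simp add: Int_commute)
    finally show ?thesis by simp
  qed
  have "(\<Sum>x\<in>X. \<Sum>y\<in>Y. of_bool ((x, y) \<in> H \<or> (y, x) \<in> H))
     = (\<Sum>x\<in>X. \<Sum>y\<in>Y. of_bool ((x, y) \<in> H) + of_bool ((y, x) \<in> H) :: nat)"
    by (intro sum.cong refl) (use H(2) in auto)
  also have "\<dots> = (\<Sum>x\<in>X. \<Sum>y\<in>Y. of_bool ((x, y) \<in> H)) + (\<Sum>y\<in>Y. \<Sum>x\<in>X. of_bool ((y, x) \<in> H))"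
    unfolding sum.distrib by (subst (2) sum.swap) simp
  also have "\<dots> = card (H \<inter> X \<times> Y) + card (H \<inter> Y \<times> X)" unfolding 1[OF fXY] 1[OF fXY(2,1)] ..
  finally show ?thesis .
qed

lemma card_crossing_eq:
  assumes "finite H" "H \<subseteq> V \<times> V" "X \<subseteq> V"
  shows "card (crossing H X) = card (H \<inter> X \<times> (V - X)) + card (H \<inter> (V - X) \<times> X)"
proof -
  have "crossing H X = (H \<inter> X \<times> (V - X)) \<union> (H \<inter> (V - X) \<times> X)"
    using assms by (auto simp: crossing_def)
  then show ?thesis using assms(1) by (simp add: card_Un_disjoint) (subst card_Un_disjoint, auto)
qed

lemma crossing_converse: "card (crossing (H\<inverse>) X) = card (crossing H X)"
proof -
  have "crossing (H\<inverse>) X = (crossing H X)\<inverse>" by (auto simp: crossing_def)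
  then show ?thesis by (simp add: card_inverse)
qed

lemma out_deg_converse: "out_deg (H\<inverse>) v = in_deg H v"
proof -
  have "{e \<in> H\<inverse>. fst e = v} = {e \<in> H. snd e = v}\<inverse>" by auto
  then show ?thesis by (simp add: out_deg_def in_deg_def card_inverse)
qed

lemma und_converse: "und ` (H\<inverse>) = und ` H"
  by (force simp: und_def image_iff)

text \<open>Of the \<open>m\<close> edges per bistar at a vertex of \<open>A\<close>, one is
  central, \<open>l - 1\<close> lead to its own leaves, and at the other \<open>k - 1\<close> the
  vertex is itself a leaf.\<close>

lemma one_sided_bistars:
  fixes F R :: "('a \<times> 'a) set"
  assumes fin: "finite A" "finite B" and AB: "A \<inter> B = {}" and F: "F \<subseteq> A \<times> B" and R: "R \<subseteq> F"
    and m: "1 < k" "k \<le> l" "m = k + l - 1"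
    and dvd: "\<And>a. a \<in> A \<Longrightarrow> m dvd out_deg F a"
    and conn: "\<And>X. \<lbrakk>X \<subseteq> A \<union> B; X \<noteq> {}; X \<noteq> A \<union> B\<rbrakk> \<Longrightarrow> 24 * m \<le> card (crossing R X)"
  shows "has_decomposition (bistar k l) (und ` F)"
proof -
  have "\<exists>P M. P \<subseteq> F \<and> M \<subseteq> P \<and> (\<forall>a\<in>A. out_deg F a = m * out_deg M a \<and> out_deg P a = k * out_deg M a) \<and>
    (\<forall>b\<in>B. in_deg P b = k * in_deg M b)"
    by (rule one_sided_decomposition[OF fin AB F R m]) (erule dvd, rule conn)
  then obtain P M where PM: "P \<subseteq> F" "M \<subseteq> P"
    and A: "\<forall>a\<in>A. out_deg F a = m * out_deg M a \<and> out_deg P a = k * out_deg M a"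
    and B: "\<forall>b\<in>B. in_deg P b = k * in_deg M b"
    by (elim exE conjE) (rule that)
  have finF: "finite F" using fin F by (meson finite_SigmaI finite_subset)
  have finP: "finite P" using PM(1) finF by (rule finite_subset)
  show ?thesis
  proof (rule decomposition_from_labels[OF finF AB F PM])
    fix a assume a: "a \<in> A"
    have "out_deg (F - P) a + k * out_deg M a = m * out_deg M a"
      using out_deg_Diff[OF finF PM(1), of a] A a by simp
    also have "\<dots> = (l - 1) * out_deg M a + k * out_deg M a"
    proof -
      have "m = (l - 1) + k" using m by simp
      then show ?thesis by (simp only: distrib_right)
    qed
    finally show "out_deg (F - P) a = (l - 1) * out_deg M a" by simp
  next
    fix b assume b: "b \<in> B"
    have "in_deg (P - M) b + in_deg M b = k * in_deg M b"
      using in_deg_Diff[OF finP PM(2), of b] B b by simp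
    also have "\<dots> = (k - 1) * in_deg M b + in_deg M b" using m by (simp flip: add_mult_distrib2 add: diff_mult_distrib)
    finally show "in_deg (P - M) b = (k - 1) * in_deg M b" by simp
  qed (use m in auto)
qed

text \<open>The graph \<open>H\<close> left by \<open>R1\<close> and \<open>R2\<close> contains
  \<open>R3\<close> and can be oriented; an edge goes to the part belonging to the side it leaves.
  Out-degrees congruent to the negated degrees in \<open>R1\<close> on \<open>A\<close> and in
  \<open>R2\<close> on \<open>B\<close> give each part divisible degrees on its side, with its
  reserve intact.\<close>

theorem bipartite_bistars:
  fixes F R1 R2 R3 :: "('a \<times> 'a) set"
  assumes fin: "finite A" "finite B" and AB: "A \<inter> B = {}" and F: "F \<subseteq> A \<times> B"
    and R: "R1 \<subseteq> F" "R2 \<subseteq> F" "R3 \<subseteq> F" "R1 \<inter> R2 = {}" "R3 \<inter> (R1 \<union> R2) = {}"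
    and m: "1 < k" "k \<le> l" "m = k + l - 1" and dvd: "m dvd card F"
    and R1: "\<And>X. \<lbrakk>X \<subseteq> A \<union> B; X \<noteq> {}; X \<noteq> A \<union> B\<rbrakk> \<Longrightarrow> 24 * m \<le> card (crossing R1 X)"
    and R2: "\<And>X. \<lbrakk>X \<subseteq> A \<union> B; X \<noteq> {}; X \<noteq> A \<union> B\<rbrakk> \<Longrightarrow> 24 * m \<le> card (crossing R2 X)"
    and R3: "\<And>X. \<lbrakk>X \<subseteq> A \<union> B; X \<noteq> {}; X \<noteq> A \<union> B\<rbrakk> \<Longrightarrow> 12 * m \<le> card (crossing R3 X)"
  shows "has_decomposition (bistar k l) (und ` F)"
proof -
  let ?V = "A \<union> B"
  have m0: "0 < m" using m by simp
  have finV: "finite ?V" using fin by simp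
  have finF: "finite F" using fin F by (meson finite_SigmaI finite_subset)
  have finR: "finite R1" "finite R2" using R finF by (auto intro: finite_subset)
  define H where "H = F - R1 - R2"
  have HF: "H \<subseteq> F" by (auto simp: H_def)
  have finH: "finite H" using HF finF by (rule finite_subset)
  have HV: "H \<subseteq> ?V \<times> ?V" using HF F by auto
  have Hanti: "(y, x) \<notin> H" if "(x, y) \<in> H" for x y
  proof
    assume "(y, x) \<in> H"
    then have "x \<in> A" "x \<in> B" using that HF F by auto
    then show False using AB by auto
  qed
  have cH: "card H + card R1 + card R2 = card F"
  proof -
    have "F = H \<union> (R1 \<union> R2)" using R by (auto simp: H_def)
    moreover have "card (H \<union> (R1 \<union> R2)) = card H + card (R1 \<union> R2)"
      using finH finR by (intro card_Un_disjoint) (auto simp: H_def)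
    moreover have "card (R1 \<union> R2) = card R1 + card R2" using finR R(4) by (rule card_Un_disjoint)
    ultimately show ?thesis by simp
  qed
  define w :: "'a \<Rightarrow> 'a \<Rightarrow> nat" where "w x y = of_bool ((x, y) \<in> H \<or> (y, x) \<in> H)" for x y
  define p where "p v = (if v \<in> A then - int (out_deg R1 v) else - int (in_deg R2 v))" for v
  have "sum p ?V = (\<Sum>v\<in>A. - int (out_deg R1 v)) + (\<Sum>v\<in>B. - int (in_deg R2 v))"
  proof -
    have "sum p ?V = sum p A + sum p B" using fin AB by (rule sum.union_disjoint)
    moreover have "sum p B = (\<Sum>v\<in>B. - int (in_deg R2 v))"
      by (rule sum.cong) (use AB in \<open>auto simp: p_def\<close>)
    ultimately show ?thesis by (simp add: p_def)
  qed
  also have "\<dots> = - int (\<Sum>v\<in>A. out_deg R1 v) - int (\<Sum>v\<in>B. in_deg R2 v)" by (simp add: sum_negf)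
  also have "(\<Sum>v\<in>A. out_deg R1 v) = card R1"
    unfolding sum_out_deg[OF finR(1) fin(1)] using R F by (auto intro!: arg_cong[of _ _ card])
  also have "(\<Sum>v\<in>B. in_deg R2 v) = card R2"
    unfolding sum_in_deg[OF finR(2) fin(2)] using R F by (auto intro!: arg_cong[of _ _ card])
  finally have sp: "sum p ?V = - int (card R1) - int (card R2)" .
  have "(\<Sum>x\<in>?V. \<Sum>y\<in>?V. w x y) = card (H \<inter> ?V \<times> ?V) + card (H \<inter> ?V \<times> ?V)"
    unfolding w_def by (rule sum_adjacency[OF finV HV Hanti]) auto
  also have "H \<inter> ?V \<times> ?V = H" using HV by (rule Int_absorb2)
  finally have sw: "(\<Sum>x\<in>?V. \<Sum>y\<in>?V. w x y) = 2 * card H" by simp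
  have "\<exists>d. (\<forall>x\<in>?V. \<forall>y\<in>?V. d x y + d y x = w x y) \<and> (\<forall>x\<in>?V. [int (\<Sum>y\<in>?V. d x y) = p x] (mod int m))"
  proof (rule modular_orientation[OF finV _ _ m0])
    show "w x y = w y x" for x y by (auto simp: w_def)
    show "w x x = 0" for x using Hanti by (auto simp: w_def)
    have "int (card F) = int (card H) + int (card R1) + int (card R2)" unfolding cH[symmetric] by simp
    \<comment> \<open>The prescribed out-degrees must add up to \<open>card H\<close> modulo
      \<open>m\<close>, which amounts to the divisibility of \<open>card F\<close>.\<close>
    then have "2 * (- int (card R1) - int (card R2)) - int (2 * card H) = - 2 * int (card F)" by simp
    moreover have "2 * int m dvd - 2 * int (card F)" using dvd by (simp add: mult_dvd_mono)
    ultimately show "[2 * sum p ?V = int (\<Sum>x\<in>?V. \<Sum>y\<in>?V. w x y)] (mod (2 * int m))"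
      unfolding sp sw cong_iff_dvd_diff by simp
    fix X assume X: "X \<subseteq> ?V" "X \<noteq> {}" "X \<noteq> ?V"
    have "(\<Sum>x\<in>X. \<Sum>y\<in>?V - X. w x y) = card (H \<inter> X \<times> (?V - X)) + card (H \<inter> (?V - X) \<times> X)"
      unfolding w_def by (rule sum_adjacency[OF finV HV Hanti X(1)]) auto
    also have "\<dots> = card (crossing H X)" by (rule card_crossing_eq[OF finH HV X(1), symmetric])
    finally have "(\<Sum>x\<in>X. \<Sum>y\<in>?V - X. w x y) = card (crossing H X)" .
    moreover have "card (crossing R3 X) \<le> card (crossing H X)"
    proof (rule card_mono)
      show "finite (crossing H X)" using finH by (simp add: crossing_def)
    qed (use R in \<open>auto simp: crossing_def H_def\<close>)
    ultimately show "12 * m \<le> (\<Sum>x\<in>X. \<Sum>y\<in>?V - X. w x y)" using R3[OF X] by simp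
  qed
  then obtain d where d: "\<forall>x\<in>?V. \<forall>y\<in>?V. d x y + d y x = w x y"
    and dp: "\<forall>x\<in>?V. [int (\<Sum>y\<in>?V. d x y) = p x] (mod int m)" by (elim exE conjE)
  define S where "S = {e \<in> H. d (fst e) (snd e) = 1}"
  have SH: "S \<subseteq> H" by (auto simp: S_def)
  have finS: "finite S" using SH finH by (rule finite_subset)
  have dv: "d x y + d y x = w x y" if "x \<in> ?V" "y \<in> ?V" for x y using d that by blast
  have dA: "d a y = of_bool ((a, y) \<in> S)" if "a \<in> A" "y \<in> ?V" for a y
  proof -
    have "(y, a) \<notin> H" using that HF F AB by auto
    then have "d a y + d y a = of_bool ((a, y) \<in> H)" using dv[of a y] that by (simp add: w_def)
    then show ?thesis unfolding S_def by (cases "(a, y) \<in> H"; cases "d a y = 1") (simp_all, linarith?)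
  qed
  have dB: "d b y = of_bool ((y, b) \<in> H - S)" if "b \<in> B" "y \<in> ?V" for b y
  proof -
    have "(b, y) \<notin> H" using that HF F AB by auto
    then have "d b y + d y b = of_bool ((y, b) \<in> H)" using dv[of b y] that by (simp add: w_def)
    then show ?thesis unfolding S_def by (cases "(y, b) \<in> H"; cases "d y b = 1") (simp_all, linarith?)
  qed
  have oS: "(\<Sum>y\<in>?V. d a y) = out_deg S a" if a: "a \<in> A" for a
  proof -
    have "(\<Sum>y\<in>?V. d a y) = card {y \<in> ?V. (a, y) \<in> S}"
      using dA[OF a] finV by (simp add: Int_def)
    also have "\<dots> = card (Pair a ` {y \<in> ?V. (a, y) \<in> S})" by (simp add: card_image inj_on_def)
    also have "Pair a ` {y \<in> ?V. (a, y) \<in> S} = {e \<in> S. fst e = a}" using SH HV by auto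
    finally show ?thesis by (simp add: out_deg_def)
  qed
  have iS: "(\<Sum>y\<in>?V. d b y) = in_deg (H - S) b" if b: "b \<in> B" for b
  proof -
    have "(\<Sum>y\<in>?V. d b y) = card {y \<in> ?V. (y, b) \<in> H - S}"
      using dB[OF b] finV by (simp add: Int_def)
    also have "\<dots> = card ((\<lambda>y. (y, b)) ` {y \<in> ?V. (y, b) \<in> H - S})" by (simp add: card_image inj_on_def)
    also have "(\<lambda>y. (y, b)) ` {y \<in> ?V. (y, b) \<in> H - S} = {e \<in> H - S. snd e = b}" using HV by auto
    finally show ?thesis by (simp add: in_deg_def)
  qed
  let ?E1 = "R1 \<union> S" and ?E2 = "R2 \<union> (H - S)"
  have sub: "?E1 \<subseteq> F" "?E2 \<subseteq> F" using R SH HF by auto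
  have "m dvd out_deg ?E1 a" if a: "a \<in> A" for a
  proof -
    have "{e \<in> ?E1. fst e = a} = {e \<in> R1. fst e = a} \<union> {e \<in> S. fst e = a}" by auto
    moreover have "card ({e \<in> R1. fst e = a} \<union> {e \<in> S. fst e = a}) = out_deg R1 a + out_deg S a"
      unfolding out_deg_def by (rule card_Un_disjoint) (use finR finS SH in \<open>auto simp: H_def\<close>)
    ultimately have "int (out_deg ?E1 a) = int (out_deg S a) - p a" using a by (simp add: out_deg_def p_def)
    moreover have "int m dvd int (out_deg S a) - p a"
    proof -
      have "[int (\<Sum>y\<in>?V. d a y) = p a] (mod int m)" using dp a by blast
      then show ?thesis unfolding oS[OF a] cong_iff_dvd_diff .
    qed
    ultimately show ?thesis by (metis int_dvd_int_iff)
  qed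
  then have "has_decomposition (bistar k l) (und ` ?E1)"
    by (intro one_sided_bistars[OF fin AB _ _ m _ R1]) (use sub F in auto)
  moreover have "m dvd out_deg (?E2\<inverse>) b" if b: "b \<in> B" for b
  proof -
    have "{e \<in> ?E2. snd e = b} = {e \<in> R2. snd e = b} \<union> {e \<in> H - S. snd e = b}" by auto
    moreover have "card ({e \<in> R2. snd e = b} \<union> {e \<in> H - S. snd e = b}) = in_deg R2 b + in_deg (H - S) b"
      unfolding in_deg_def by (rule card_Un_disjoint) (use finR finH in \<open>auto simp: H_def\<close>)
    moreover have "b \<notin> A" using b AB by auto
    ultimately have "int (in_deg ?E2 b) = int (in_deg (H - S) b) - p b" by (simp add: in_deg_def p_def)
    moreover have "int m dvd int (in_deg (H - S) b) - p b"
    proof -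
      have "[int (\<Sum>y\<in>?V. d b y) = p b] (mod int m)" using dp b by blast
      then show ?thesis unfolding iS[OF b] cong_iff_dvd_diff .
    qed
    ultimately show ?thesis unfolding out_deg_converse by (metis int_dvd_int_iff)
  qed
  \<comment> \<open>Reversing the arcs exchanges the two sides, so in this part the vertices of
    \<open>B\<close> are the \<open>l\<close>-centres.\<close>
  then have "has_decomposition (bistar k l) (und ` (?E2\<inverse>))"
  proof (intro one_sided_bistars[where R = "R2\<inverse>" and m = m, OF fin(2,1) _ _ _ m])
    show "24 * m \<le> card (crossing (R2\<inverse>) X)" if "X \<subseteq> B \<union> A" "X \<noteq> {}" "X \<noteq> B \<union> A" for X
      unfolding crossing_converse using that by (intro R2) auto
  qed (use AB sub F in auto)
  then have "has_decomposition (bistar k l) (und ` ?E2)" unfolding und_converse .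
  moreover have "und ` ?E1 \<inter> und ` ?E2 = {}"
  proof -
    have "?E1 \<inter> ?E2 = {}" using R SH by (auto simp: H_def)
    then show ?thesis using inj_on_image_Int[OF inj_on_subset[OF inj_on_und[OF AB] F] sub] by simp
  qed
  ultimately have "has_decomposition (bistar k l) (und ` ?E1 \<union> und ` ?E2)" by (rule has_decomposition_Un)
  moreover have "?E1 \<union> ?E2 = F" using R SH by (auto simp: H_def)
  then have "und ` ?E1 \<union> und ` ?E2 = und ` F" by (metis image_Un)
  ultimately show ?thesis by simp
qed

section \<open>Reduction to bipartite graphs\<close>

lemma edge_iso_card:
  assumes "edge_iso F H"
  shows "card F = card H"
proof -
  obtain f where f: "bij_betw f (\<Union>F) (\<Union>H)" "(\<lambda>e. f ` e) ` F = H"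
    using assms unfolding edge_iso_def by (elim exE conjE)
  have "inj_on f (\<Union>F)" using f(1) by (simp add: bij_betw_def)
  then have "inj_on (image f) F" by (rule inj_on_subset[OF inj_on_image_Pow]) auto
  then show ?thesis unfolding f(2)[symmetric] by (simp add: card_image)
qed

lemma card_bistar:
  assumes "0 < k" "0 < l"
  shows "card (bistar k l) = k + l - 1"
proof -
  have bi: "bistar k l = insert {0, 1} ((\<lambda>x. {0, x}) ` {2..k} \<union> (\<lambda>y. {1, y}) ` {k + 1..k + l - 1})"
    unfolding bistar_def by auto
  have "card ((\<lambda>x. {0, x}) ` {2..k}) = k - 1"
    by (subst card_image) (auto simp: inj_on_def doubleton_eq_iff)
  moreover have "card ((\<lambda>y. {1, y}) ` {k + 1..k + l - 1}) = l - 1"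
    using assms by (subst card_image) (auto simp: inj_on_def doubleton_eq_iff)
  moreover have "(\<lambda>x. {0, x}) ` {2..k} \<inter> (\<lambda>y. {1, y}) ` {k + 1..k + l - 1} = {}"
  proof (rule equals0I)
    fix e assume "e \<in> (\<lambda>x. {0, x}) ` {2..k} \<inter> (\<lambda>y. {1, y}) ` {k + 1..k + l - 1}"
    then have "0 \<in> e" "\<exists>y. k + 1 \<le> y \<and> e = {1, y}" by auto
    then show False by auto
  qed
  moreover have "{0, 1} \<notin> (\<lambda>x. {0, x}) ` {2..k} \<union> (\<lambda>y. {1, y}) ` {k + 1..k + l - 1}"
  proof
    assume "{0, 1} \<in> (\<lambda>x. {0, x}) ` {2..k} \<union> (\<lambda>y. {1, y}) ` {k + 1..k + l - 1}"
    then obtain x :: nat where "2 \<le> x" "x \<in> {0, 1}" using assms by fastforce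
    then show False by simp
  qed
  ultimately show ?thesis unfolding bi using assms by (simp add: card_Un_disjoint)
qed

text \<open>This shows in the end that the bipartite graph left over still has a number of edges
  divisible by \<open>m\<close>.\<close>

lemma has_decomposition_dvd:
  assumes "has_decomposition H E" "finite E"
  shows "card H dvd card E"
proof -
  obtain P where P: "\<Union>P = E" "\<forall>X\<in>P. \<forall>Y\<in>P. X \<noteq> Y \<longrightarrow> X \<inter> Y = {}" "\<forall>X\<in>P. edge_iso X H"
    using assms(1) unfolding has_decomposition_def by (elim exE conjE)
  have "card (\<Union>P) = sum card P"
  proof (rule card_Union_disjoint)
    show "pairwise disjnt P" using P(2) by (auto simp: pairwise_def disjnt_def)
    show "finite A" if "A \<in> P" for A using that P(1) assms(2) by (auto intro: finite_subset)
  qed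
  moreover have "card X = card H" if "X \<in> P" for X using P(3) that by (blast intro: edge_iso_card)
  ultimately show ?thesis unfolding P(1) by simp
qed

lemma has_decomposition_single: "edge_iso T H \<Longrightarrow> has_decomposition H T"
  unfolding has_decomposition_def by (intro exI[of _ "{T}"]) simp

lemma has_decomposition_empty: "has_decomposition H {}"
  unfolding has_decomposition_def by (intro exI[of _ "{}"]) simp

lemma simple_graph_finite: "simple_graph V E \<Longrightarrow> finite E"
proof -
  assume "simple_graph V E"
  then have "finite V" "E \<subseteq> Pow V" by (auto simp: simple_graph_def)
  then show ?thesis by (meson finite_Pow_iff finite_subset)
qed

definition cut_edges :: "'a set set \<Rightarrow> 'a set \<Rightarrow> 'a set set" where
  "cut_edges E X = {e \<in> E. e \<inter> X \<noteq> {} \<and> \<not> e \<subseteq> X}"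

lemma cut_edges_size:
  assumes G: "simple_graph V E" and conn: "edge_connected N V E" and X: "X \<subseteq> V" "X \<noteq> {}" "X \<noteq> V"
  shows "N \<le> card (cut_edges E X)"
proof (rule ccontr)
  assume "\<not> N \<le> card (cut_edges E X)"
  then have "connected_graph V (E - cut_edges E X)"
    using conn unfolding edge_connected_def by (auto simp: cut_edges_def)
  moreover obtain u v where uv: "u \<in> X" "v \<in> V" "v \<notin> X" using X by auto
  ultimately have "(adj (E - cut_edges E X))\<^sup>*\<^sup>* u v" using X unfolding connected_graph_def by auto
  then have "v \<in> X"
  proof (induction rule: rtranclp_induct)
    case base
    then show ?case using uv by simp
  next
    case (step y z)
    then show ?case by (auto simp: adj_def cut_edges_def)
  qed
  then show False using uv by simp
qed

text \<open>Flipping the sides of all vertices of \<open>X\<close> in a maximum cut shows that every cut retains at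
  least half of its edges.\<close>
lemma max_cut:
  assumes G: "simple_graph V E" and N: "\<And>X. \<lbrakk>X \<subseteq> V; X \<noteq> {}; X \<noteq> V\<rbrakk> \<Longrightarrow> 2 * n \<le> card (cut_edges E X)"
  shows "\<exists>A\<subseteq>V. \<forall>X\<subseteq>V. X \<noteq> {} \<longrightarrow> X \<noteq> V \<longrightarrow> n \<le> card (cut_edges E A \<inter> cut_edges E X)"
proof -
  have finV: "finite V" using G by (simp add: simple_graph_def)
  have finE: "finite E" using G by (rule simple_graph_finite)
  have finC: "finite (cut_edges E X)" for X using finE by (simp add: cut_edges_def)
  let ?S = "(\<lambda>A. card (cut_edges E A)) ` Pow V"
  have "finite ?S" using finV by simp
  moreover have "?S \<noteq> {}" by auto
  ultimately have "Max ?S \<in> ?S" by (rule Max_in)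
  then obtain A where A: "A \<subseteq> V" "Max ?S = card (cut_edges E A)" by auto
  have max: "card (cut_edges E B) \<le> card (cut_edges E A)" if "B \<subseteq> V" for B
    unfolding A(2)[symmetric] using that \<open>finite ?S\<close> by (intro Max_ge) auto
  have "n \<le> card (cut_edges E A \<inter> cut_edges E X)" if X: "X \<subseteq> V" "X \<noteq> {}" "X \<noteq> V" for X
  proof -
    let ?A = "cut_edges E A" and ?X = "cut_edges E X" and ?B = "(A - X) \<union> (X - A)"
    have "cut_edges E ?B = (?A - ?X) \<union> (?X - ?A)"
    proof -
      have "e \<in> cut_edges E ?B \<longleftrightarrow> e \<in> (?A - ?X) \<union> (?X - ?A)" for e
      proof (cases "e \<in> E")
        case True
        then obtain u v where "e = {u, v}" using G unfolding simple_graph_def by blast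
        then show ?thesis using True by (auto simp: cut_edges_def)
      qed (simp add: cut_edges_def)
      then show ?thesis by blast
    qed
    moreover have "card (cut_edges E ?B) \<le> card ?A" using A(1) X by (intro max) auto
    moreover have "card ((?A - ?X) \<union> (?X - ?A)) = card (?A - ?X) + card (?X - ?A)"
      using finC by (intro card_Un_disjoint) auto
    moreover have "card ?A = card (?A - ?X) + card (?A \<inter> ?X)"
      using finC by (metis Diff_Int2 Int_Diff_Un card_Un_disjoint finite_Diff finite_Int Int_Diff_disjoint add.commute)
    moreover have "card ?X = card (?X - ?A) + card (?A \<inter> ?X)"
      using finC by (metis Int_commute Int_Diff_Un card_Un_disjoint finite_Diff finite_Int Int_Diff_disjoint add.commute)
    ultimately show ?thesis using N[OF X] by simp
  qed
  then show ?thesis using A(1) by blast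
qed

text \<open>A nonempty graph all of whose nonzero degrees are at least \<open>k + l - 1\<close> contains a bistar, so after
  removing a maximal family of disjoint bistars what remains is degenerate.\<close>
lemma strip_bistars:
  fixes Q :: "'a set set"
  assumes kl: "1 < k" "1 < l" and fin: "finite Q" and Q: "\<And>e. e \<in> Q \<Longrightarrow> \<exists>u v. e = {u, v} \<and> u \<noteq> v"
  shows "\<exists>W. und ` W \<subseteq> Q \<and> has_decomposition (bistar k l) (Q - und ` W) \<and> finite W \<and>
    (\<forall>x y. (x, y) \<in> W \<longrightarrow> (y, x) \<notin> W) \<and> (\<forall>v. out_deg W v \<le> k + l - 2)"
  using fin Q
proof (induction "card Q" arbitrary: Q rule: less_induct)
  case less
  note fin = less.prems(1)
  define nb where "nb v = {x. {v, x} \<in> Q}" for v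
  have nb_finite: "finite (nb v)" for v
  proof -
    have "inj_on (\<lambda>x. {v, x}) (nb v)" by (auto simp: inj_on_def doubleton_eq_iff)
    moreover have "(\<lambda>x. {v, x}) ` nb v \<subseteq> Q" by (auto simp: nb_def)
    ultimately show ?thesis using fin inj_on_finite by blast
  qed
  have nb_irr: "v \<notin> nb v" for v using less.prems(2)[of "{v, v}"] by (auto simp: nb_def doubleton_eq_iff)
  consider (empty) "Q = {}" | (low) v where "nb v \<noteq> {}" "card (nb v) \<le> k + l - 2"
    | (high) "Q \<noteq> {}" "\<And>v. nb v \<noteq> {} \<Longrightarrow> k + l - 2 < card (nb v)"
    by (meson not_le)
  then show ?case
  proof cases
    case empty
    then show ?thesis by (intro exI[of _ "{}"]) (simp add: has_decomposition_empty out_deg_def)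
  next
    case low
    \<comment> \<open>A vertex of small positive degree is stripped: all of its edges are directed
      away from it, and the rest is handled by induction.\<close>
    define Qv where "Qv = {e \<in> Q. v \<in> e}"
    obtain x where "x \<in> nb v" using low by auto
    then have "{v, x} \<in> Qv" by (simp add: Qv_def nb_def)
    then have "Qv \<noteq> {}" "Qv \<subseteq> Q" by (auto simp: Qv_def)
    then have "card (Q - Qv) < card Q" using fin by (intro psubset_card_mono) auto
    then have "\<exists>W. und ` W \<subseteq> Q - Qv \<and> has_decomposition (bistar k l) (Q - Qv - und ` W) \<and> finite W \<and>
      (\<forall>x y. (x, y) \<in> W \<longrightarrow> (y, x) \<notin> W) \<and> (\<forall>v. out_deg W v \<le> k + l - 2)"
      using fin less.prems(2) by (intro less.hyps) auto
    then obtain W where W: "und ` W \<subseteq> Q - Qv" "has_decomposition (bistar k l) (Q - Qv - und ` W)" "finite W"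
      "\<forall>x y. (x, y) \<in> W \<longrightarrow> (y, x) \<notin> W" "\<forall>v. out_deg W v \<le> k + l - 2" by (elim exE conjE)
    have Wv: "x \<noteq> v" "y \<noteq> v" if "(x, y) \<in> W" for x y
      using W(1) that by (auto simp: Qv_def und_def image_subset_iff)
    let ?W = "W \<union> Pair v ` nb v"
    have undv: "und ` Pair v ` nb v = Qv"
    proof (intro equalityI subsetI)
      fix e assume e: "e \<in> Qv"
      then obtain a b where "e = {a, b}" "a \<noteq> b" using less.prems(2)[of e] by (auto simp: Qv_def)
      moreover have "a = v \<or> b = v" using e calculation by (auto simp: Qv_def)
      ultimately obtain y where "e = {v, y}" by (auto simp: insert_commute)
      moreover from this have "y \<in> nb v" using e by (simp add: Qv_def nb_def)
      ultimately show "e \<in> und ` Pair v ` nb v" unfolding image_image und_def by auto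
    qed (auto simp: Qv_def nb_def und_def)
    have "Q - und ` ?W = Q - Qv - und ` W" unfolding image_Un undv by auto
    then have d1: "has_decomposition (bistar k l) (Q - und ` ?W)" using W(2) by simp
    have d2: "und ` ?W \<subseteq> Q" unfolding image_Un undv using W(1) \<open>Qv \<subseteq> Q\<close> by auto
    have d3: "out_deg ?W u \<le> k + l - 2" for u
    proof (cases "u = v")
      case True
      have "fst e \<noteq> v" if "e \<in> W" for e using Wv(1)[of "fst e" "snd e"] that by simp
      then have "{e \<in> ?W. fst e = u} = Pair v ` nb v" using True by auto
      then show ?thesis using low(2) by (simp add: out_deg_def card_image inj_on_def)
    next
      case False
      then have "{e \<in> ?W. fst e = u} = {e \<in> W. fst e = u}" by auto
      then show ?thesis using W(5) by (simp add: out_deg_def)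
    qed
    have d4: "(y, x) \<notin> ?W" if "(x, y) \<in> ?W" for x y
    proof -
      have vW: "(v, z) \<notin> W" "(z, v) \<notin> W" for z using Wv(1)[of v z] Wv(2)[of z v] by auto
      show ?thesis
      proof
        assume yx: "(y, x) \<in> ?W"
        show False
        proof (cases "(x, y) \<in> W")
          case True
          then have "(y, x) \<notin> W" "x \<noteq> v" "y \<noteq> v" using W(4) Wv(1,2)[of x y] by simp_all
          then show False using yx by auto
        next
          case False
          then have xy: "x = v" "y \<in> nb v" using that by auto
          then have "y \<noteq> v" using nb_irr[of v] by auto
          then show False using yx xy(1) vW(2)[of y] by auto
        qed
      qed
    qed
    have d5: "finite ?W" using W(3) nb_finite by simp
    show ?thesis by (intro exI[of _ ?W] conjI allI impI d1 d2 d3 d4 d5)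
  next
    case high
    then obtain e where "e \<in> Q" by auto
    then obtain u v where uv: "{u, v} \<in> Q" "u \<noteq> v" using less.prems(2) by metis
    then have "v \<in> nb u" "u \<in> nb v" by (auto simp: nb_def insert_commute)
    then have big: "k + l - 2 < card (nb u)" "k + l - 2 < card (nb v)" using high(2) by auto
    have "k - 1 \<le> card (nb u - {v})" using big(1) kl \<open>v \<in> nb u\<close> nb_finite by (simp add: card_Diff_singleton)
    then obtain X where X: "X \<subseteq> nb u - {v}" "card X = k - 1" "finite X" by (rule obtain_subset_with_card_n)
    \<comment> \<open>Apart from \<open>u\<close>, the vertex \<open>v\<close> has at least
      \<open>k + l - 2\<close> neighbours, of which \<open>X\<close> takes at most
      \<open>k - 1\<close>; thus \<open>l - 1\<close> remain for \<open>Y\<close>.\<close>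
    have "card (nb v - {u}) - card X \<le> card (nb v - {u} - X)" by (rule diff_card_le_card_Diff[OF X(3)])
    then have "l - 1 \<le> card (nb v - {u} - X)" using big(2) kl X(2) \<open>u \<in> nb v\<close> nb_finite by (simp add: card_Diff_singleton)
    then obtain Y where Y: "Y \<subseteq> nb v - {u} - X" "card Y = l - 1" "finite Y" by (rule obtain_subset_with_card_n)
    define T where "T = insert {u, v} ((\<lambda>x. {u, x}) ` X \<union> (\<lambda>y. {v, y}) ` Y)"
    have "edge_iso T (bistar k l)" unfolding T_def
      by (rule edge_iso_bistar) (use X Y kl uv nb_irr in auto)
    then have dT: "has_decomposition (bistar k l) T" by (rule has_decomposition_single)
    have TQ: "T \<subseteq> Q" "T \<noteq> {}" using uv X(1) Y(1) by (auto simp: T_def nb_def)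
    then have "card (Q - T) < card Q" using fin by (intro psubset_card_mono) auto
    then have "\<exists>W. und ` W \<subseteq> Q - T \<and> has_decomposition (bistar k l) (Q - T - und ` W) \<and> finite W \<and>
      (\<forall>x y. (x, y) \<in> W \<longrightarrow> (y, x) \<notin> W) \<and> (\<forall>v. out_deg W v \<le> k + l - 2)"
      using fin less.prems(2) by (intro less.hyps) auto
    then obtain W where W: "und ` W \<subseteq> Q - T" "has_decomposition (bistar k l) (Q - T - und ` W)" "finite W"
      "\<forall>x y. (x, y) \<in> W \<longrightarrow> (y, x) \<notin> W" "\<forall>v. out_deg W v \<le> k + l - 2" by (elim exE conjE)
    have "has_decomposition (bistar k l) (T \<union> (Q - T - und ` W))"
      by (rule has_decomposition_Un[OF dT W(2)]) auto
    moreover have "T \<union> (Q - T - und ` W) = Q - und ` W" using W(1) TQ by auto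
    ultimately have "has_decomposition (bistar k l) (Q - und ` W)" by simp
    moreover have "und ` W \<subseteq> Q" using W(1) by blast
    ultimately show ?thesis using W(3,4,5) by (intro exI[of _ W] conjI)
  qed
qed

text \<open>Every edge is given multiplicity 12, and the out-degrees are prescribed modulo \<open>2 * n\<close>.\<close>
lemma near_balanced_orientation:
  fixes H :: "('a \<times> 'a) set"
  assumes fin: "finite V" and H: "H \<subseteq> V \<times> V" "\<And>x y. (x, y) \<in> H \<Longrightarrow> (y, x) \<notin> H" and n: "6 \<le> n"
    and conn: "\<And>X. \<lbrakk>X \<subseteq> V; X \<noteq> {}; X \<noteq> V\<rbrakk> \<Longrightarrow> 2 * n \<le> card (crossing H X)"
  shows "\<exists>S\<subseteq>H. \<forall>X\<subseteq>V.
    (n - 6) * card (crossing H X) \<le> 2 * n * card (entering ((H - S) \<union> S\<inverse>) X) \<and>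
    2 * n * card (entering ((H - S) \<union> S\<inverse>) X) \<le> (n + 6) * card (crossing H X)"
proof -
  have finH: "finite H" using fin H(1) by (meson finite_SigmaI finite_subset)
  define ad :: "'a \<Rightarrow> 'a \<Rightarrow> nat" where "ad x y = of_bool ((x, y) \<in> H \<or> (y, x) \<in> H)" for x y
  define dg where "dg x = (\<Sum>y\<in>V. ad x y)" for x
  define e where "e X = card (H \<inter> X \<times> X)" for X
  define cr where "cr X = card (crossing H X)" for X
  have ad_cr: "(\<Sum>x\<in>X. \<Sum>y\<in>V - X. ad x y) = cr X" if "X \<subseteq> V" for X
  proof -
    have "(\<Sum>x\<in>X. \<Sum>y\<in>V - X. ad x y) = card (H \<inter> X \<times> (V - X)) + card (H \<inter> (V - X) \<times> X)"
      unfolding ad_def by (rule sum_adjacency[OF fin H that]) auto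
    then show ?thesis unfolding cr_def card_crossing_eq[OF finH H(1) that] .
  qed
  have ad_in: "(\<Sum>x\<in>X. \<Sum>y\<in>X. ad x y) = 2 * e X" if "X \<subseteq> V" for X
  proof -
    have "(\<Sum>x\<in>X. \<Sum>y\<in>X. ad x y) = card (H \<inter> X \<times> X) + card (H \<inter> X \<times> X)"
      unfolding ad_def by (rule sum_adjacency[OF fin H that that])
    then show ?thesis by (simp add: e_def)
  qed
  have split: "(\<Sum>x\<in>X. \<Sum>y\<in>V. h x y) = (\<Sum>x\<in>X. \<Sum>y\<in>V - X. h x y) + (\<Sum>x\<in>X. \<Sum>y\<in>X. h x y)"
    if "X \<subseteq> V" for X and h :: "'a \<Rightarrow> 'a \<Rightarrow> nat"
    unfolding sum.distrib[symmetric] by (intro sum.cong refl sum.subset_diff[OF that fin])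
  have dg: "sum dg X = 2 * e X + cr X" if "X \<subseteq> V" for X
    unfolding dg_def split[OF that] ad_cr[OF that] ad_in[OF that] by simp
  have crV: "cr V = 0"
  proof -
    have "crossing H V = {}" using H(1) by (auto simp: crossing_def)
    then show ?thesis by (simp add: cr_def)
  qed
  \<comment> \<open>Credit each end of an edge with \<open>(n - 6) / (2 * n)\<close> of it, plus
    \<open>1 / (2 * n)\<close> for each of the 12 copies leaving that end. The two credits add up to
    1 and differ from one half by at most \<open>6 / (2 * n)\<close>. The residue is chosen to make
    the total credit of each vertex an integer, since
    \<open>(n + 6) + (n - 6) = 2 * n\<close>.\<close>
  define p where "p x = int ((6 + n) * dg x)" for x
  have "\<exists>d. (\<forall>x\<in>V. \<forall>y\<in>V. d x y + d y x = 12 * ad x y) \<and> (\<forall>x\<in>V. [int (\<Sum>y\<in>V. d x y) = p x] (mod int (2 * n)))"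
  proof (rule modular_orientation[OF fin])
    show "12 * ad x y = 12 * ad y x" for x y by (auto simp: ad_def)
    show "12 * ad x x = 0" for x using H(2) by (auto simp: ad_def)
    show "0 < 2 * n" using n by simp
    have "2 * sum p V = int ((12 + 2 * n) * sum dg V)"
      by (simp add: p_def sum_distrib_left sum.distrib algebra_simps)
    also have "\<dots> = int (12 * sum dg V) + int (2 * n) * int (2 * e V)"
      unfolding dg[OF order_refl] crV by (simp add: algebra_simps)
    also have "12 * sum dg V = (\<Sum>x\<in>V. \<Sum>y\<in>V. 12 * ad x y)"
      by (simp add: dg_def sum_distrib_left)
    finally have eq: "2 * sum p V - int (\<Sum>x\<in>V. \<Sum>y\<in>V. 12 * ad x y) = (2 * int (2 * n)) * int (e V)" by simp
    show "[2 * sum p V = int (\<Sum>x\<in>V. \<Sum>y\<in>V. 12 * ad x y)] (mod (2 * int (2 * n)))"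
      unfolding cong_iff_dvd_diff eq by (rule dvd_triv_left)
    fix X assume X: "X \<subseteq> V" "X \<noteq> {}" "X \<noteq> V"
    have "12 * (2 * n) \<le> 12 * cr X" using conn[OF X] by (simp add: cr_def)
    also have "\<dots> = (\<Sum>x\<in>X. \<Sum>y\<in>V - X. 12 * ad x y)" unfolding ad_cr[OF X(1), symmetric] by (simp add: sum_distrib_left)
    finally show "12 * (2 * n) \<le> (\<Sum>x\<in>X. \<Sum>y\<in>V - X. 12 * ad x y)" .
  qed
  then obtain d where d: "\<forall>x\<in>V. \<forall>y\<in>V. d x y + d y x = 12 * ad x y"
    and dp: "\<forall>x\<in>V. [int (\<Sum>y\<in>V. d x y) = p x] (mod int (2 * n))" by (elim exE conjE)
  define out where "out x = (\<Sum>y\<in>V. d x y)" for x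
  have out_in: "(\<Sum>x\<in>X. \<Sum>y\<in>X. d x y) = 12 * e X" if X: "X \<subseteq> V" for X
  proof -
    have "2 * (\<Sum>x\<in>X. \<Sum>y\<in>X. d x y) = (\<Sum>x\<in>X. \<Sum>y\<in>X. d x y) + (\<Sum>x\<in>X. \<Sum>y\<in>X. d y x)"
      by (subst (3) sum.swap) simp
    also have "\<dots> = (\<Sum>x\<in>X. \<Sum>y\<in>X. 12 * ad x y)"
      unfolding sum.distrib[symmetric] using d X by (intro sum.cong refl) auto
    also have "\<dots> = 12 * (2 * e X)" unfolding ad_in[OF X, symmetric] by (simp add: sum_distrib_left)
    finally show ?thesis by simp
  qed
  have out_cr: "(\<Sum>x\<in>X. \<Sum>y\<in>V - X. d x y) \<le> 12 * cr X" if X: "X \<subseteq> V" for X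
  proof -
    have "(\<Sum>x\<in>X. \<Sum>y\<in>V - X. d x y) \<le> (\<Sum>x\<in>X. \<Sum>y\<in>V - X. 12 * ad x y)"
    proof (intro sum_mono)
      fix x y assume "x \<in> X" "y \<in> V - X"
      then have "d x y + d y x = 12 * ad x y" using d X by auto
      then show "d x y \<le> 12 * ad x y" by linarith
    qed
    also have "\<dots> = 12 * cr X" unfolding ad_cr[OF X, symmetric] by (simp add: sum_distrib_left)
    finally show ?thesis .
  qed
  have out: "12 * e X \<le> sum out X" "sum out X \<le> 12 * e X + 12 * cr X" if X: "X \<subseteq> V" for X
    using out_in[OF X] out_cr[OF X] unfolding out_def split[OF X] by linarith+
  \<comment> \<open>The total credit of \<open>x\<close>, an integral and almost even share of its
    degree.\<close>
  define f where "f x = (out x + (n - 6) * dg x) div (2 * n)" for x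
  have f: "2 * n * f x = out x + (n - 6) * dg x" if x: "x \<in> V" for x
  proof -
    have dvd: "int (2 * n) dvd int (out x) - p x"
      using dp x unfolding out_def cong_iff_dvd_diff by blast
    have eq: "int (out x + (n - 6) * dg x) = int (out x) - p x + int (2 * n) * int (dg x)"
    proof -
      have "int (out x + (n - 6) * dg x) = int (out x) + (int n - 6) * int (dg x)"
        by (simp only: of_nat_add of_nat_mult of_nat_diff[OF n] of_nat_numeral)
      moreover have "p x = (6 + int n) * int (dg x)" by (simp add: p_def algebra_simps)
      ultimately show ?thesis by (simp add: algebra_simps)
    qed
    have "int (2 * n) dvd int (out x + (n - 6) * dg x)"
      unfolding eq by (intro dvd_add dvd dvd_triv_left)
    then have "2 * n dvd out x + (n - 6) * dg x" by (simp only: int_dvd_int_iff)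
    then show ?thesis by (simp add: f_def)
  qed
  have fs: "2 * n * sum f X = sum out X + (n - 6) * sum dg X" if X: "X \<subseteq> V" for X
  proof -
    have "2 * n * sum f X = (\<Sum>x\<in>X. out x + (n - 6) * dg x)"
      unfolding sum_distrib_left by (rule sum.cong) (use f X in auto)
    then show ?thesis by (simp add: sum.distrib sum_distrib_left)
  qed
  have n2: "n - 6 + 6 = n" using n by simp
  have e2: "2 * n * e X = 12 * e X + (n - 6) * (2 * e X)" for X
    using arg_cong[OF n2, of "\<lambda>t. 2 * (t * e X)"] by (simp add: add_mult_distrib)
  have c2: "(n + 6) * cr X = 12 * cr X + (n - 6) * cr X" for X
    using arg_cong[OF n2, of "\<lambda>t. t * cr X"] by (simp add: add_mult_distrib)
  have flow: "2 * n * e X + (n - 6) * cr X \<le> 2 * n * sum f X" "2 * n * sum f X \<le> 2 * n * e X + (n + 6) * cr X"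
    if X: "X \<subseteq> V" for X
    unfolding fs[OF X] dg[OF X] distrib_left e2 c2 using out[OF X] by linarith+
  have "\<exists>S\<subseteq>H. \<forall>v\<in>V. card {e \<in> S. fst e = v} + card {e \<in> H - S. snd e = v} \<le> f v"
  \<comment> \<open>The credits of the vertices of \<open>X\<close> cover all edges inside
    \<open>X\<close>, so the fractional ownership can be rounded to an integral one with capacities
    \<open>f\<close>.\<close>
  proof (rule bounded_ownership[OF fin H(1)])
    show "(v, v) \<notin> H" for v using H(2) by auto
    fix X assume X: "X \<subseteq> V"
    have "2 * n * e X \<le> 2 * n * sum f X" using flow(1)[OF X] by linarith
    then show "card (H \<inter> X \<times> X) \<le> sum f X" using n by (simp add: e_def)
  qed
  then obtain S where S: "S \<subseteq> H" and own0: "\<forall>v\<in>V. card {e \<in> S. fst e = v} + card {e \<in> H - S. snd e = v} \<le> f v"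
    by (elim exE conjE)
  have finS: "finite S" using S finH by (rule finite_subset)
  define own where "own v = out_deg S v + in_deg (H - S) v" for v
  have own: "sum own X \<le> sum f X" if "X \<subseteq> V" for X
    using own0 that by (intro sum_mono) (auto simp: own_def out_deg_def in_deg_def)
  have sown: "sum own X = card {e \<in> S. fst e \<in> X} + card {e \<in> H - S. snd e \<in> X}" if "X \<subseteq> V" for X
  proof -
    have "finite X" using that fin by (rule finite_subset)
    then show ?thesis unfolding own_def sum.distrib using finS finH by (simp add: sum_out_deg sum_in_deg)
  qed
  have "sum own V = sum f V"
  proof -
    have "{e \<in> S. fst e \<in> V} = S" "{e \<in> H - S. snd e \<in> V} = H - S" using S H(1) by auto
    then have "sum own V = card S + card (H - S)" using sown[of V] by simp
    also have "\<dots> = e V"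
    proof -
      have "H \<inter> V \<times> V = H" using H(1) by (rule Int_absorb2)
      then show ?thesis using S finH finS by (simp add: e_def card_Diff_subset card_mono)
    qed
    finally have "sum own V = e V" .
    moreover have "2 * n * sum f V \<le> 2 * n * e V" "2 * n * e V \<le> 2 * n * sum f V"
      using flow[OF order_refl] unfolding crV by linarith+
    then have "sum f V = e V" using n by simp
    ultimately show ?thesis by simp
  qed
  \<comment> \<open>The totals agree, so all capacities are exhausted. With each edge directed to
    its owner, the number of arcs entering \<open>X\<close> is \<open>sum f X\<close> minus the
    number of edges inside \<open>X\<close>.\<close>
  then have own_eq: "sum own X = sum f X" if X: "X \<subseteq> V" for X
    using own[OF X] own[of "V - X"] sum.subset_diff[OF X fin, of own] sum.subset_diff[OF X fin, of f] by auto
  have ent: "sum own X = e X + card (entering ((H - S) \<union> S\<inverse>) X)" if X: "X \<subseteq> V" for X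
  proof -
    let ?a = "{e \<in> S. fst e \<in> X \<and> snd e \<in> X}" and ?b = "{e \<in> S. fst e \<in> X \<and> snd e \<notin> X}"
    let ?c = "{e \<in> H - S. fst e \<in> X \<and> snd e \<in> X}" and ?d = "{e \<in> H - S. fst e \<notin> X \<and> snd e \<in> X}"
    have "card {e \<in> S. fst e \<in> X} = card ?a + card ?b"
      using finS by (subst card_Un_disjoint[symmetric]) (auto intro!: arg_cong[of _ _ card])
    moreover have "card {e \<in> H - S. snd e \<in> X} = card ?c + card ?d"
      using finH by (subst card_Un_disjoint[symmetric]) (auto intro!: arg_cong[of _ _ card])
    moreover have "e X = card ?a + card ?c"
      unfolding e_def using finH finS S by (subst card_Un_disjoint[symmetric]) (auto intro!: arg_cong[of _ _ card])
    moreover have "card (entering ((H - S) \<union> S\<inverse>) X) = card ?d + card (?b\<inverse>)"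
    proof -
      have "entering ((H - S) \<union> S\<inverse>) X = ?d \<union> ?b\<inverse>" by (auto simp: entering_def)
      moreover have "?d \<inter> ?b\<inverse> = {}" using H(2) S by auto
      ultimately show ?thesis using finH finS by (simp add: card_Un_disjoint)
    qed
    moreover have "card (?b\<inverse>) = card ?b" by (rule card_inverse)
    ultimately show ?thesis unfolding sown[OF X] by linarith
  qed
  have "(n - 6) * cr X \<le> 2 * n * card (entering ((H - S) \<union> S\<inverse>) X) \<and>
    2 * n * card (entering ((H - S) \<union> S\<inverse>) X) \<le> (n + 6) * cr X" if X: "X \<subseteq> V" for X
    using flow[OF X] unfolding own_eq[OF X, symmetric] ent[OF X] distrib_left by linarith
  then show ?thesis using S unfolding cr_def by blast
qed

section \<open>Absorbing the edges inside the two sides\<close>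

lemma bounded_ownership_bipartite:
  fixes E :: "('a \<times> 'a) set" and f g :: "'a \<Rightarrow> nat"
  assumes V: "finite V" and E: "E \<subseteq> V \<times> V"
    and fg: "\<And>X Y. \<lbrakk>X \<subseteq> V; Y \<subseteq> V\<rbrakk> \<Longrightarrow> card (E \<inter> X \<times> Y) \<le> sum f X + sum g Y"
  shows "\<exists>S\<subseteq>E. \<forall>v\<in>V. out_deg S v \<le> f v \<and> in_deg (E - S) v \<le> g v"
proof -
  \<comment> \<open>Every vertex is split into a copy for outgoing arcs, tagged
    \<open>False\<close>, and one for incoming arcs, tagged \<open>True\<close>; the two bounds
    become capacities of different vertices.\<close>
  define i where "i e = ((fst e, False), (snd e, True))" for e :: "'a \<times> 'a"
  have inj: "inj i" by (auto simp: inj_def i_def prod_eq_iff)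
  define h where "h v = (if snd v then g (fst v) else f (fst v))" for v
  have "\<exists>S\<subseteq>i ` E. \<forall>v\<in>V \<times> UNIV. card {e \<in> S. fst e = v} + card {e \<in> i ` E - S. snd e = v} \<le> h v"
  proof (rule bounded_ownership)
    show "finite (V \<times> (UNIV :: bool set))" using V by simp
    show "i ` E \<subseteq> (V \<times> UNIV) \<times> (V \<times> UNIV)" "(v, v) \<notin> i ` E" for v using E by (auto simp: i_def)
    fix Z :: "('a \<times> bool) set" assume Z: "Z \<subseteq> V \<times> UNIV"
    define X where "X = {x. (x, False) \<in> Z}"
    define Y where "Y = {y. (y, True) \<in> Z}"
    have XY: "X \<subseteq> V" "Y \<subseteq> V" using Z by (auto simp: X_def Y_def)
    have fXY: "finite X" "finite Y" using XY V by (auto intro: finite_subset)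
    have Z': "Z = (\<lambda>x. (x, False)) ` X \<union> (\<lambda>y. (y, True)) ` Y"
    proof (rule set_eqI)
      fix z :: "'a \<times> bool"
      show "z \<in> Z \<longleftrightarrow> z \<in> (\<lambda>x. (x, False)) ` X \<union> (\<lambda>y. (y, True)) ` Y"
        by (cases z; cases "snd z") (auto simp: X_def Y_def)
    qed
    have "i ` E \<inter> Z \<times> Z = i ` (E \<inter> X \<times> Y)" by (auto simp: i_def X_def Y_def)
    then have "card (i ` E \<inter> Z \<times> Z) = card (E \<inter> X \<times> Y)"
      by (simp add: card_image inj_on_subset[OF inj])
    moreover have "sum h Z = sum f X + sum g Y"
    proof -
      have "sum h Z = sum h ((\<lambda>x. (x, False)) ` X) + sum h ((\<lambda>y. (y, True)) ` Y)"
        unfolding Z' using fXY by (intro sum.union_disjoint) auto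
      then show ?thesis by (simp add: sum.reindex inj_on_def h_def)
    qed
    ultimately show "card (i ` E \<inter> Z \<times> Z) \<le> sum h Z" using fg[OF XY] by simp
  qed
  then obtain S' where S': "S' \<subseteq> i ` E" and b: "\<forall>v\<in>V \<times> UNIV. card {e \<in> S'. fst e = v} + card {e \<in> i ` E - S'. snd e = v} \<le> h v"
    by (elim exE conjE)
  obtain S where S: "S \<subseteq> E" "S' = i ` S" using S' by (rule subset_imageE)
  have "out_deg S v \<le> f v \<and> in_deg (E - S) v \<le> g v" if v: "v \<in> V" for v
  proof -
    have "{e \<in> S'. fst e = (v, False)} = i ` {e \<in> S. fst e = v}" unfolding S(2) by (auto simp: i_def)
    then have "card {e \<in> S'. fst e = (v, False)} = out_deg S v"
      by (simp add: out_deg_def card_image inj_on_subset[OF inj])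
    moreover have "{e \<in> i ` E - S'. snd e = (v, True)} = i ` {e \<in> E - S. snd e = v}"
      unfolding S(2) image_set_diff[OF inj, symmetric] by (auto simp: i_def)
    then have "card {e \<in> i ` E - S'. snd e = (v, True)} = in_deg (E - S) v"
      by (simp add: in_deg_def card_image inj_on_subset[OF inj])
    moreover have "card {e \<in> S'. fst e = (v, False)} \<le> h (v, False)" "card {e \<in> i ` E - S'. snd e = (v, True)} \<le> h (v, True)"
      using bspec[OF b, of "(v, False)"] bspec[OF b, of "(v, True)"] v by simp_all
    ultimately show ?thesis by (simp add: h_def)
  qed
  then show ?thesis using S(1) by blast
qed

lemma injection_over:
  assumes fin: "finite X" "finite Y"
    and card: "\<And>i. i \<in> p ` X \<Longrightarrow> card {x \<in> X. p x = i} \<le> card {y \<in> Y. q y = i}"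
  shows "\<exists>g. inj_on g X \<and> (\<forall>x\<in>X. g x \<in> Y \<and> q (g x) = p x)"
proof -
  have "\<forall>i\<in>p ` X. \<exists>g. g ` {x \<in> X. p x = i} \<subseteq> {y \<in> Y. q y = i} \<and> inj_on g {x \<in> X. p x = i}"
  proof
    fix i assume i: "i \<in> p ` X"
    show "\<exists>g. g ` {x \<in> X. p x = i} \<subseteq> {y \<in> Y. q y = i} \<and> inj_on g {x \<in> X. p x = i}"
      by (rule card_le_inj) (use fin card[OF i] in auto)
  qed
  then obtain G where G: "\<forall>i\<in>p ` X. G i ` {x \<in> X. p x = i} \<subseteq> {y \<in> Y. q y = i} \<and> inj_on (G i) {x \<in> X. p x = i}"
    by (elim bchoice[THEN exE])
  have 1: "G (p x) x \<in> Y \<and> q (G (p x) x) = p x" if "x \<in> X" for x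
  proof -
    have "G (p x) ` {z \<in> X. p z = p x} \<subseteq> {y \<in> Y. q y = p x}" using G that by blast
    then show ?thesis using that by auto
  qed
  have "inj_on (\<lambda>x. G (p x) x) X"
  proof (rule inj_onI)
    fix x y assume xy: "x \<in> X" "y \<in> X" "G (p x) x = G (p y) y"
    then have "p x = p y" using 1[OF xy(1)] 1[OF xy(2)] by simp
    moreover have "inj_on (G (p x)) {z \<in> X. p z = p x}" using G xy(1) by blast
    ultimately show "x = y" using xy by (simp add: inj_on_def)
  qed
  then show ?thesis using 1 by (intro exI[of _ "\<lambda>x. G (p x) x"]) auto
qed

text \<open>Since each demand forbids only one element, one spare element per pool suffices.\<close>
lemma allocate:
  fixes n :: "'j \<Rightarrow> nat" and bad :: "'j \<Rightarrow> 'u" and loc :: "'j \<Rightarrow> 'i" and q :: "'u \<Rightarrow> 'i"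
  assumes "finite J" "finite U"
    and "\<And>j. j \<in> J \<Longrightarrow> (\<Sum>j'\<in>{j' \<in> J. loc j' = loc j}. n j') < card {u \<in> U. q u = loc j}"
  shows "\<exists>Z. (\<forall>j\<in>J. Z j \<subseteq> U \<and> card (Z j) = n j \<and> bad j \<notin> Z j \<and> (\<forall>u\<in>Z j. q u = loc j)) \<and>
    (\<forall>j\<in>J. \<forall>j'\<in>J. j \<noteq> j' \<longrightarrow> Z j \<inter> Z j' = {})"
  using assms(1,3)
proof (induction J rule: finite_induct)
  case empty
  then show ?case by simp
next
  case (insert i J)
  have mono: "(\<Sum>j'\<in>{j' \<in> J. loc j' = loc j}. n j') \<le> (\<Sum>j'\<in>{j' \<in> insert i J. loc j' = loc j}. n j')" for j
    using insert.hyps(1) by (intro sum_mono2) auto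
  have "\<exists>Z. (\<forall>j\<in>J. Z j \<subseteq> U \<and> card (Z j) = n j \<and> bad j \<notin> Z j \<and> (\<forall>u\<in>Z j. q u = loc j)) \<and>
    (\<forall>j\<in>J. \<forall>j'\<in>J. j \<noteq> j' \<longrightarrow> Z j \<inter> Z j' = {})"
  proof (rule insert.IH)
    fix j assume "j \<in> J"
    then show "(\<Sum>j'\<in>{j' \<in> J. loc j' = loc j}. n j') < card {u \<in> U. q u = loc j}"
      by (intro le_less_trans[OF mono] insert.prems) simp
  qed
  then obtain Z where Z1: "\<forall>j\<in>J. Z j \<subseteq> U \<and> card (Z j) = n j \<and> bad j \<notin> Z j \<and> (\<forall>u\<in>Z j. q u = loc j)"
    and Z2: "\<forall>j\<in>J. \<forall>j'\<in>J. j \<noteq> j' \<longrightarrow> Z j \<inter> Z j' = {}" by (elim exE conjE)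
  let ?K = "{j \<in> J. loc j = loc i}" and ?P = "{u \<in> U. q u = loc i}"
  \<comment> \<open>Apart from the sets already chosen only \<open>bad i\<close> is forbidden; the
    strict inequality in the hypothesis provides for it.\<close>
  let ?used = "insert (bad i) (\<Union>j\<in>?K. Z j)"
  have finP: "finite ?P" using assms(2) by simp
  have "finite (\<Union>j\<in>?K. Z j)" using insert.hyps(1) Z1 assms(2) by (auto intro: finite_subset)
  have "card (\<Union>j\<in>?K. Z j) \<le> (\<Sum>j\<in>?K. card (Z j))" using insert.hyps(1) by (intro card_UN_le) simp
  also have "\<dots> = (\<Sum>j\<in>?K. n j)" using Z1 by (intro sum.cong) auto
  finally have "card (\<Union>j\<in>?K. Z j) \<le> (\<Sum>j\<in>?K. n j)" .
  moreover have "card ?used \<le> Suc (card (\<Union>j\<in>?K. Z j))"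
    using \<open>finite (\<Union>j\<in>?K. Z j)\<close> by (simp add: card_insert_if)
  ultimately have cu: "card ?used \<le> Suc (\<Sum>j\<in>?K. n j)" by linarith
  have "(\<Sum>j'\<in>{j' \<in> insert i J. loc j' = loc i}. n j') = n i + (\<Sum>j\<in>?K. n j)"
  proof -
    have "{j' \<in> insert i J. loc j' = loc i} = insert i ?K" by auto
    then show ?thesis using insert.hyps by simp
  qed
  then have "n i + Suc (\<Sum>j\<in>?K. n j) \<le> card ?P" using insert.prems[of i] by simp
  moreover have "card ?P - card ?used \<le> card (?P - ?used)"
    using \<open>finite (\<Union>j\<in>?K. Z j)\<close> by (intro diff_card_le_card_Diff) simp
  ultimately have "n i \<le> card (?P - ?used)" using cu by linarith
  then obtain T where T: "T \<subseteq> ?P - ?used" "card T = n i" by (rule obtain_subset_with_card_n)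
  have TZ: "T \<inter> Z j = {}" if "j \<in> J" for j
  proof (cases "loc j = loc i")
    case True
    then show ?thesis using T(1) that by auto
  next
    case False
    then have "q u \<noteq> loc i" if "u \<in> Z j" for u using Z1 that \<open>j \<in> J\<close> by auto
    then show ?thesis using T(1) by auto
  qed
  show ?case
  proof (intro exI[of _ "Z(i := T)"] conjI ballI impI)
    fix j j' assume j: "j \<in> insert i J" "j' \<in> insert i J" "j \<noteq> j'"
    then show "(Z(i := T)) j \<inter> (Z(i := T)) j' = {}"
      using Z2 TZ[of j] TZ[of j'] insert.hyps(2) by (cases "j = i"; cases "j' = i") (simp_all add: Int_commute)
  qed (use Z1 T insert.hyps(2) in \<open>auto split: if_splits\<close>)
qed

lemma inj_on_und_antisym:
  assumes "\<And>x y. (x, y) \<in> K \<Longrightarrow> (y, x) \<notin> K"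
  shows "inj_on und K"
proof (rule inj_onI)
  fix e f assume "e \<in> K" "f \<in> K" "und e = und f"
  then show "e = f" using assms[of "fst e" "snd e"] by (cases e; cases f) (auto simp: und_def doubleton_eq_iff)
qed

text \<open>An arc \<open>(w, v)\<close> of \<open>D\<close> is at the disposal of its head \<open>v\<close>. Every arc \<open>(v, x)\<close> of \<open>W\<close> becomes a leaf edge at \<open>v\<close> of
  a bistar with central edge \<open>(w, v)\<close>, whose other leaf edges are provided by \<open>v\<close> and \<open>w\<close>.\<close>
lemma absorb_inner_arcs:
  fixes D W Ow :: "('a \<times> 'a) set"
  assumes fin: "finite V" and D: "D \<subseteq> V \<times> V" "\<And>x y. (x, y) \<in> D \<Longrightarrow> (y, x) \<notin> D"
      "\<And>x y. (x, y) \<in> D \<Longrightarrow> (x \<in> A) \<noteq> (y \<in> A)"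
    and W: "W \<subseteq> V \<times> V" "\<And>x y. (x, y) \<in> W \<Longrightarrow> (y, x) \<notin> W" "\<And>x y. (x, y) \<in> W \<Longrightarrow> (x \<in> A) = (y \<in> A)"
    and Ow: "Ow \<subseteq> D" and kl: "1 < k" "1 < l" and T: "0 < t"
    and load: "\<And>v. v \<in> V \<Longrightarrow> t * out_deg W v \<le> in_deg Ow v"
    and room: "\<And>v. v \<in> V \<Longrightarrow> out_deg W v * (k - 1) + (out_deg Ow v div t + 1) * (l - 1) + 1 \<le> in_deg Ow v"
  shows "\<exists>U\<subseteq>Ow. has_decomposition (bistar k l) (und ` (W \<union> U))"
proof -
  have finD: "finite D" using fin D(1) by (meson finite_SigmaI finite_subset)
  have finW: "finite W" using fin W(1) by (meson finite_SigmaI finite_subset)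
  have finO: "finite Ow" using Ow finD by (rule finite_subset)
  have OV: "Ow \<subseteq> V \<times> V" using Ow D(1) by (rule subset_trans)
  \<comment> \<open>\<open>S\<close> will hold the candidates for central edges, about one arc in
    \<open>t\<close>. At most \<open>f v\<close> of them leave \<open>v\<close>, and at most
    \<open>g v\<close> arcs entering \<open>v\<close> are left out, so that at least
    \<open>out_deg W v\<close> candidates enter \<open>v\<close>.\<close>
  define f where "f v = out_deg Ow v div t + 1" for v
  define g where "g v = in_deg Ow v - out_deg W v" for v
  have WO: "out_deg W v \<le> in_deg Ow v" if "v \<in> V" for v
  proof -
    have "out_deg W v \<le> t * out_deg W v" using T by simp
    then show ?thesis using load[OF that] by linarith
  qed
  have "\<exists>S\<subseteq>Ow. \<forall>v\<in>V. out_deg S v \<le> f v \<and> in_deg (Ow - S) v \<le> g v"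
  proof (rule bounded_ownership_bipartite[OF fin OV])
    fix X Y assume XY: "X \<subseteq> V" "Y \<subseteq> V"
    have fXY: "finite X" "finite Y" using XY fin by (auto intro: finite_subset)
    define c where "c = card (Ow \<inter> X \<times> Y)"
    have "c \<le> (\<Sum>v\<in>X. out_deg Ow v)" unfolding c_def by (rule card_inner_le(1)[OF finO fXY(1)])
    also have "\<dots> \<le> (\<Sum>v\<in>X. t * f v)"
    proof (rule sum_mono)
      fix v
      have "out_deg Ow v = t * (out_deg Ow v div t) + out_deg Ow v mod t" by simp
      moreover have "out_deg Ow v mod t < t" using T by simp
      ultimately show "out_deg Ow v \<le> t * f v" unfolding f_def distrib_left by linarith
    qed
    finally have 1: "c \<le> t * sum f X" by (simp add: sum_distrib_left)
    have "c \<le> (\<Sum>v\<in>Y. in_deg Ow v)" unfolding c_def by (rule card_inner_le(2)[OF finO fXY(2)])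
    then have "(t - 1) * c \<le> (\<Sum>v\<in>Y. (t - 1) * in_deg Ow v)" unfolding sum_distrib_left[symmetric] by (rule mult_le_mono2)
    also have "\<dots> \<le> (\<Sum>v\<in>Y. t * g v)"
    proof (rule sum_mono)
      fix v assume "v \<in> Y"
      then have "t * out_deg W v \<le> in_deg Ow v" using XY by (intro load) auto
      then show "(t - 1) * in_deg Ow v \<le> t * g v" unfolding g_def diff_mult_distrib diff_mult_distrib2 by simp
    qed
    finally have 2: "(t - 1) * c \<le> t * sum g Y" by (simp add: sum_distrib_left)
    \<comment> \<open>Charging each arc with \<open>1 / t\<close> to its tail and
      \<open>1 - 1 / t\<close> to its head respects all capacities; the inequality appears
      multiplied by \<open>t\<close>.\<close>
    have "t * c = c + (t - 1) * c" using T by (cases t) auto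
    then have "t * c \<le> t * (sum f X + sum g Y)" unfolding distrib_left using 1 2 by linarith
    then show "card (Ow \<inter> X \<times> Y) \<le> sum f X + sum g Y" using T by (simp add: c_def)
  qed
  then obtain S where S: "S \<subseteq> Ow" and S0: "\<forall>v\<in>V. out_deg S v \<le> f v \<and> in_deg (Ow - S) v \<le> g v"
    by (elim exE conjE)
  have Sf: "out_deg S v \<le> f v" "in_deg (Ow - S) v \<le> g v" if "v \<in> V" for v using S0 that by blast+
  have finS: "finite S" using S finO by (rule finite_subset)
  have "\<exists>c. inj_on c W \<and> (\<forall>e\<in>W. c e \<in> S \<and> snd (c e) = fst e)"
  proof (rule injection_over[OF finW finS])
    fix v assume "v \<in> fst ` W"
    then have v: "v \<in> V" using W(1) by auto
    have "out_deg W v \<le> in_deg S v"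
      using Sf(2)[OF v] WO[OF v] in_deg_Diff[OF finO S, of v] unfolding g_def by linarith
    then show "card {e \<in> W. fst e = v} \<le> card {e \<in> S. snd e = v}" by (simp add: out_deg_def in_deg_def)
  qed
  then obtain c where c_inj: "inj_on c W" and c0: "\<forall>e\<in>W. c e \<in> S \<and> snd (c e) = fst e" by (elim exE conjE)
  have c: "c e \<in> S" "snd (c e) = fst e" if "e \<in> W" for e using c0 that by blast+
  let ?C = "c ` W"
  have CO: "?C \<subseteq> Ow" using c(1) S by auto
  \<comment> \<open>An arc \<open>e = (v, x)\<close> of \<open>W\<close> makes two demands: tag
    \<open>True\<close> for further leaf edges at \<open>v\<close>, tag \<open>False\<close> for
    leaf edges at the tail of the central edge \<open>c e\<close>.\<close>
  define loc where "loc j = (if snd j then fst (fst j) else fst (c (fst j)))" for j :: "('a \<times> 'a) \<times> bool"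
  \<comment> \<open>\<open>v\<close> is the \<open>k\<close>-centre and already has the leaf
    \<open>x\<close>, hence \<open>k - 2\<close>; the tail of the central edge is the
    \<open>l\<close>-centre.\<close>
  define n where "n j = (if snd j then k - 2 else l - 1)" for j :: "('a \<times> 'a) \<times> bool"
  \<comment> \<open>The one possible coincidence of leaves: \<open>x\<close> lies on the side of
    \<open>v\<close> and may be adjacent to the other centre \<open>w\<close> too, so the arc
    \<open>(x, w)\<close> is excluded.\<close>
  define bad where "bad j = (snd (fst j), fst (c (fst j)))" for j :: "('a \<times> 'a) \<times> bool"
  let ?J = "W \<times> (UNIV :: bool set)" and ?U = "Ow - ?C"
  have "\<exists>Z. (\<forall>j\<in>?J. Z j \<subseteq> ?U \<and> card (Z j) = n j \<and> bad j \<notin> Z j \<and> (\<forall>u\<in>Z j. snd u = loc j)) \<and>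
    (\<forall>j\<in>?J. \<forall>j'\<in>?J. j \<noteq> j' \<longrightarrow> Z j \<inter> Z j' = {})"
  proof (rule allocate)
    show "finite ?J" "finite ?U" using finW finO by simp_all
    fix j assume j: "j \<in> ?J"
    define y where "y = loc j"
    have e: "fst j \<in> W" using j by auto
    have y: "y \<in> V"
    proof (cases "snd j")
      case True
      then show ?thesis using e W(1) by (auto simp: y_def loc_def)
    next
      case False
      have "c (fst j) \<in> V \<times> V" using c(1)[OF e] S OV by blast
      then show ?thesis using False by (simp add: y_def loc_def mem_Times_iff)
    qed
    let ?a = "{e \<in> W. fst e = y}" and ?b = "{e \<in> W. fst (c e) = y}"
    have "{j' \<in> ?J. loc j' = y} = (\<lambda>e. (e, True)) ` ?a \<union> (\<lambda>e. (e, False)) ` ?b"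
      by (auto simp: loc_def split: if_splits)
    then have "(\<Sum>j'\<in>{j' \<in> ?J. loc j' = y}. n j') = sum n ((\<lambda>e. (e, True)) ` ?a) + sum n ((\<lambda>e. (e, False)) ` ?b)"
      using finW by (simp only:) (intro sum.union_disjoint, auto)
    also have "\<dots> = card ?a * (k - 2) + card ?b * (l - 1)"
      by (simp add: sum.reindex inj_on_def n_def)
    also have "card ?b \<le> f y"
    proof -
      have "card ?b = card (c ` ?b)" using c_inj by (intro card_image[symmetric]) (auto simp: inj_on_def)
      also have "\<dots> \<le> out_deg S y" unfolding out_deg_def using c(1) finS by (intro card_mono) auto
      finally show ?thesis using Sf(1)[OF y] by simp
    qed
    then have "card ?a * (k - 2) + card ?b * (l - 1) \<le> out_deg W y * (k - 2) + f y * (l - 1)"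
      unfolding out_deg_def by (intro add_mono mult_le_mono1) auto
    \<comment> \<open>An arc of \<open>W\<close> leaving \<open>y\<close> takes one entering arc as
      central edge and \<open>k - 2\<close> as leaf edges, which explains the factor
      \<open>k - 1\<close> in \<open>room\<close>; the final 1 there is the spare element.\<close>
    also have "\<dots> < in_deg ?U y"
    proof -
      have "{u \<in> ?C. snd u = y} = c ` ?a" using c(2) by auto
      moreover have "card (c ` ?a) = card ?a" using c_inj by (intro card_image) (auto simp: inj_on_def)
      ultimately have "in_deg ?C y = out_deg W y" by (simp add: in_deg_def out_deg_def)
      then have "in_deg ?U y + out_deg W y = in_deg Ow y" using in_deg_Diff[OF finO CO, of y] by simp
      moreover have "out_deg W y * (k - 1) = out_deg W y * (k - 2) + out_deg W y"
      proof -
        have "k - 1 = Suc (k - 2)" using kl by simp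
        then show ?thesis by simp
      qed
      ultimately show ?thesis using room[OF y] unfolding f_def by linarith
    qed
    finally show "(\<Sum>j'\<in>{j' \<in> ?J. loc j' = loc j}. n j') < card {u \<in> ?U. snd u = loc j}"
      unfolding y_def in_deg_def .
  qed
  then obtain Z where Z0: "\<forall>j\<in>?J. Z j \<subseteq> ?U \<and> card (Z j) = n j \<and> bad j \<notin> Z j \<and> (\<forall>u\<in>Z j. snd u = loc j)"
    and Zd: "\<forall>j\<in>?J. \<forall>j'\<in>?J. j \<noteq> j' \<longrightarrow> Z j \<inter> Z j' = {}" by (elim exE conjE)
  have Z: "Z (e, i) \<subseteq> ?U" "card (Z (e, i)) = n (e, i)" "bad (e, i) \<notin> Z (e, i)" "\<And>u. u \<in> Z (e, i) \<Longrightarrow> snd u = loc (e, i)"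
    if "e \<in> W" for e i using bspec[OF Z0, of "(e, i)"] that by simp_all
  define K where "K e = insert (c e) (Z (e, True) \<union> Z (e, False))" for e
  have KO: "K e \<subseteq> Ow" if "e \<in> W" for e using that Z(1)[OF that] c(1)[OF that] S by (auto simp: K_def)
  have WD: "W \<inter> D = {}" using W(3) D(3) by auto
  have injWD: "inj_on und (W \<union> D)"
  proof (rule inj_on_und_antisym)
    fix x y assume xy: "(x, y) \<in> W \<union> D"
    show "(y, x) \<notin> W \<union> D"
      using xy W(2)[of x y] D(2)[of x y] W(3)[of x y] D(3)[of x y] W(3)[of y x] D(3)[of y x] by blast
  qed
  have "has_decomposition (bistar k l) (\<Union>e\<in>W. und ` insert e (K e))"
  proof (rule has_decomposition_family)
    fix e e' assume e: "e \<in> W" "e' \<in> W" "e \<noteq> e'"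
    have "Z (e, i) \<inter> Z (e', i') = {}" for i i' using Zd e by blast
    moreover have "c e \<noteq> c e'" using inj_onD[OF c_inj, of e e'] e by blast
    moreover have "c e \<notin> Z (e', i)" "c e' \<notin> Z (e, i)" for i using Z(1)[OF e(1)] Z(1)[OF e(2)] e by blast+
    ultimately have "K e \<inter> K e' = {}" unfolding K_def by blast
    moreover have "e \<notin> K e'" "e' \<notin> K e" using KO e WD Ow by blast+
    ultimately have "insert e (K e) \<inter> insert e' (K e') = {}" using e(3) by blast
    moreover have "insert e (K e) \<subseteq> W \<union> D" "insert e' (K e') \<subseteq> W \<union> D" using KO e Ow by blast+
    ultimately show "und ` insert e (K e) \<inter> und ` insert e' (K e') = {}"
      using inj_on_image_Int[OF injWD] by (metis image_empty)
  next
    fix e assume e: "e \<in> W"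
    obtain v x where vx: "e = (v, x)" by (cases e)
    obtain w where w: "c e = (w, v)" using c(2)[OF e] vx by (cases "c e") auto
    have wv: "(w, v) \<in> D" using c(1)[OF e] S Ow w by auto
    have colw: "(w \<in> A) \<noteq> (v \<in> A)" using D(3)[OF wv] .
    have colx: "(v \<in> A) = (x \<in> A)" using W(3) e vx by auto
    have "v \<noteq> x" using W(2)[of v x] e vx by auto
    let ?Z1 = "Z (e, True)" and ?Z2 = "Z (e, False)"
    have Z1: "snd u = v" "u \<in> D" "u \<noteq> (w, v)" if "u \<in> ?Z1" for u
    proof -
      have "u \<in> ?U" using Z(1)[OF e] that by blast
      moreover have "(w, v) \<in> c ` W" using imageI[OF e, of c] w by simp
      ultimately show "u \<in> D" "u \<noteq> (w, v)" using Ow by auto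
      show "snd u = v" using Z(4)[OF e that] vx by (simp add: loc_def)
    qed
    have Z2: "snd u = w" "u \<in> D" "u \<noteq> (x, w)" if "u \<in> ?Z2" for u
    proof -
      have "u \<in> ?U" using Z(1)[OF e] that by blast
      then show "u \<in> D" using Ow by auto
      show "snd u = w" using Z(4)[OF e that] w by (simp add: loc_def)
      show "u \<noteq> (x, w)" using Z(3)[OF e, of False] that vx w by (auto simp: bad_def)
    qed
    have T1: "(y \<in> A) \<noteq> (v \<in> A)" "y \<noteq> w" if y: "y \<in> fst ` ?Z1" for y
    proof -
      obtain u where u: "u \<in> ?Z1" "y = fst u" using y by blast
      have "u = (y, v)" using Z1(1)[OF u(1)] u(2) by (cases u) simp
      then show "(y \<in> A) \<noteq> (v \<in> A)" "y \<noteq> w" using Z1(2,3)[OF u(1)] D(3) by auto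
    qed
    have T2: "(y \<in> A) \<noteq> (w \<in> A)" "y \<noteq> x" "y \<noteq> v" if y: "y \<in> fst ` ?Z2" for y
    proof -
      obtain u where u: "u \<in> ?Z2" "y = fst u" using y by blast
      have "u = (y, w)" using Z2(1)[OF u(1)] u(2) by (cases u) simp
      then show "(y \<in> A) \<noteq> (w \<in> A)" "y \<noteq> x" "y \<noteq> v" using Z2(2,3)[OF u(1)] D(3) D(2)[OF wv] by auto
    qed
    have finZ: "finite ?Z1" "finite ?Z2" using Z(1)[OF e] finO by (meson finite_Diff finite_subset)+
    have "inj_on fst ?Z1" using Z1(1) by (auto simp: inj_on_def prod_eq_iff)
    then have c1: "card (fst ` ?Z1) = k - 2" using Z(2)[OF e, of True] by (simp add: card_image n_def)
    have "inj_on fst ?Z2" using Z2(1) by (auto simp: inj_on_def prod_eq_iff)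
    then have c2: "card (fst ` ?Z2) = l - 1" using Z(2)[OF e, of False] by (simp add: card_image n_def)
    have "x \<notin> fst ` ?Z1" using T1(1)[of x] colx by blast
    then have cX: "card (insert x (fst ` ?Z1)) = k - 1" using c1 finZ kl by simp
    have "edge_iso (insert {v, w} ((\<lambda>y. {v, y}) ` insert x (fst ` ?Z1) \<union> (\<lambda>y. {w, y}) ` fst ` ?Z2)) (bistar k l)"
    proof (rule edge_iso_bistar[OF _ _ cX c2])
      show "v \<noteq> w" using colw by auto
      show "v \<notin> insert x (fst ` ?Z1) \<union> fst ` ?Z2" using \<open>v \<noteq> x\<close> T1(1)[of v] T2(3)[of v] by blast
      show "w \<notin> insert x (fst ` ?Z1) \<union> fst ` ?Z2" using colw colx T1(2)[of w] T2(1)[of w] by blast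
      show "insert x (fst ` ?Z1) \<inter> fst ` ?Z2 = {}" using colw T1(1) T2(1,2) by blast
    qed (use finZ kl in auto)
    moreover have "und ` insert e (K e) = insert {v, w} ((\<lambda>y. {v, y}) ` insert x (fst ` ?Z1) \<union> (\<lambda>y. {w, y}) ` fst ` ?Z2)"
    proof -
      have "und ` ?Z1 = (\<lambda>y. {v, y}) ` fst ` ?Z1"
        unfolding image_image by (rule image_cong) (use Z1(1) in \<open>auto simp: und_def\<close>)
      moreover have "und ` ?Z2 = (\<lambda>y. {w, y}) ` fst ` ?Z2"
        unfolding image_image by (rule image_cong) (use Z2(1) in \<open>auto simp: und_def\<close>)
      moreover have "und e = {v, x}" "und (c e) = {v, w}" using vx w by (auto simp: und_def)
      ultimately show ?thesis
        by (simp only: K_def image_insert image_Un Un_insert_left Un_insert_right insert_commute)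
    qed
    ultimately show "edge_iso (und ` insert e (K e)) (bistar k l)" by simp
  qed
  moreover have "(\<Union>e\<in>W. und ` insert e (K e)) = und ` (W \<union> (\<Union>e\<in>W. K e))" by blast
  ultimately have "has_decomposition (bistar k l) (und ` (W \<union> (\<Union>e\<in>W. K e)))" by simp
  moreover have "(\<Union>e\<in>W. K e) \<subseteq> Ow" using KO by blast
  ultimately show ?thesis by (intro exI[of _ "\<Union>e\<in>W. K e"] conjI)
qed

section \<open>From arcs back to a bipartite graph\<close>

lemma in_deg_entering:
  assumes "\<And>x. (x, x) \<notin> D"
  shows "in_deg D v = card (entering D {v})"
  unfolding in_deg_def entering_def by (rule arg_cong[of _ _ card]) (use assms in auto)

lemma out_deg_entering:
  assumes "\<And>x. (x, x) \<notin> D" "D \<subseteq> V \<times> V"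
  shows "out_deg D v = card (entering D (V - {v}))"
  unfolding out_deg_def entering_def by (rule arg_cong[of _ _ card]) (use assms in auto)

lemma crossing_Diff: "R \<subseteq> V \<times> V \<Longrightarrow> crossing R (V - X) = crossing R X"
  unfolding crossing_def by auto

text \<open>For arcs between \<open>A\<close> and its complement this rewrites every pair with the
  end in \<open>A\<close> first, the form in which bipartite graphs are decomposed.\<close>

definition arcs_from :: "'a set \<Rightarrow> ('a \<times> 'a) set \<Rightarrow> ('a \<times> 'a) set" where
  "arcs_from A R = {e \<in> R \<union> R\<inverse>. fst e \<in> A}"

lemma und_arcs_from:
  assumes "\<And>x y. (x, y) \<in> R \<Longrightarrow> x \<in> A \<or> y \<in> A"
  shows "und ` arcs_from A R = und ` R"
proof (intro equalityI subsetI)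
  fix e assume "e \<in> und ` arcs_from A R"
  then have "e \<in> und ` (R \<union> R\<inverse>)" by (auto simp: arcs_from_def)
  then show "e \<in> und ` R" unfolding image_Un und_converse by simp
next
  fix e assume "e \<in> und ` R"
  then obtain x y where xy: "(x, y) \<in> R" "e = {x, y}" by (auto simp: und_def)
  then consider "(x, y) \<in> arcs_from A R" | "(y, x) \<in> arcs_from A R"
    using assms[OF xy(1)] by (auto simp: arcs_from_def)
  then show "e \<in> und ` arcs_from A R"
  proof cases
    case 1 then show ?thesis using xy(2) by (intro image_eqI) (auto simp: und_def)
  next
    case 2 then show ?thesis using xy(2) by (intro image_eqI) (auto simp: und_def)
  qed
qed

text \<open>No arc occurs in both directions, so \<open>und\<close> is injective on
  \<open>R\<close>, and each entering arc yields a different crossing edge.\<close>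

lemma crossing_arcs_from:
  assumes fin: "finite R" and anti: "\<And>x y. (x, y) \<in> R \<Longrightarrow> (y, x) \<notin> R"
    and A: "\<And>x y. (x, y) \<in> R \<Longrightarrow> x \<in> A \<or> y \<in> A"
  shows "card (entering R X) \<le> card (crossing (arcs_from A R) X)"
proof -
  have fe: "entering R X \<subseteq> R" by (auto simp: entering_def)
  have finc: "finite (crossing (arcs_from A R) X)" using fin by (simp add: crossing_def arcs_from_def)
  have "card (entering R X) = card (und ` entering R X)"
    by (rule card_image[symmetric, OF inj_on_subset[OF inj_on_und_antisym[OF anti] fe]])
  also have "\<dots> \<le> card (und ` crossing (arcs_from A R) X)"
  proof (rule card_mono)
    show "finite (und ` crossing (arcs_from A R) X)" using finc by simp
    show "und ` entering R X \<subseteq> und ` crossing (arcs_from A R) X"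
    proof
      fix e assume "e \<in> und ` entering R X"
      then obtain x y where xy: "(x, y) \<in> R" "x \<notin> X" "y \<in> X" "e = {x, y}"
        by (auto simp: und_def entering_def)
      then consider "(x, y) \<in> crossing (arcs_from A R) X" | "(y, x) \<in> crossing (arcs_from A R) X"
        using A[OF xy(1)] by (auto simp: arcs_from_def crossing_def)
      then show "e \<in> und ` crossing (arcs_from A R) X"
      proof cases
        case 1 then show ?thesis using xy(4) by (intro image_eqI) (auto simp: und_def)
      next
        case 2 then show ?thesis using xy(4) by (intro image_eqI) (auto simp: und_def)
      qed
    qed
  qed
  also have "\<dots> \<le> card (crossing (arcs_from A R) X)" using finc by (rule card_image_le)
  finally show ?thesis .
qed

text \<open>The arithmetic behind \<open>28\<close>. A vertex has degree \<open>d\<close> in the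
  bipartite graph, in-degree \<open>i\<close> and out-degree \<open>u\<close> in its orientation,
  in-degree \<open>q\<close> and out-degree \<open>t\<close> after removal of the reserves, and
  out-degree \<open>s\<close> among the degenerate edges. From \<open>i \<ge> n - 6\<close> and
  \<open>60 * m \<le> 20 * m\<^sup>2\<close> it follows that
  \<open>q \<ge> 8 * m\<^sup>2 - 6\<close>, enough for \<open>7 * m * (m - 1)\<close>.\<close>

lemma degree_estimate:
  fixes m n d i u q s t k l :: nat
  assumes m: "3 \<le> m" "m = k + l - 1" "1 < k" "1 < l" and n: "n = 28 * m\<^sup>2"
    and i: "(n - 6) * d \<le> 2 * n * i" and u: "2 * n * u \<le> (n + 6) * d" and d: "2 * n \<le> d"
    and q: "i \<le> q + 60 * m" and s: "s \<le> m - 1" and t: "t \<le> u"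
  shows "7 * m * s \<le> q" and "s * (k - 1) + (t div (7 * m) + 1) * (l - 1) + 1 \<le> q"
proof -
  define M where "M = m * m"
  have nM: "n = 28 * M" by (simp add: n M_def power2_eq_square)
  have M3: "3 * m \<le> M" unfolding M_def using m(1) by (rule mult_le_mono1)
  have n0: "252 \<le> n" using nM M3 m(1) by linarith
  have "2 * n * (n - 6) = (n - 6) * (2 * n)" by (rule mult.commute)
  also have "\<dots> \<le> (n - 6) * d" using d by (rule mult_le_mono2)
  also note i
  finally have i6: "n - 6 \<le> i" using n0 by simp
  have "7 * m * s \<le> 7 * m * (m - 1)" using s by (rule mult_le_mono2)
  also have "\<dots> = 7 * M - 7 * m" by (simp add: M_def diff_mult_distrib2)
  also have "\<dots> \<le> q" using i6 q nM M3 m(1) by linarith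
  finally show "7 * m * s \<le> q" .
  have "2 * n * ((n - 6) * u) \<le> 2 * n * ((n + 6) * i)"
  proof -
    have "(n - 6) * (2 * n * u) \<le> (n - 6) * ((n + 6) * d)" using u by (rule mult_le_mono2)
    also have "\<dots> = (n + 6) * ((n - 6) * d)" by (rule mult.left_commute)
    also have "\<dots> \<le> (n + 6) * (2 * n * i)" using i by (rule mult_le_mono2)
    finally show ?thesis by (simp only: mult.left_commute mult.assoc)
  qed
  then have "(n - 6) * u \<le> (n + 6) * i" using n0 by simp
  then have "20 * ((n - 6) * u) \<le> 20 * ((n + 6) * i)" by (rule mult_le_mono2)
  then have "(n - 6) * (20 * u) \<le> (20 * (n + 6)) * i" by (simp only: mult.assoc mult.left_commute)
  \<comment> \<open>The out-degree is at most \<open>(n + 6) / (n - 6)\<close> times the in-degree,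
    and this factor is at most \<open>21 / 20\<close> since \<open>n \<ge> 252\<close>.\<close>
  also have "\<dots> \<le> (21 * (n - 6)) * i" using n0 by (intro mult_le_mono1) simp
  finally have "(n - 6) * (20 * u) \<le> (n - 6) * (21 * i)" by (simp add: mult.commute mult.left_commute)
  then have ui: "20 * u \<le> 21 * i" using n0 by simp
  define c where "c = t div (7 * m)"
  have "c * (l - 1) \<le> c * m" using m by (intro mult_le_mono2) linarith
  then have "7 * (c * (l - 1)) \<le> c * (7 * m)" by simp
  also have "\<dots> \<le> t" unfolding c_def by (rule div_times_less_eq_dividend)
  finally have c7: "7 * (c * (l - 1)) \<le> u" using t by simp
  have "s * (k - 1) + (l - 1) + 1 \<le> M"
  proof -
    have "s * (k - 1) \<le> (m - 1) * (k - 1)" using s by (rule mult_le_mono1)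
    moreover have "l - 1 \<le> (m - 1) * (l - 1)" using m by simp
    moreover have "(m - 1) * (k - 1) + (m - 1) * (l - 1) = (m - 1) * (m - 1)"
      unfolding distrib_left[symmetric] using m by simp
    moreover have "(m - 1) * (m - 1) + 1 \<le> M"
    proof -
      obtain j where "m = Suc j" using m(1) by (cases m) auto
      then show ?thesis by (simp add: M_def)
    qed
    ultimately show ?thesis by linarith
  qed
  \<comment> \<open>The left side is at most \<open>u / 7 + M\<close>, hence at most
    \<open>3 * i / 20 + M\<close>, while \<open>q \<ge> i - 60 * m \<ge> i - 20 * M\<close>; the
    bound \<open>i \<ge> 28 * M - 6\<close> leaves a margin.\<close>
  moreover have "c * (l - 1) + M \<le> q"
    using c7 ui i6 q nM M3 m(1) by linarith
  ultimately show "s * (k - 1) + (t div (7 * m) + 1) * (l - 1) + 1 \<le> q"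
    unfolding c_def[symmetric] add_mult_distrib by linarith
qed

theorem theorem22:
  fixes k l m :: nat and V :: "'a set" and E :: "'a set set"
  assumes "1 < k" and "k \<le> l" and "m = k + l - 1"
    and "simple_graph V E"
    and "edge_connected (112 * m^2) V E"
    and "m dvd card E"
  shows "has_decomposition (bistar k l) E"
proof (cases "card V \<le> 1")
  case True
  have "E = {}"
  proof (rule equals0I)
    fix e assume "e \<in> E"
    then obtain u v where uv: "u \<noteq> v" "{u, v} \<subseteq> V" "finite V" using assms(4) unfolding simple_graph_def by blast
    then have "card {u, v} \<le> card V" by (intro card_mono)
    then show False using True uv(1) by simp
  qed
  then show ?thesis by (simp add: has_decomposition_empty)
next
  case False
  have finV: "finite V" and EV: "\<And>e. e \<in> E \<Longrightarrow> \<exists>u v. e = {u, v} \<and> u \<noteq> v \<and> u \<in> V \<and> v \<in> V"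
    using assms(4) by (auto simp: simple_graph_def)
  have finE: "finite E" using assms(4) by (rule simple_graph_finite)
  have m3: "3 \<le> m" and kl: "1 < l" using assms(1-3) by auto
  \<comment> \<open>The maximum cut keeps cuts of \<open>56 * m\<^sup>2 = 2 * n\<close>; the
    orientation will leave almost \<open>n\<close> arcs in each direction.\<close>
  define n where "n = 28 * m\<^sup>2"
  have m2: "3 * m \<le> m\<^sup>2" unfolding power2_eq_square using m3 by (rule mult_le_mono1)
  have n60: "60 * m + 6 \<le> n" unfolding n_def using m2 m3 by linarith
  have "\<exists>A\<subseteq>V. \<forall>X\<subseteq>V. X \<noteq> {} \<longrightarrow> X \<noteq> V \<longrightarrow> 2 * n \<le> card (cut_edges E A \<inter> cut_edges E X)"
  proof (rule max_cut[OF assms(4)])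
    fix X assume "X \<subseteq> V" "X \<noteq> {}" "X \<noteq> V"
    then have "112 * m\<^sup>2 \<le> card (cut_edges E X)" by (rule cut_edges_size[OF assms(4,5)])
    then show "2 * (2 * n) \<le> card (cut_edges E X)" by (simp add: n_def)
  qed
  then obtain A where AV: "A \<subseteq> V" and cutA: "\<forall>X\<subseteq>V. X \<noteq> {} \<longrightarrow> X \<noteq> V \<longrightarrow> 2 * n \<le> card (cut_edges E A \<inter> cut_edges E X)"
    by (elim exE conjE)
  define H where "H = {(a, b). a \<in> A \<and> b \<in> V - A \<and> {a, b} \<in> E}"
  have HV: "H \<subseteq> V \<times> V" using AV by (auto simp: H_def)
  have finH: "finite H" using finV HV by (meson finite_SigmaI finite_subset)
  have Hanti: "(y, x) \<notin> H" if "(x, y) \<in> H" for x y using that by (auto simp: H_def)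
  have crossH: "und ` crossing H X = cut_edges E A \<inter> cut_edges E X" if X: "X \<subseteq> V" for X
  proof (intro equalityI subsetI)
    fix e assume "e \<in> cut_edges E A \<inter> cut_edges E X"
    then have e: "e \<in> E" "e \<inter> A \<noteq> {}" "\<not> e \<subseteq> A" "e \<inter> X \<noteq> {}" "\<not> e \<subseteq> X" by (auto simp: cut_edges_def)
    obtain u v where uv: "e = {u, v}" "u \<in> V" "v \<in> V" using EV[OF e(1)] by blast
    then consider "(u, v) \<in> crossing H X" | "(v, u) \<in> crossing H X"
      using e by (auto simp: crossing_def H_def insert_commute)
    then show "e \<in> und ` crossing H X"
    proof cases
      case 1 then show ?thesis using uv(1) by (intro image_eqI) (auto simp: und_def)
    next
      case 2 then show ?thesis using uv(1) by (intro image_eqI) (auto simp: und_def)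
    qed
  next
    fix e assume "e \<in> und ` crossing H X"
    then obtain a b where "(a, b) \<in> H" "(a \<in> X) \<noteq> (b \<in> X)" "e = {a, b}"
      unfolding crossing_def und_def by fastforce
    then show "e \<in> cut_edges E A \<inter> cut_edges E X" by (auto simp: H_def cut_edges_def)
  qed
  have undH: "und ` H = cut_edges E A"
  proof -
    have "crossing H A = H" by (auto simp: crossing_def H_def)
    then show ?thesis using crossH[OF AV] by simp
  qed
  have connH: "2 * n \<le> card (crossing H X)" if X: "X \<subseteq> V" "X \<noteq> {}" "X \<noteq> V" for X
  proof -
    have "inj_on und (crossing H X)"
      by (rule inj_on_subset[OF inj_on_und_antisym[OF Hanti]]) (auto simp: crossing_def)
    then have "card (crossing H X) = card (cut_edges E A \<inter> cut_edges E X)"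
      using card_image crossH[OF X(1)] by metis
    then show ?thesis using cutA X by simp
  qed
  have "\<exists>S\<subseteq>H. \<forall>X\<subseteq>V.
    (n - 6) * card (crossing H X) \<le> 2 * n * card (entering ((H - S) \<union> S\<inverse>) X) \<and>
    2 * n * card (entering ((H - S) \<union> S\<inverse>) X) \<le> (n + 6) * card (crossing H X)"
  proof (rule near_balanced_orientation[OF finV HV])
    show "6 \<le> n" using n60 by linarith
  qed (use Hanti connH in auto)
  then obtain S where S: "S \<subseteq> H" and bal: "\<forall>X\<subseteq>V.
    (n - 6) * card (crossing H X) \<le> 2 * n * card (entering ((H - S) \<union> S\<inverse>) X) \<and>
    2 * n * card (entering ((H - S) \<union> S\<inverse>) X) \<le> (n + 6) * card (crossing H X)" by (elim exE conjE)
  define D where "D = (H - S) \<union> S\<inverse>"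
  have DV: "D \<subseteq> V \<times> V" using HV S by (auto simp: D_def)
  have finD: "finite D" using finV DV by (meson finite_SigmaI finite_subset)
  have Danti: "(y, x) \<notin> D" if "(x, y) \<in> D" for x y using that S by (auto simp: D_def H_def)
  have Dcol: "(x \<in> A) \<noteq> (y \<in> A)" if "(x, y) \<in> D" for x y using that S by (auto simp: D_def H_def)
  have Dloop: "(x, x) \<notin> D" for x using Danti by blast
  have undD: "und ` D = cut_edges E A"
  proof -
    have "und ` D = und ` ((H - S) \<union> S)" unfolding D_def image_Un und_converse ..
    also have "(H - S) \<union> S = H" using S by auto
    finally show ?thesis unfolding undH .
  qed
  have "V \<noteq> {}" using False by auto
  then obtain r where r: "r \<in> V" by auto
  have entD: "60 * m \<le> card (entering D X)" if X: "X \<subseteq> V - {r}" "X \<noteq> {}" for X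
  proof -
    have XV: "X \<subseteq> V" "X \<noteq> V" using X r by auto
    have "2 * n * (n - 6) = (n - 6) * (2 * n)" by (rule mult.commute)
    also have "\<dots> \<le> (n - 6) * card (crossing H X)"
      using connH[OF XV(1) X(2) XV(2)] by (rule mult_le_mono2)
    also have "\<dots> \<le> 2 * n * card (entering D X)" using bal XV(1) unfolding D_def by blast
    finally have "n - 6 \<le> card (entering D X)" using n60 m3 by simp
    then show ?thesis using n60 by linarith
  qed
  \<comment> \<open>\<open>24 * m\<close> serve the rounding in the first part;
    \<open>36 * m = 24 * m + 12 * m\<close> must be left for the other two reserves.\<close>
  have "\<exists>R\<subseteq>D. (\<forall>X\<subseteq>V - {r}. X \<noteq> {} \<longrightarrow> 24 * m \<le> card (entering R X) \<and> 36 * m \<le> card (entering (D - R) X)) \<and>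
    (\<forall>v. card {e \<in> R. snd e = v} \<le> 24 * m)"
  proof (rule branching_packing[OF finV finD DV r])
    fix X assume "X \<subseteq> V - {r}" "X \<noteq> {}"
    then show "24 * m + 36 * m \<le> card (entering D X)" using entD by simp
  qed
  then obtain R1 where R1: "R1 \<subseteq> D" "\<forall>X\<subseteq>V - {r}. X \<noteq> {} \<longrightarrow> 24 * m \<le> card (entering R1 X) \<and> 36 * m \<le> card (entering (D - R1) X)"
    "\<forall>v. card {e \<in> R1. snd e = v} \<le> 24 * m" by (elim exE conjE)
  have "\<exists>R\<subseteq>D - R1. (\<forall>X\<subseteq>V - {r}. X \<noteq> {} \<longrightarrow> 24 * m \<le> card (entering R X) \<and> 12 * m \<le> card (entering (D - R1 - R) X)) \<and>
    (\<forall>v. card {e \<in> R. snd e = v} \<le> 24 * m)"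
  proof (rule branching_packing[OF finV _ _ r])
    show "finite (D - R1)" "D - R1 \<subseteq> V \<times> V" using finD DV by auto
    fix X assume "X \<subseteq> V - {r}" "X \<noteq> {}"
    then have "36 * m \<le> card (entering (D - R1) X)" using R1(2) by simp
    then show "24 * m + 12 * m \<le> card (entering (D - R1) X)" by simp
  qed
  then obtain R2 where R2: "R2 \<subseteq> D - R1" "\<forall>X\<subseteq>V - {r}. X \<noteq> {} \<longrightarrow> 24 * m \<le> card (entering R2 X) \<and> 12 * m \<le> card (entering (D - R1 - R2) X)"
    "\<forall>v. card {e \<in> R2. snd e = v} \<le> 24 * m" by (elim exE conjE)
  have "\<exists>R\<subseteq>D - R1 - R2. (\<forall>X\<subseteq>V - {r}. X \<noteq> {} \<longrightarrow> 12 * m \<le> card (entering R X) \<and> 0 \<le> card (entering (D - R1 - R2 - R) X)) \<and>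
    (\<forall>v. card {e \<in> R. snd e = v} \<le> 12 * m)"
  proof (rule branching_packing[OF finV _ _ r])
    show "finite (D - R1 - R2)" "D - R1 - R2 \<subseteq> V \<times> V" using finD DV by auto
    fix X assume "X \<subseteq> V - {r}" "X \<noteq> {}"
    then show "12 * m + 0 \<le> card (entering (D - R1 - R2) X)" using R2(2) by simp
  qed
  then obtain R3 where R3: "R3 \<subseteq> D - R1 - R2" "\<forall>X\<subseteq>V - {r}. X \<noteq> {} \<longrightarrow> 12 * m \<le> card (entering R3 X) \<and> 0 \<le> card (entering (D - R1 - R2 - R3) X)"
    "\<forall>v. card {e \<in> R3. snd e = v} \<le> 12 * m" by (elim exE conjE)
  \<comment> \<open>The arcs that may be spent on inner edges: all but at most
    \<open>24 * m + 24 * m + 12 * m\<close> of those entering any vertex.\<close>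
  define Ow where "Ow = D - R1 - R2 - R3"
  have OwD: "Ow \<subseteq> D" by (auto simp: Ow_def)
  have inO: "in_deg D v \<le> in_deg Ow v + 60 * m" for v
  proof -
    have "in_deg (D - R1) v + in_deg R1 v = in_deg D v" by (rule in_deg_Diff[OF finD R1(1)])
    moreover have "in_deg (D - R1 - R2) v + in_deg R2 v = in_deg (D - R1) v"
      using finD by (intro in_deg_Diff[OF _ R2(1)]) simp
    moreover have "in_deg Ow v + in_deg R3 v = in_deg (D - R1 - R2) v"
      unfolding Ow_def using finD by (intro in_deg_Diff[OF _ R3(1)]) simp
    moreover have "in_deg R1 v \<le> 24 * m" "in_deg R2 v \<le> 24 * m" "in_deg R3 v \<le> 12 * m"
      using R1(3) R2(3) R3(3) by (auto simp: in_deg_def)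
    ultimately show ?thesis by linarith
  qed
  have outO: "out_deg Ow v \<le> out_deg D v" for v
    unfolding out_deg_def using finD OwD by (intro card_mono) auto
  let ?Q = "E - cut_edges E A"
  have "\<exists>W. und ` W \<subseteq> ?Q \<and> has_decomposition (bistar k l) (?Q - und ` W) \<and> finite W \<and>
    (\<forall>x y. (x, y) \<in> W \<longrightarrow> (y, x) \<notin> W) \<and> (\<forall>v. out_deg W v \<le> k + l - 2)"
  proof (rule strip_bistars[OF assms(1) kl])
    show "\<exists>u v. e = {u, v} \<and> u \<noteq> v" if "e \<in> ?Q" for e using EV[of e] that by blast
  qed (use finE in simp)
  then obtain W where W: "und ` W \<subseteq> ?Q" "has_decomposition (bistar k l) (?Q - und ` W)" "finite W"
    "\<forall>x y. (x, y) \<in> W \<longrightarrow> (y, x) \<notin> W" "\<forall>v. out_deg W v \<le> k + l - 2" by (elim exE conjE)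
  have WE: "{x, y} \<in> E" "{x, y} \<notin> cut_edges E A" if "(x, y) \<in> W" for x y
  proof -
    have "und (x, y) \<in> ?Q" using W(1) that by blast
    then show "{x, y} \<in> E" "{x, y} \<notin> cut_edges E A" by (simp_all add: und_def)
  qed
  have WV: "W \<subseteq> V \<times> V"
  proof (rule subrelI)
    fix x y assume "(x, y) \<in> W"
    then obtain u v where "{x, y} = {u, v}" "u \<in> V" "v \<in> V" using WE(1) EV by blast
    then show "(x, y) \<in> V \<times> V" by (auto simp: doubleton_eq_iff)
  qed
  have Wcol: "(x \<in> A) = (y \<in> A)" if "(x, y) \<in> W" for x y
    using WE[OF that] by (auto simp: cut_edges_def)
  have est: "7 * m * out_deg W v \<le> in_deg Ow v"
    "out_deg W v * (k - 1) + (out_deg Ow v div (7 * m) + 1) * (l - 1) + 1 \<le> in_deg Ow v" if v: "v \<in> V" for v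
  proof -
    let ?d = "card (crossing H {v})"
    have vV: "{v} \<noteq> V" using False by auto
    have d: "2 * n \<le> ?d" using v vV by (intro connH) auto
    have i: "(n - 6) * ?d \<le> 2 * n * in_deg D v"
      unfolding in_deg_entering[OF Dloop] using bal v unfolding D_def by simp
    have u: "2 * n * out_deg D v \<le> (n + 6) * ?d"
    proof -
      have "2 * n * card (entering D (V - {v})) \<le> (n + 6) * card (crossing H (V - {v}))"
        using bal unfolding D_def by simp
      then show ?thesis unfolding out_deg_entering[OF Dloop DV] crossing_Diff[OF HV] .
    qed
    have s: "out_deg W v \<le> m - 1" using W(5) assms(3) by (simp add: numeral_2_eq_2)
    show "7 * m * out_deg W v \<le> in_deg Ow v"
      by (rule degree_estimate(1)[OF m3 assms(3,1) kl n_def i u d inO s outO])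
    show "out_deg W v * (k - 1) + (out_deg Ow v div (7 * m) + 1) * (l - 1) + 1 \<le> in_deg Ow v"
      by (rule degree_estimate(2)[OF m3 assms(3,1) kl n_def i u d inO s outO])
  qed
  \<comment> \<open>About one arc in \<open>7 * m\<close> is a candidate for a central edge: few
    enough for the leaf edges demanded at the tails, yet enough for the at most \<open>m - 1\<close>
    inner arcs leaving each vertex.\<close>
  have "\<exists>U\<subseteq>Ow. has_decomposition (bistar k l) (und ` (W \<union> U))"
    by (rule absorb_inner_arcs[OF finV DV Danti Dcol WV _ Wcol OwD assms(1) kl _ est])
       (use W(4) m3 in auto)
  then obtain U where U: "U \<subseteq> Ow" "has_decomposition (bistar k l) (und ` (W \<union> U))" by (elim exE conjE)
  let ?D = "D - U"
  have A: "x \<in> A \<or> y \<in> A" if "(x, y) \<in> D" for x y using Dcol[OF that] by auto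
  define F where "F = arcs_from A ?D"
  have arcsAB: "arcs_from A R \<subseteq> A \<times> (V - A)" if "R \<subseteq> D" for R
  proof
    fix e assume e: "e \<in> arcs_from A R"
    obtain a b where ab: "e = (a, b)" by (cases e)
    then have "a \<in> A" "(a, b) \<in> D \<or> (b, a) \<in> D" using e that by (auto simp: arcs_from_def)
    then show "e \<in> A \<times> (V - A)" using Dcol[of a b] Dcol[of b a] DV ab by auto
  qed
  have FAB: "F \<subseteq> A \<times> (V - A)" unfolding F_def by (rule arcsAB) auto
  have finF: "finite F" using FAB finV AV by (meson finite_Diff finite_SigmaI finite_subset)
  have undF: "und ` F = und ` ?D" unfolding F_def by (rule und_arcs_from) (use A in auto)
  have disjoint: "arcs_from A R \<inter> arcs_from A R' = {}" if "R \<subseteq> D" "R' \<subseteq> D" "R \<inter> R' = {}" for R R'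
  proof (rule equals0I)
    fix e assume e: "e \<in> arcs_from A R \<inter> arcs_from A R'"
    obtain a b where "e = (a, b)" by (cases e)
    then have "(a, b) \<in> R \<or> (b, a) \<in> R" "(a, b) \<in> R' \<or> (b, a) \<in> R'" using e by (auto simp: arcs_from_def)
    then show False using that Danti[of a b] Danti[of b a] by blast
  qed
  have cross: "c \<le> card (crossing (arcs_from A R) X)"
    if R: "R \<subseteq> D" and c: "\<forall>X\<subseteq>V - {r}. X \<noteq> {} \<longrightarrow> c \<le> card (entering R X)"
      and X: "X \<subseteq> V" "X \<noteq> {}" "X \<noteq> V" for R X c
  proof -
    have ge: "c \<le> card (crossing (arcs_from A R) Y)" if Y: "Y \<subseteq> V - {r}" "Y \<noteq> {}" for Y
    proof -
      have "c \<le> card (entering R Y)" using c Y by blast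
      also have "\<dots> \<le> card (crossing (arcs_from A R) Y)"
      proof (rule crossing_arcs_from)
        show "finite R" using R finD by (rule finite_subset)
      qed (use R Danti A in blast)+
      finally show ?thesis .
    qed
    show ?thesis
    proof (cases "r \<in> X")
      case False
      then show ?thesis using X by (intro ge) auto
    next
      \<comment> \<open>Branchings control only sets that avoid the root; crossings are symmetric,
        so the complement of \<open>X\<close> serves instead.\<close>
      case True
      have "arcs_from A R \<subseteq> V \<times> V" using arcsAB[OF R] AV by auto
      then have "crossing (arcs_from A R) (V - X) = crossing (arcs_from A R) X" by (rule crossing_Diff)
      moreover have "c \<le> card (crossing (arcs_from A R) (V - X))" using True X by (intro ge) auto
      ultimately show ?thesis by simp
    qed
  qed
  have RD: "R1 \<subseteq> D" "R2 \<subseteq> D" "R3 \<subseteq> D" using R1(1) R2(1) R3(1) by auto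
  have RU: "R1 \<subseteq> ?D" "R2 \<subseteq> ?D" "R3 \<subseteq> ?D" using R1(1) R2(1) R3(1) U(1) by (auto simp: Ow_def)
  have mono: "arcs_from A R \<subseteq> F" if "R \<subseteq> ?D" for R using that unfolding F_def arcs_from_def by auto
  have VA: "A \<union> (V - A) = V" using AV by auto
  \<comment> \<open>Everything already decomposed: the degenerate edges with the arcs
    \<open>U\<close> they absorbed, and the bistars removed from inside the two sides.\<close>
  let ?rest = "und ` (W \<union> U) \<union> (?Q - und ` W)"
  have UD: "und ` U \<subseteq> cut_edges E A" unfolding undD[symmetric] using U(1) OwD by blast
  have undDU: "und ` ?D = cut_edges E A - und ` U"
    unfolding undD[symmetric] using inj_on_image_set_diff[OF inj_on_und_antisym[OF Danti], of D U] U(1) OwD by blast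
  have decrest: "has_decomposition (bistar k l) ?rest"
    by (rule has_decomposition_Un[OF U(2) W(2)]) (use UD in blast)
  have E: "und ` F \<union> ?rest = E"
    unfolding undF undDU image_Un using W(1) UD by (auto simp: cut_edges_def)
  have Fdisj: "und ` F \<inter> ?rest = {}"
    unfolding undF undDU image_Un using W(1) by blast
  have "m dvd card F"
  proof -
    have "und ` F \<subseteq> E" "?rest \<subseteq> E" using E by (metis Un_upper1, metis Un_upper2)
    then have fin: "finite (und ` F)" "finite ?rest" using finE by (metis finite_subset)+
    have "card E = card (und ` F) + card ?rest"
      using card_Un_disjoint[OF fin Fdisj] by (simp only: E)
    moreover have "m dvd card ?rest"
    proof -
      have "card (bistar k l) = m" using card_bistar[of k l] assms(1-3) by simp
      then show ?thesis using has_decomposition_dvd[OF decrest] fin(2) by simp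
    qed
    moreover have "card (und ` F) = card F"
      by (rule card_image[OF inj_on_subset[OF inj_on_und FAB]]) auto
    ultimately show ?thesis using assms(6) by (simp add: dvd_add_left_iff)
  qed
  then have "has_decomposition (bistar k l) (und ` F)"
  proof (intro bipartite_bistars[where ?R1.0 = "arcs_from A R1" and ?R2.0 = "arcs_from A R2" and ?R3.0 = "arcs_from A R3" and m = m,
        OF _ _ _ FAB _ _ _ _ _ assms(1-3)])
    show "finite A" "finite (V - A)" "A \<inter> (V - A) = {}" using finV AV by (auto intro: finite_subset)
    show "arcs_from A R1 \<subseteq> F" "arcs_from A R2 \<subseteq> F" "arcs_from A R3 \<subseteq> F" by (rule mono[OF RU(1)], rule mono[OF RU(2)], rule mono[OF RU(3)])
    show "arcs_from A R1 \<inter> arcs_from A R2 = {}" using R2(1) by (intro disjoint RD) auto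
    show "arcs_from A R3 \<inter> (arcs_from A R1 \<union> arcs_from A R2) = {}"
      using disjoint[OF RD(3,1)] disjoint[OF RD(3,2)] R3(1) by blast
    show "24 * m \<le> card (crossing (arcs_from A R1) X)" if "X \<subseteq> A \<union> (V - A)" "X \<noteq> {}" "X \<noteq> A \<union> (V - A)" for X
      using that R1(2) unfolding VA by (intro cross RD) auto
    show "24 * m \<le> card (crossing (arcs_from A R2) X)" if "X \<subseteq> A \<union> (V - A)" "X \<noteq> {}" "X \<noteq> A \<union> (V - A)" for X
      using that R2(2) unfolding VA by (intro cross RD) auto
    show "12 * m \<le> card (crossing (arcs_from A R3) X)" if "X \<subseteq> A \<union> (V - A)" "X \<noteq> {}" "X \<noteq> A \<union> (V - A)" for X
      using that R3(2) unfolding VA by (intro cross RD) auto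
  qed
  then have "has_decomposition (bistar k l) (und ` F \<union> ?rest)"
    using decrest Fdisj by (rule has_decomposition_Un)
  then show ?thesis unfolding E .
qed

end
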